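(* Let $1<p<\infty$ and $\lambda\in(0,n)$. Let $L$ be a linear operator of type $\omega$ on $\mathrm{L}^2(\mathbb R^n)$ with $\omega<\pi/2$, generating an analytic semigroup $e^{-tL}$ whose kernels $p_t(x,y)$ satisfy the heat kernel bounds stated in the context. Assume that for each $t>0$ the kernel $p_t(x,y)$ is Hölder continuous in both variables $x,y$ and that there exist constants $\beta>0$, $0<\gamma\le1$ and $c>0$ such that, with the same $m>0$ as in the heat kernel bounds, $$|p_t(x,y)|\le c\,\frac{t^{\beta/m}}{(t^{1/m}+|x-y|)^{n+\beta}}\qquad\forall\,t>0,\ x,y\in\mathbb R^n,$$ $$|p_t(x+h,y)-p_t(x,y)|+|p_t(x,y+h)-p_t(x,y)|\le c\,|h|^\gamma\frac{t^{\beta/m}}{(t^{1/m}+|x-y|)^{n+\beta+\gamma}}$$ for all $t>0$ and $x,y,h\in\mathbb R^n$ with $2|h|\le t^{1/m}+|x-y|$, and $$\int_{\mathbb R^n}p_t(x,y)\,dx=\int_{\mathbb R^n}p_t(x,y)\,dy=1\qquad\forall\,t>0.$$ Then $\mathrm{L}^{p,\lambda}_L(\mathbb R^n)$ and $\mathrm{L}^{p,\lambda}(\mathbb R^n)$ coincide, and their norms $\|\cdot\|_{\mathrm{L}^{p,\lambda}_L}$ and $\|\cdot\|_{\mathrm{L}^{p,\lambda}}$ are equivalent.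
   Context: Type $\omega$: $L$ is closed, its spectrum is contained in $S_\omega=\{z\in\mathbb C:|\arg z|\le\omega\}\cup\{0\}$, and for each $\nu>\omega$ there is $c_\nu$ with $\|(L-\zeta \mathcal I)^{-1}\|_{\mathrm{L}^2\to \mathrm{L}^2}\le c_\nu|\zeta|^{-1}$ for all $\zeta\notin S_\nu$; for $\omega<\pi/2$, $L$ generates an analytic semigroup $e^{-zL}$, $0\le|\arg z|<\pi/2-\omega$. Heat kernel bounds: for $t>0$, $e^{-tL}$ is represented by a kernel $p_t(x,y)$ with $|p_t(x,y)|\le c\,t^{-n/m}g\big(|x-y|/t^{1/m}\big)$ for all $x,y\in\mathbb R^n$, where $m>0$ is a constant and $g$ is a positive, bounded, decreasing function with $\lim_{r\to\infty}r^{n+\epsilon}g(r)=0$ for some $\epsilon>0$. Function class $\mathcal M_p$: for $\beta'>0$, $\mathcal M_{(p;\beta')}$ is the set of complex-valued $f\in \mathrm{L}^p_{\rm loc}(\mathbb R^n)$ with $\int_{\mathbb R^n}|f(x)|^p(1+|x|)^{-(n+\beta')}dx<\infty$. Put $\Theta(L)=\sup\{\epsilon>0:\lim_{r\to\infty}r^{n+\epsilon}g(r)=0\}$, where $g$ is the function in the heat kernel bound. Then $\mathcal M_p=\mathcal M_{(p;\Theta(L))}$ if $\Theta(L)<\infty$ and $\mathcal M_p=\bigcup_{0<\beta'<\infty}\mathcal M_{(p;\beta')}$ if $\Theta(L)=\infty$. For $f\in\mathcal M_p$ and $t>0$, $P_tf(x)=e^{-tL}f(x)=\int_{\mathbb R^n}p_t(x,y)f(y)\,dy$.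 Morrey spaces: balls $B$ are Euclidean open balls with radius $r_B$; $f_B=|B|^{-1}\int_Bf(x)\,dx$; $t_B=r_B^m$. The space $\mathrm{L}^{p,\lambda}(\mathbb R^n)$ consists of all complex-valued $f\in \mathrm{L}^p_{\rm loc}(\mathbb R^n)$ with $$\|f\|_{\mathrm{L}^{p,\lambda}}=\sup_{B\subset\mathbb R^n}\Big[r_B^{-\lambda}\int_B|f(x)-f_B|^pdx\Big]^{1/p}<\infty .$$ The space $\mathrm{L}^{p,\lambda}_L(\mathbb R^n)$ consists of all $f\in\mathcal M_p$ with $$\|f\|_{\mathrm{L}^{p,\lambda}_L}=\sup_{B\subset\mathbb R^n}\Big[r_B^{-\lambda}\int_B|f(x)-P_{t_B}f(x)|^pdx\Big]^{1/p}<\infty .$$ These "norms" are seminorms; $\|\cdot\|_{\mathrm{L}^{p,\lambda}}$ vanishes on constants and $\|\cdot\|_{\mathrm{L}^{p,\lambda}_L}$ vanishes on $\mathcal K_{L,p}=\{f\in\mathcal M_p:P_tf(x)=f(x)\text{ for a.a. }x\in\mathbb R^n\text{ and all }t>0\}$, and the two spaces are understood modulo constants and modulo $\mathcal K_{L,p}$, respectively. *)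

theory Defs
  imports "HOL-Analysis.Analysis"
begin

section \<open>Operators on \<open>L\<^sup>2\<close>\<close>

text \<open>
  Elements of \<open>L\<^sup>2\<close> are represented by Lebesgue measurable functions, and equality in \<open>L\<^sup>2\<close> is
  almost-everywhere equality \<open>ae_eq\<close>. Operators act on representatives, respect \<open>ae_eq\<close>, and are
  only constrained on their domain.
\<close>

definition ae_eq :: "('a::euclidean_space \<Rightarrow> complex) \<Rightarrow> ('a \<Rightarrow> complex) \<Rightarrow> bool" where
  "ae_eq f g \<longleftrightarrow> (AE x in lebesgue. f x = g x)"

definition L2 :: "('a::euclidean_space \<Rightarrow> complex) set" where
  "L2 = {f \<in> borel_measurable lebesgue. integrable lebesgue (\<lambda>x. (norm (f x))\<^sup>2)}"

definition l2norm :: "('a::euclidean_space \<Rightarrow> complex) \<Rightarrow> real" where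
  "l2norm f = sqrt (integral\<^sup>L lebesgue (\<lambda>x. (norm (f x))\<^sup>2))"

definition L2_tendsto ::
  "('i \<Rightarrow> 'a::euclidean_space \<Rightarrow> complex) \<Rightarrow> ('a \<Rightarrow> complex) \<Rightarrow> 'i filter \<Rightarrow> bool" where
  "L2_tendsto u f F \<longleftrightarrow> ((\<lambda>i. l2norm (\<lambda>x. u i x - f x)) \<longlongrightarrow> 0) F"

definition L2_linear_op ::
  "('a::euclidean_space \<Rightarrow> complex) set \<Rightarrow> (('a \<Rightarrow> complex) \<Rightarrow> 'a \<Rightarrow> complex) \<Rightarrow> bool" where
  "L2_linear_op D L \<longleftrightarrow>
     D \<subseteq> L2 \<and> L ` D \<subseteq> L2 \<and> (\<lambda>_. 0) \<in> D \<and>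
     (\<forall>f\<in>D. \<forall>g\<in>L2. ae_eq f g \<longrightarrow> g \<in> D \<and> ae_eq (L f) (L g)) \<and>
     (\<forall>f\<in>D. \<forall>g\<in>D. (\<lambda>x. f x + g x) \<in> D \<and> ae_eq (L (\<lambda>x. f x + g x)) (\<lambda>x. L f x + L g x)) \<and>
     (\<forall>c. \<forall>f\<in>D. (\<lambda>x. c * f x) \<in> D \<and> ae_eq (L (\<lambda>x. c * f x)) (\<lambda>x. c * L f x))"

definition L2_closed_op ::
  "('a::euclidean_space \<Rightarrow> complex) set \<Rightarrow> (('a \<Rightarrow> complex) \<Rightarrow> 'a \<Rightarrow> complex) \<Rightarrow> bool" where
  "L2_closed_op D L \<longleftrightarrow>
     (\<forall>u f h. (\<forall>i::nat. u i \<in> D) \<and> f \<in> L2 \<and> h \<in> L2 \<and>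
        L2_tendsto u f sequentially \<and> L2_tendsto (\<lambda>i. L (u i)) h sequentially
        \<longrightarrow> f \<in> D \<and> ae_eq (L f) h)"

definition L2_onorm :: "(('a::euclidean_space \<Rightarrow> complex) \<Rightarrow> 'a \<Rightarrow> complex) \<Rightarrow> ennreal" where
  "L2_onorm T = (SUP f\<in>{f \<in> L2. l2norm f \<le> 1}. ennreal (l2norm (T f)))"

definition L2_bounded_op :: "(('a::euclidean_space \<Rightarrow> complex) \<Rightarrow> 'a \<Rightarrow> complex) \<Rightarrow> bool" where
  "L2_bounded_op T \<longleftrightarrow> L2_linear_op L2 T \<and> L2_onorm T < \<infinity>"

text \<open>\<open>L2_resolvent D L \<zeta> R\<close> says that \<open>R\<close> is the bounded inverse \<open>(L - \<zeta>)\<^sup>-\<^sup>1\<close>.\<close>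

definition L2_resolvent ::
  "('a::euclidean_space \<Rightarrow> complex) set \<Rightarrow> (('a \<Rightarrow> complex) \<Rightarrow> 'a \<Rightarrow> complex) \<Rightarrow>
     complex \<Rightarrow> (('a \<Rightarrow> complex) \<Rightarrow> 'a \<Rightarrow> complex) \<Rightarrow> bool" where
  "L2_resolvent D L \<zeta> R \<longleftrightarrow>
     L2_bounded_op R \<and>
     (\<forall>h\<in>L2. R h \<in> D \<and> ae_eq (\<lambda>x. L (R h) x - \<zeta> * R h x) h) \<and>
     (\<forall>f\<in>D. ae_eq (R (\<lambda>x. L f x - \<zeta> * f x)) f)"

definition L2_spectrum ::
  "('a::euclidean_space \<Rightarrow> complex) set \<Rightarrow> (('a \<Rightarrow> complex) \<Rightarrow> 'a \<Rightarrow> complex) \<Rightarrow> complex set" where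
  "L2_spectrum D L = {\<zeta>. \<nexists>R. L2_resolvent D L \<zeta> R}"

definition closed_sector :: "real \<Rightarrow> complex set" where
  "closed_sector \<omega> = {z. \<bar>Arg z\<bar> \<le> \<omega>} \<union> {0}"

definition open_sector :: "real \<Rightarrow> complex set" where
  "open_sector \<theta> = {z. z \<noteq> 0 \<and> \<bar>Arg z\<bar> < \<theta>}"

definition op_type ::
  "real \<Rightarrow> ('a::euclidean_space \<Rightarrow> complex) set \<Rightarrow> (('a \<Rightarrow> complex) \<Rightarrow> 'a \<Rightarrow> complex) \<Rightarrow> bool" where
  "op_type \<omega> D L \<longleftrightarrow>
     L2_linear_op D L \<and> L2_closed_op D L \<and> L2_spectrum D L \<subseteq> closed_sector \<omega> \<and>
     (\<forall>\<nu>>\<omega>. \<exists>c>0. \<forall>\<zeta>. \<zeta> \<notin> closed_sector \<nu> \<longrightarrow>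
        (\<forall>R. L2_resolvent D L \<zeta> R \<longrightarrow> L2_onorm R \<le> ennreal (c / norm \<zeta>)))"

text \<open>
  \<open>T z\<close> plays the role of \<open>e\<^sup>-\<^sup>z\<^sup>L\<close>: a semigroup on the sector \<open>\<bar>arg z\<bar> < \<theta>\<close>, holomorphic in operator
  norm, strongly continuous at \<open>0\<close> in every smaller closed sector, and with infinitesimal generator
  \<open>-L\<close>, domain included. For \<open>L\<close> of type \<open>\<omega> < \<pi>/2\<close> and \<open>\<theta> = \<pi>/2 - \<omega>\<close> these conditions
  determine \<open>T z\<close> uniquely as an operator on \<open>L\<^sup>2\<close>.
\<close>

definition generates_analytic_semigroup ::
  "real \<Rightarrow> ('a::euclidean_space \<Rightarrow> complex) set \<Rightarrow> (('a \<Rightarrow> complex) \<Rightarrow> 'a \<Rightarrow> complex) \<Rightarrow>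
     (complex \<Rightarrow> ('a \<Rightarrow> complex) \<Rightarrow> 'a \<Rightarrow> complex) \<Rightarrow> bool" where
  "generates_analytic_semigroup \<theta> D L T \<longleftrightarrow>
     (\<forall>z\<in>open_sector \<theta> \<union> {0}. L2_bounded_op (T z)) \<and>
     (\<forall>f\<in>L2. ae_eq (T 0 f) f) \<and>
     (\<forall>z\<in>open_sector \<theta> \<union> {0}. \<forall>w\<in>open_sector \<theta> \<union> {0}. \<forall>f\<in>L2.
        ae_eq (T (z + w) f) (T z (T w f))) \<and>
     (\<forall>z\<in>open_sector \<theta>. \<exists>T'. L2_bounded_op T' \<and>
        ((\<lambda>w. L2_onorm (\<lambda>f x. (T w f x - T z f x) / (w - z) - T' f x)) \<longlongrightarrow> 0) (at z)) \<and>
     (\<forall>\<theta>'\<in>{0..<\<theta>}. \<forall>f\<in>L2. L2_tendsto (\<lambda>z. T z f) f (at 0 within closed_sector \<theta>')) \<and>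
     (\<forall>f\<in>L2. f \<in> D \<longleftrightarrow>
        (\<exists>h\<in>L2. L2_tendsto (\<lambda>t x. (T (of_real t) f x - f x) / of_real t) h (at_right (0::real)))) \<and>
     (\<forall>f\<in>D. L2_tendsto (\<lambda>t x. (T (of_real t) f x - f x) / of_real t) (\<lambda>x. - L f x)
               (at_right (0::real)))"

section \<open>Heat kernel bounds\<close>

definition heat_kernel_profile :: "real \<Rightarrow> (real \<Rightarrow> real) \<Rightarrow> bool" where
  "heat_kernel_profile n g \<longleftrightarrow>
     (\<forall>r\<ge>0. g r > 0) \<and> (\<exists>M. \<forall>r\<ge>0. g r \<le> M) \<and> antimono_on {0..} g \<and>
     (\<exists>\<epsilon>>0. ((\<lambda>r. r powr (n + \<epsilon>) * g r) \<longlongrightarrow> 0) at_top)"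

definition heat_kernel_bounds ::
  "(complex \<Rightarrow> ('a::euclidean_space \<Rightarrow> complex) \<Rightarrow> 'a \<Rightarrow> complex) \<Rightarrow> real \<Rightarrow> (real \<Rightarrow> real) \<Rightarrow>
     (real \<Rightarrow> 'a \<Rightarrow> 'a \<Rightarrow> complex) \<Rightarrow> bool" where
  "heat_kernel_bounds T m g k \<longleftrightarrow>
     m > 0 \<and> heat_kernel_profile (real DIM('a)) g \<and>
     (\<forall>t>0. \<forall>f\<in>L2. AE x in lebesgue.
        T (of_real t) f x = integral\<^sup>L lebesgue (\<lambda>y. k t x y * f y)) \<and>
     (\<exists>c>0. \<forall>t>0. \<forall>x y.
        norm (k t x y) \<le> c * t powr (- real DIM('a) / m) * g (norm (x - y) / t powr (1 / m)))"

definition Theta :: "real \<Rightarrow> (real \<Rightarrow> real) \<Rightarrow> ereal" where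
  "Theta n g = (SUP \<epsilon>\<in>{\<epsilon>. \<epsilon> > 0 \<and> ((\<lambda>r. r powr (n + \<epsilon>) * g r) \<longlongrightarrow> 0) at_top}. ereal \<epsilon>)"

section \<open>Function spaces\<close>

definition Lp_loc :: "real \<Rightarrow> ('a::euclidean_space \<Rightarrow> complex) set" where
  "Lp_loc p = {f \<in> borel_measurable lebesgue.
     \<forall>K. compact K \<longrightarrow> set_integrable lebesgue K (\<lambda>x. norm (f x) powr p)}"

definition M_weighted :: "real \<Rightarrow> real \<Rightarrow> ('a::euclidean_space \<Rightarrow> complex) set" where
  "M_weighted p b = {f \<in> Lp_loc p.
     integrable lebesgue (\<lambda>x. norm (f x) powr p * (1 + norm x) powr (- (real DIM('a) + b)))}"

definition M_class :: "real \<Rightarrow> (real \<Rightarrow> real) \<Rightarrow> ('a::euclidean_space \<Rightarrow> complex) set" where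
  "M_class p g =
     (let \<Theta> = Theta (real DIM('a)) g in
      if \<Theta> < \<infinity> then M_weighted p (real_of_ereal \<Theta>) else (\<Union>b\<in>{0<..}. M_weighted p b))"

definition heat_ext ::
  "(real \<Rightarrow> 'a::euclidean_space \<Rightarrow> 'a \<Rightarrow> complex) \<Rightarrow> real \<Rightarrow> ('a \<Rightarrow> complex) \<Rightarrow> 'a \<Rightarrow> complex" where
  "heat_ext k t f x = integral\<^sup>L lebesgue (\<lambda>y. k t x y * f y)"

definition ball_avg :: "('a::euclidean_space \<Rightarrow> complex) \<Rightarrow> 'a \<Rightarrow> real \<Rightarrow> complex" where
  "ball_avg f x r = set_lebesgue_integral lebesgue (ball x r) f /\<^sub>R measure lebesgue (ball x r)"

text \<open>The \<open>p\<close>-th root on the extended nonnegative reals (for \<open>p > 0\<close>).\<close>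

definition ennreal_root :: "real \<Rightarrow> ennreal \<Rightarrow> ennreal" where
  "ennreal_root p a = (if a = \<infinity> then \<infinity> else ennreal (enn2real a powr (1 / p)))"

text \<open>
  The supremum common to both Morrey seminorms; \<open>a x r\<close> is the function that is subtracted from
  \<open>f\<close> on the ball with centre \<open>x\<close> and radius \<open>r\<close>.
\<close>

definition morrey_sup ::
  "real \<Rightarrow> real \<Rightarrow> ('a::euclidean_space \<Rightarrow> real \<Rightarrow> 'a \<Rightarrow> complex) \<Rightarrow> ('a \<Rightarrow> complex) \<Rightarrow> ennreal" where
  "morrey_sup p lam a f =
     (SUP (x, r)\<in>UNIV \<times> {0<..}. ennreal_root p
        (ennreal (r powr (- lam)) *
          (\<integral>\<^sup>+y\<in>ball x r. ennreal (norm (f y - a x r y) powr p) \<partial>lebesgue)))"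

definition morrey_seminorm ::
  "real \<Rightarrow> real \<Rightarrow> ('a::euclidean_space \<Rightarrow> complex) \<Rightarrow> ennreal" where
  "morrey_seminorm p lam f = morrey_sup p lam (\<lambda>x r y. ball_avg f x r) f"

definition morrey_space :: "real \<Rightarrow> real \<Rightarrow> ('a::euclidean_space \<Rightarrow> complex) set" where
  "morrey_space p lam = {f \<in> Lp_loc p. morrey_seminorm p lam f < \<infinity>}"

definition morreyL_seminorm ::
  "real \<Rightarrow> (real \<Rightarrow> 'a::euclidean_space \<Rightarrow> 'a \<Rightarrow> complex) \<Rightarrow> real \<Rightarrow> real \<Rightarrow>
     ('a \<Rightarrow> complex) \<Rightarrow> ennreal" where
  "morreyL_seminorm m k p lam f = morrey_sup p lam (\<lambda>x r. heat_ext k (r powr m) f) f"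

definition morreyL_space ::
  "real \<Rightarrow> (real \<Rightarrow> real) \<Rightarrow> (real \<Rightarrow> 'a::euclidean_space \<Rightarrow> 'a \<Rightarrow> complex) \<Rightarrow> real \<Rightarrow> real \<Rightarrow>
     ('a \<Rightarrow> complex) set" where
  "morreyL_space m g k p lam = {f \<in> M_class p g. morreyL_seminorm m k p lam f < \<infinity>}"

definition const_fns :: "('a::euclidean_space \<Rightarrow> complex) set" where
  "const_fns = {f. \<exists>c. ae_eq f (\<lambda>_. c)}"

definition kernelL ::
  "(real \<Rightarrow> real) \<Rightarrow> (real \<Rightarrow> 'a::euclidean_space \<Rightarrow> 'a \<Rightarrow> complex) \<Rightarrow> real \<Rightarrow>
     ('a \<Rightarrow> complex) set" where
  "kernelL g k p = {f \<in> M_class p g. \<forall>t>0. ae_eq (heat_ext k t f) f}"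

definition mod_rel ::
  "('a::euclidean_space \<Rightarrow> complex) set \<Rightarrow> ('a \<Rightarrow> complex) set \<Rightarrow>
     (('a \<Rightarrow> complex) \<times> ('a \<Rightarrow> complex)) set" where
  "mod_rel A N = {(f, h). f \<in> A \<and> h \<in> A \<and> (\<lambda>x. f x - h x) \<in> N}"

text \<open>
  The spaces are understood modulo constants and modulo \<open>kernelL\<close>. They coincide in the sense that
  \<open>f \<mapsto> f\<close> maps \<open>morrey_space\<close> into \<open>morreyL_space\<close> and induces a bijection of the two
  quotients: a class \<open>X\<close> modulo constants is sent to the class modulo \<open>kernelL\<close> containing \<open>X\<close>.
  Plain equality of the two sets of functions fails already for the heat semigroup, since
  \<open>kernelL\<close> then contains all harmonic polynomials.
\<close>

definition morrey_spaces_coincide ::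
  "real \<Rightarrow> (real \<Rightarrow> real) \<Rightarrow> (real \<Rightarrow> 'a::euclidean_space \<Rightarrow> 'a \<Rightarrow> complex) \<Rightarrow> real \<Rightarrow> real \<Rightarrow> bool" where
  "morrey_spaces_coincide m g k p lam \<longleftrightarrow>
     morrey_space p lam \<subseteq> morreyL_space m g k p lam \<and>
     bij_betw (\<lambda>X. mod_rel (morreyL_space m g k p lam) (kernelL g k p) `` X)
       (morrey_space p lam // mod_rel (morrey_space p lam) const_fns)
       (morreyL_space m g k p lam // mod_rel (morreyL_space m g k p lam) (kernelL g k p))"

text \<open>Here \<open>f\<close> and \<open>h\<close> range over all representatives of corresponding classes.\<close>

definition morrey_norms_equivalent ::
  "real \<Rightarrow> (real \<Rightarrow> real) \<Rightarrow> (real \<Rightarrow> 'a::euclidean_space \<Rightarrow> 'a \<Rightarrow> complex) \<Rightarrow> real \<Rightarrow> real \<Rightarrow> bool" where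
  "morrey_norms_equivalent m g k p lam \<longleftrightarrow>
     (\<exists>C>0. \<forall>f\<in>morrey_space p lam. \<forall>h\<in>morreyL_space m g k p lam.
        (\<lambda>x. f x - h x) \<in> kernelL g k p \<longrightarrow>
        morreyL_seminorm m k p lam h \<le> ennreal C * morrey_seminorm p lam f \<and>
        morrey_seminorm p lam f \<le> ennreal C * morreyL_seminorm m k p lam h)"

end

(*
  Put P_t = heat_ext k t and mu = (n - lam) / p > 0. Modulo constants a Campanato function f is a
  Morrey function: its averages over concentric balls form a dyadic chain with geometrically
  decaying steps, so they converge to one constant l as the radius grows, and
  |f_B - l| <= C r_B^(-mu). For F with int_B |F|^p <= S^p r_B^lam one has |P_t F| <= C S t^(-mu/m),
  which bounds the L-seminorm of f = F + l since P_t preserves constants.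

  Conversely, let h have L-seminorm at most S. For t and s comparable,
  P_t h - P_(t+s) h = P_t (h - P_s h) is at most C S t^(-mu/m), hence so is P_t h - P_t' h for
  t <= t' <= 2 t. Thus P_t h converges uniformly, as t tends to infinity, to a function u with
  |P_t h - u| <= C S t^(-mu/m). The semigroup law gives P_t u = u, and h - u is a Morrey function in
  the class of h modulo the kernel. Finally, a Morrey function fixed by all P_t is 0, because P_t F
  tends to 0, so two Campanato functions that agree modulo the kernel differ by a constant.
*)

theory Submission
  imports Defs
begin

section \<open>Weights with polynomial decay\<close>

text \<open>The obstacle is that the functions concerned lie outside L2. A member of
  \<open>M_class p g\<close> may grow polynomially, and the exponent \<open>Theta\<close> that
  governs this growth need not itself be an admissible decay rate of the kernel. Because
  \<open>p > 1\<close>, there is an admissible \<open>e > b / p\<close> for the growth exponent b of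
  the function, and then the function lies in \<open>weighted_L1 e\<close>, where all integrals P_t
  F converge absolutely and which every P_t maps into itself. The semigroup law is given only almost
  everywhere on L2; truncation, dominated convergence and continuity of P_t F carry it over to
  \<open>weighted_L1 e\<close> and to every point.

  The exponent obtained in this way depends on the function. Two exponents therefore run through the
  heat estimates: a fixed \<open>e\<close>, from which the uniform constants come, and an
  \<open>e'\<close>, which only guarantees convergence. The kernel at time t lives at the length
  scale t^(1/m), so all that these estimates ask of F is a bound for the averages of its modulus
  over balls of one radius not much larger than that scale.\<close>

lemma sigma_finite_lebesgue: "sigma_finite_measure (lebesgue :: 'a::euclidean_space measure)"
proof (unfold_locales)
  show "\<exists>A::'a set set. countable A \<and> A \<subseteq> sets lebesgue \<and> \<Union>A = space lebesgue \<and>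
      (\<forall>a\<in>A. emeasure lebesgue a \<noteq> (\<infinity>::ennreal))"
  proof (intro exI[of _ "range (\<lambda>j. ball (0::'a) (real j))"] conjI)
    show "\<Union> (range (\<lambda>j. ball (0::'a) (real j))) = space lebesgue"
      using reals_Archimedean2 by auto
  qed (auto simp: emeasure_ball)
qed

interpretation lebesgue: sigma_finite_measure "lebesgue :: 'a::euclidean_space measure"
  by (rule sigma_finite_lebesgue)

text \<open>Provides Tonelli over \<open>lebesgue\<close> itself: the functions concerned are
  Lebesgue measurable and need not be Borel.\<close>

interpretation lebesgue_pair: pair_sigma_finite
  "lebesgue :: 'a::euclidean_space measure" "lebesgue :: 'b::euclidean_space measure" ..

abbreviation ball_vol :: "'a::euclidean_space itself \<Rightarrow> real" where
  "ball_vol _ \<equiv> unit_ball_vol (real DIM('a))"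

lemma unit_ball_vol_nonzero [simp]: "n \<ge> 0 \<Longrightarrow> unit_ball_vol n \<noteq> 0"
  using unit_ball_vol_pos[of n] by (simp del: unit_ball_vol_pos)

lemma emeasure_lborel_ball:
  fixes x :: "'a::euclidean_space"
  assumes "r > 0"
  shows "emeasure lborel (ball x r) = ennreal (ball_vol TYPE('a) * r powr DIM('a))"
  using assms by (simp add: emeasure_ball powr_realpow)

lemma measure_lborel_ball:
  fixes x :: "'a::euclidean_space"
  assumes "r > 0"
  shows "measure lborel (ball x r) = ball_vol TYPE('a) * r powr DIM('a)"
  using assms by (simp add: measure_def emeasure_lborel_ball)

lemma id_lebesgue_borel [measurable]: "(\<lambda>x. x) \<in> lebesgue \<rightarrow>\<^sub>M borel"
  by (simp add: measurable_completion)

lemma ball_lebesgue [measurable]: "ball x r \<in> sets lebesgue"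
  by simp

text \<open>This is the L1-normalised dilation \<open>\<tau>^(-n) \<phi>(x / \<tau>)\<close> of the
  profile \<open>\<phi>(z) = (1 + |z|)^(-(n + e))\<close>, with \<open>\<tau>\<close> a length.
  Hence its integral does not depend on \<open>\<tau>\<close>, and at \<open>\<tau> = 1\<close> it
  is the weight of \<open>M_weighted\<close>.\<close>

definition decay_wt :: "real \<Rightarrow> real \<Rightarrow> 'a::euclidean_space \<Rightarrow> real" where
  "decay_wt e \<tau> x = \<tau> powr e / (\<tau> + norm x) powr (real DIM('a) + e)"

lemma decay_wt_nonneg [simp]: "0 \<le> decay_wt e \<tau> x"
  by (simp add: decay_wt_def)

lemma decay_wt_minus [simp]: "decay_wt e \<tau> (- x) = decay_wt e \<tau> x"
  by (simp add: decay_wt_def)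

lemma decay_wt_commute: "decay_wt e \<tau> (x - y) = decay_wt e \<tau> (y - x)"
  by (simp add: decay_wt_def norm_minus_commute)

lemma decay_wt_borel [measurable]: "decay_wt e \<tau> \<in> borel_measurable borel"
  unfolding decay_wt_def by measurable

text \<open>A displacement by at most r multiplies \<open>\<tau> + norm x\<close> by at most
  \<open>1 + r / \<tau>\<close>. The loss thus depends only on r measured in units of the scale,
  which keeps later constants independent of time.\<close>

lemma decay_wt_le_shift:
  fixes x :: "'a::euclidean_space"
  assumes "\<tau> > 0" "e > 0" "r \<ge> 0" "norm (x - y) \<le> r"
  shows "decay_wt e \<tau> x \<le> (1 + r / \<tau>) powr (real DIM('a) + e) * decay_wt e \<tau> y"
proof -
  let ?N = "real DIM('a) + e"
  have "norm y \<le> norm x + r"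
    using assms norm_triangle_ineq4[of x "x - y"] by simp
  then have "\<tau> + norm y \<le> \<tau> + norm x + r" by simp
  also have "\<dots> \<le> (1 + r / \<tau>) * (\<tau> + norm x)"
    using assms by (simp add: field_simps)
  finally have "(\<tau> + norm y) powr ?N \<le> ((1 + r / \<tau>) * (\<tau> + norm x)) powr ?N"
    using assms by (intro powr_mono2) auto
  also have "\<dots> = (1 + r / \<tau>) powr ?N * (\<tau> + norm x) powr ?N"
    using assms by (intro powr_mult)
  finally have *: "(\<tau> + norm y) powr ?N \<le> (1 + r / \<tau>) powr ?N * (\<tau> + norm x) powr ?N" .
  have pos: "(\<tau> + norm x) powr ?N > 0" "(\<tau> + norm y) powr ?N > 0"
    using assms by (smt (verit) norm_ge_zero powr_gt_zero)+
  have "1 / (\<tau> + norm x) powr ?N \<le> (1 + r / \<tau>) powr ?N / (\<tau> + norm y) powr ?N"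
    using * pos by (simp add: field_simps)
  then have "\<tau> powr e * (1 / (\<tau> + norm x) powr ?N) \<le> \<tau> powr e * ((1 + r / \<tau>) powr ?N / (\<tau> + norm y) powr ?N)"
    by (rule mult_left_mono) simp
  then show ?thesis by (simp add: decay_wt_def mult_ac)
qed

text \<open>Dyadic decomposition into the balls of radius \<open>2\<^sup>k \<tau>\<close> around \<open>x\<close>.\<close>

lemma nn_integral_decay_wt:
  assumes "e > 0"
  shows "\<exists>C>0. \<forall>\<tau>>0. \<forall>x::'a::euclidean_space.
    (\<integral>\<^sup>+y. ennreal (decay_wt e \<tau> (x - y)) \<partial>lebesgue) \<le> ennreal C"
proof -
  define n where "n = real DIM('a)"
  define v where "v = ball_vol TYPE('a)"
  define q where "q = 2 powr (- e)"
  define C where "C = 2 powr (n + e) * v * (1 / (1 - q))"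
  have n: "n > 0" and v: "v > 0" by (auto simp: n_def v_def)
  have q: "0 < q" "q < 1" using assms powr_less_mono[of "- e" 0 2] by (auto simp: q_def)
  have C: "C > 0" using v q by (simp add: C_def)
  have vn: "unit_ball_vol n = v" by (simp add: v_def n_def)
  have "(\<integral>\<^sup>+y. ennreal (decay_wt e \<tau> (x - y)) \<partial>lebesgue) \<le> ennreal C" if \<tau>: "\<tau> > 0" for \<tau> and x :: 'a
  proof -
    \<comment> \<open>The value \<open>a k\<close> bounds the weight at points whose first enclosing
      dyadic ball is the k-th. Minimality of k gives
      \<open>2 ^ k * \<tau> \<le> 2 * (\<tau> + d)\<close>, the source of the factor
      \<open>2 powr (n + e)\<close>.\<close>
    define a where "a k = 2 powr (n + e) * \<tau> powr e * (2 ^ k * \<tau>) powr (- (n + e))" for k :: nat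
    have a0: "a k \<ge> 0" for k by (simp add: a_def)
    have pt: "ennreal (decay_wt e \<tau> (x - y)) \<le> (\<Sum>k. ennreal (a k) * indicator (ball x (2 ^ k * \<tau>)) y)" for y
    proof -
      define d where "d = norm (x - y)"
      obtain k0 :: nat where "d / \<tau> < 2 ^ k0" using real_arch_pow[of 2 "d / \<tau>"] by auto
      then have k0: "d < 2 ^ k0 * \<tau>" using \<tau> by (simp add: field_simps)
      define k where "k = (LEAST k. d < 2 ^ k * \<tau>)"
      have k: "d < 2 ^ k * \<tau>" unfolding k_def by (rule LeastI[of _ k0]) (rule k0)
      have le: "2 ^ k * \<tau> \<le> 2 * (\<tau> + d)"
      proof (cases k)
        case 0 then show ?thesis using \<tau> by (simp add: d_def)
      next
        case (Suc i)
        then have "\<not> d < 2 ^ i * \<tau>" using not_less_Least[of i "\<lambda>k. d < 2 ^ k * \<tau>"] k_def by auto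
        then show ?thesis using Suc \<tau> by simp
      qed
      have "(2 * (\<tau> + d)) powr (- (n + e)) \<le> (2 ^ k * \<tau>) powr (- (n + e))"
        using le \<tau> n assms by (intro powr_mono2') auto
      then have "2 powr (- (n + e)) * (\<tau> + d) powr (- (n + e)) \<le> (2 ^ k * \<tau>) powr (- (n + e))"
        using \<tau> by (subst (asm) powr_mult) (auto simp: d_def)
      then have "(\<tau> + d) powr (- (n + e)) \<le> 2 powr (n + e) * (2 ^ k * \<tau>) powr (- (n + e))"
        using powr_minus[of 2 "n + e"] mult_left_mono[of "2 powr (- (n + e)) * (\<tau> + d) powr (- (n + e))" _ "2 powr (n + e)"]
        by (simp add: mult.assoc[symmetric] powr_add[symmetric])
      then have "\<tau> powr e * (\<tau> + d) powr (- (n + e)) \<le> \<tau> powr e * (2 powr (n + e) * (2 ^ k * \<tau>) powr (- (n + e)))"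
        by (rule mult_left_mono) simp
      then have "decay_wt e \<tau> (x - y) \<le> a k"
        by (simp add: decay_wt_def a_def n_def[symmetric] d_def[symmetric] powr_minus[of "\<tau> + d" "n + e"]
            divide_inverse mult.assoc mult.left_commute[of "\<tau> powr e"] del: minus_add_distrib)
      then have "ennreal (decay_wt e \<tau> (x - y)) \<le> (\<Sum>k\<in>{k}. ennreal (a k) * indicator (ball x (2 ^ k * \<tau>)) y)"
        using k by (simp add: d_def dist_norm ennreal_leI)
      also have "\<dots> \<le> (\<Sum>k. ennreal (a k) * indicator (ball x (2 ^ k * \<tau>)) y)"
        by (intro sum_le_suminf) auto
      finally show ?thesis .
    qed
    have "(\<integral>\<^sup>+y. ennreal (decay_wt e \<tau> (x - y)) \<partial>lebesgue)
        \<le> (\<integral>\<^sup>+y. (\<Sum>k. ennreal (a k) * indicator (ball x (2 ^ k * \<tau>)) y) \<partial>lebesgue)"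
      by (intro nn_integral_mono pt)
    also have "\<dots> = (\<Sum>k. ennreal (a k) * emeasure lebesgue (ball x (2 ^ k * \<tau>)))"
      by (subst nn_integral_suminf) (auto simp: nn_integral_cmult)
    \<comment> \<open>The volume of the k-th ball cancels n of the n + e powers of its radius; what
      remains is \<open>q ^ k\<close>, free of \<open>\<tau>\<close>.\<close>
    also have "\<dots> = (\<Sum>k. ennreal (2 powr (n + e) * v * q ^ k))"
    proof (intro suminf_cong)
      fix k :: nat
      have "(2 ^ k * \<tau>) powr (- (n + e)) * (2 ^ k * \<tau>) powr n = (2 ^ k * \<tau>) powr (- e)"
        by (simp add: powr_add[symmetric])
      also have "\<dots> = (2 ^ k) powr (- e) * \<tau> powr (- e)"
        using \<tau> by (intro powr_mult)
      also have "(2 ^ k) powr (- e) = q ^ k"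
        by (simp add: q_def powr_realpow[symmetric] powr_powr mult.commute)
      finally have "\<tau> powr e * ((2 ^ k * \<tau>) powr (- (n + e)) * (2 ^ k * \<tau>) powr n) = q ^ k"
        using \<tau> by (simp add: powr_minus)
      then have eq: "a k * (v * (2 ^ k * \<tau>) powr n) = 2 powr (n + e) * v * q ^ k"
        by (simp add: a_def mult_ac)
      show "ennreal (a k) * emeasure lebesgue (ball x (2 ^ k * \<tau>)) = ennreal (2 powr (n + e) * v * q ^ k)"
        using \<tau> v a0[of k] by (simp add: emeasure_lborel_ball n_def[symmetric] vn ennreal_mult[symmetric] eq)
    qed
    also have "\<dots> = ennreal C"
      using q v sums_mult[OF geometric_sums[of q], of "2 powr (n + e) * v"]
      by (intro suminf_ennreal_eq) (auto simp: C_def)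
    finally show ?thesis .
  qed
  with C show ?thesis by blast
qed

text \<open>Writing \<open>F\<close> as an average over balls \<open>ball z r\<close> and exchanging the integrals replaces the
  usual covering argument.\<close>

lemma nn_integral_decay_wt_mult_le:
  fixes F :: "'a::euclidean_space \<Rightarrow> ennreal"
  assumes [measurable]: "F \<in> borel_measurable lebesgue"
    and "e > 0" "\<tau> > 0" "r > 0" and A: "\<And>z. (\<integral>\<^sup>+y\<in>ball z r. F y \<partial>lebesgue) \<le> A * emeasure lebesgue (ball z r)"
  shows "(\<integral>\<^sup>+y. ennreal (decay_wt e \<tau> (x - y)) * F y \<partial>lebesgue) \<le>
    ennreal ((1 + r / \<tau>) powr (real DIM('a) + e)) * A * (\<integral>\<^sup>+y. ennreal (decay_wt e \<tau> (x - y)) \<partial>lebesgue)"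
proof -
  define V where "V = emeasure lebesgue (ball (0::'a) r)"
  have V: "emeasure lebesgue (ball z r) = V" for z :: 'a
    using \<open>r > 0\<close> by (simp add: V_def emeasure_lborel_ball)
  have V0: "V \<noteq> 0" "V \<noteq> \<infinity>"
    using \<open>r > 0\<close> unit_ball_vol_pos[of "real DIM('a)"]
    by (auto simp: V_def emeasure_lborel_ball simp del: unit_ball_vol_pos)
  define K where "K = ennreal ((1 + r / \<tau>) powr (real DIM('a) + e))"
  let ?w = "\<lambda>y. ennreal (decay_wt e \<tau> (x - y))"
  \<comment> \<open>Inside \<open>ball z r\<close> the weight is moved from y to the centre z, so
    that the inner integral becomes the plain integral of F over a ball.\<close>
  have shift: "?w y * indicator (ball z r) y \<le> K * ?w z * indicator (ball z r) y" for y z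
  proof (cases "y \<in> ball z r")
    case True
    then have "norm ((x - y) - (x - z)) \<le> r"
      by (simp add: dist_norm)
    from decay_wt_le_shift[OF \<open>\<tau> > 0\<close> \<open>e > 0\<close> _ this] \<open>r > 0\<close> True
    show ?thesis by (simp add: K_def ennreal_mult[symmetric] ennreal_leI)
  qed simp
  have "V * (\<integral>\<^sup>+y. ?w y * F y \<partial>lebesgue) = (\<integral>\<^sup>+y. (\<integral>\<^sup>+z. ?w y * F y * indicator (ball y r) z \<partial>lebesgue) \<partial>lebesgue)"
    by (subst nn_integral_cmult_indicator) (auto simp: V nn_integral_cmult mult.commute)
  also have "\<dots> = (\<integral>\<^sup>+z. (\<integral>\<^sup>+y. ?w y * F y * indicator (ball y r) z \<partial>lebesgue) \<partial>lebesgue)"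
    by (rule lebesgue_pair.Fubini') (simp add: indicator_def)
  also have "\<dots> = (\<integral>\<^sup>+z. (\<integral>\<^sup>+y. (?w y * indicator (ball z r) y) * F y \<partial>lebesgue) \<partial>lebesgue)"
    by (intro nn_integral_cong) (auto simp: indicator_def dist_commute)
  also have "\<dots> \<le> (\<integral>\<^sup>+z. (\<integral>\<^sup>+y. (K * ?w z * indicator (ball z r) y) * F y \<partial>lebesgue) \<partial>lebesgue)"
    by (intro nn_integral_mono mult_right_mono shift) auto
  also have "\<dots> = (\<integral>\<^sup>+z. K * ?w z * (\<integral>\<^sup>+y\<in>ball z r. F y \<partial>lebesgue) \<partial>lebesgue)"
    by (subst nn_integral_cmult[symmetric]) (auto simp: mult_ac)
  also have "\<dots> \<le> (\<integral>\<^sup>+z. K * ?w z * (A * V) \<partial>lebesgue)"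
    using A V by (intro nn_integral_mono mult_left_mono) auto
  also have "\<dots> = V * (K * A * (\<integral>\<^sup>+z. ?w z \<partial>lebesgue))"
    by (subst nn_integral_cmult[symmetric], simp, subst nn_integral_cmult[symmetric], simp) (simp add: mult_ac)
  finally show ?thesis
    using V0 by (simp add: ennreal_mult_le_mult_iff K_def)
qed

section \<open>Morrey bounds\<close>

text \<open>A Young inequality with threshold s: below s the first term suffices, above s the second
  one does, because \<open>(x / s) powr (p - 1) \<ge> 1\<close>. The parameter s is chosen at each
  use: the size of a mean, 1, or a power of \<open>1 + norm y\<close>.\<close>

lemma le_add_powr:
  fixes x s p :: real
  assumes "p \<ge> 1" "s > 0" "x \<ge> 0"
  shows "x \<le> s + s powr (1 - p) * x powr p"
proof (cases "x \<le> s")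
  case True
  then show ?thesis using assms by (simp add: add_increasing2)
next
  case False
  then have "x = x powr (1 - p) * x powr p"
    using assms by (simp add: powr_add[symmetric])
  also have "\<dots> \<le> s powr (1 - p) * x powr p"
    using False assms by (intro mult_right_mono powr_mono2') auto
  finally show ?thesis using assms by linarith
qed

lemma powr_add_le:
  fixes a b p :: real
  assumes "a \<ge> 0" "b \<ge> 0" "p \<ge> 0"
  shows "(a + b) powr p \<le> 2 powr p * (a powr p + b powr p)"
proof -
  have "(a + b) powr p \<le> (2 * max a b) powr p"
    using assms by (intro powr_mono2) auto
  also have "\<dots> = 2 powr p * max a b powr p"
    using assms by (intro powr_mult)
  also have "max a b powr p \<le> a powr p + b powr p"
    by (auto simp: max_def)
  finally show ?thesis by simp
qed

text \<open>A substitute for Hoelder's inequality, obtained by integrating \<open>x \<le> s + s\<^bsup>1-p\<^esup> x\<^sup>p\<close>.\<close>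

lemma set_nn_integral_le_of_powr:
  fixes F :: "'a::euclidean_space \<Rightarrow> real"
  assumes [measurable]: "F \<in> borel_measurable lebesgue" "B \<in> sets lebesgue"
    and F0: "\<And>y. F y \<ge> 0" and p: "p \<ge> 1" and s: "s \<ge> 0"
    and le: "(\<integral>\<^sup>+y\<in>B. ennreal (F y powr p) \<partial>lebesgue) \<le> ennreal (s powr p) * emeasure lebesgue B"
  shows "(\<integral>\<^sup>+y\<in>B. ennreal (F y) \<partial>lebesgue) \<le> ennreal (2 * s) * emeasure lebesgue B"
\<comment> \<open>The threshold must be positive. For \<open>s = 0\<close> the hypothesis forces F
  to vanish almost everywhere on B.\<close>
proof (cases "s = 0")
  case True
  then have "(\<integral>\<^sup>+y\<in>B. ennreal (F y powr p) \<partial>lebesgue) = 0"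
    using le p by simp
  then have "AE y in lebesgue. ennreal (F y powr p) * indicator B y = 0"
    by (subst (asm) nn_integral_0_iff_AE) auto
  then have "AE y in lebesgue. ennreal (F y) * indicator B y = 0"
    by eventually_elim (auto simp: indicator_def split: if_splits)
  then have "(\<integral>\<^sup>+y\<in>B. ennreal (F y) \<partial>lebesgue) = 0"
    by (subst nn_integral_0_iff_AE) auto
  then show ?thesis by simp
next
  case False
  then have s: "s > 0" using s by simp
  have "(\<integral>\<^sup>+y\<in>B. ennreal (F y) \<partial>lebesgue) \<le>
      (\<integral>\<^sup>+y. ennreal s * indicator B y + ennreal (s powr (1 - p)) * (ennreal (F y powr p) * indicator B y) \<partial>lebesgue)"
    using le_add_powr[OF p s F0] s
    by (intro nn_integral_mono) (auto simp: indicator_def ennreal_mult[symmetric] ennreal_plus[symmetric] intro!: ennreal_leI simp del: ennreal_plus)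
  also have "\<dots> = ennreal s * emeasure lebesgue B + ennreal (s powr (1 - p)) * (\<integral>\<^sup>+y\<in>B. ennreal (F y powr p) \<partial>lebesgue)"
    by (subst nn_integral_add) (auto simp: nn_integral_cmult)
  also have "\<dots> \<le> ennreal s * emeasure lebesgue B + ennreal (s powr (1 - p)) * (ennreal (s powr p) * emeasure lebesgue B)"
    by (intro add_left_mono mult_left_mono le) auto
  also have "ennreal (s powr (1 - p)) * (ennreal (s powr p) * emeasure lebesgue B) = ennreal s * emeasure lebesgue B"
    using s by (simp add: mult.assoc[symmetric] ennreal_mult[symmetric] powr_add[symmetric])
  also have "ennreal s * emeasure lebesgue B + ennreal s * emeasure lebesgue B = ennreal (2 * s) * emeasure lebesgue B"
    using s by (simp add: distrib_right[symmetric] ennreal_plus[symmetric] del: ennreal_plus)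
  finally show ?thesis .
qed

text \<open>Increments over successive doublings are dominated by a geometric series of ratio
  \<open>2 powr (- a)\<close>. The real variable is a radius when this is applied to ball averages,
  and a time when it is applied to the semigroup.\<close>

lemma dyadic_chain:
  fixes \<phi> :: "real \<Rightarrow> 'b::banach"
  assumes a: "a > 0" and A: "A \<ge> 0"
    and step: "\<And>t t'. 0 < t \<Longrightarrow> t \<le> t' \<Longrightarrow> t' \<le> 2 * t \<Longrightarrow> norm (\<phi> t - \<phi> t') \<le> A * t powr (- a)"
  shows "\<exists>l. (\<phi> \<longlongrightarrow> l) at_top \<and> (\<forall>t>0. norm (\<phi> t - l) \<le> A / (1 - 2 powr (- a)) * t powr (- a))"
proof -
  define q where "q = 2 powr (- a)"
  define K where "K = A / (1 - q)"
  have q: "0 < q" "q < 1" using a powr_less_mono[of "- a" 0 2] by (auto simp: q_def)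
  have K: "K \<ge> 0" using A q by (simp add: K_def)
  \<comment> \<open>Here j counts doublings. The induction splits off the step from t to 2 t, and
    \<open>(2 * t) powr (- a) = q * t powr (- a)\<close> shifts the remaining geometric sum by one
    place.\<close>
  have chain: "norm (\<phi> t - \<phi> t') \<le> A * t powr (- a) * (\<Sum>i<j. q ^ i)"
    if "0 < t" "t \<le> t'" "t' \<le> 2 ^ j * t" for t t' j
    using that
  proof (induction j arbitrary: t)
    case 0
    then show ?case by simp
  next
    case (Suc j)
    have sum: "(\<Sum>i<Suc j. q ^ i) = 1 + q * (\<Sum>i<j. q ^ i)"
      by (simp add: sum.lessThan_Suc_shift sum_distrib_left del: sum.lessThan_Suc)
    have nn: "0 \<le> q * (\<Sum>i<j. q ^ i)" using q by (simp add: sum_nonneg)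
    show ?case
    proof (cases "t' \<le> 2 * t")
      case True
      have "norm (\<phi> t - \<phi> t') \<le> A * t powr (- a)" using step Suc.prems True by simp
      also have "\<dots> \<le> A * t powr (- a) * (\<Sum>i<Suc j. q ^ i)"
        unfolding sum using nn A mult_left_mono[of 1 "1 + q * (\<Sum>i<j. q ^ i)" "A * t powr (- a)"] by simp
      finally show ?thesis .
    next
      case False
      have "norm (\<phi> t - \<phi> t') \<le> norm (\<phi> t - \<phi> (2 * t)) + norm (\<phi> (2 * t) - \<phi> t')"
        by (rule norm_diff_triangle_ineq[of _ "\<phi> (2 * t)" "\<phi> (2 * t)", simplified])
      also have "\<dots> \<le> A * t powr (- a) + A * (2 * t) powr (- a) * (\<Sum>i<j. q ^ i)"
        using step[of t "2 * t"] Suc.IH[of "2 * t"] Suc.prems False by (simp add: mult_ac)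
      also have "(2 * t) powr (- a) = q * t powr (- a)"
        using Suc.prems by (subst powr_mult) (auto simp: q_def)
      finally show ?thesis unfolding sum by (simp add: algebra_simps)
    qed
  qed
  have bd: "norm (\<phi> t - \<phi> t') \<le> K * t powr (- a)" if "0 < t" "t \<le> t'" for t t'
  proof -
    obtain j :: nat where "t' / t < 2 ^ j" using real_arch_pow[of 2 "t' / t"] by auto
    then have "norm (\<phi> t - \<phi> t') \<le> A * t powr (- a) * (\<Sum>i<j. q ^ i)"
      using that by (intro chain) (auto simp: field_simps)
    also have "(\<Sum>i<j. q ^ i) \<le> 1 / (1 - q)"
      using q sum_le_suminf[of "\<lambda>i. q ^ i" "{..<j}"] by (simp add: suminf_geometric)
    finally show ?thesis using A that by (simp add: K_def mult_left_mono)
  qed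
  have lim0: "((\<lambda>t. K * t powr (- a)) \<longlongrightarrow> 0) at_top"
    using a by (intro tendsto_mult_right_zero tendsto_neg_powr filterlim_ident) auto
  \<comment> \<open>Completeness is used along the integers only; the bound against that limit then
    gives convergence in the real variable.\<close>
  have "Cauchy (\<lambda>j. \<phi> (real j))"
  proof (rule metric_CauchyI)
    fix e :: real assume e: "e > 0"
    have "\<forall>\<^sub>F t in at_top. K * t powr (- a) < e"
      using lim0 e by (rule order_tendstoD(2))
    then obtain T where T: "\<And>t. t \<ge> T \<Longrightarrow> K * t powr (- a) < e"
      by (auto simp: eventually_at_top_linorder)
    obtain J :: nat where J: "real J \<ge> max T 1" using real_arch_simple by blast
    have le: "dist (\<phi> (real i)) (\<phi> (real j)) < e" if "J \<le> i" "i \<le> j" for i j :: nat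
    proof -
      have "real i \<ge> max T 1" using J that by linarith
      then show ?thesis using bd[of "real i" "real j"] T[of "real i"] that by (simp add: dist_norm)
    qed
    show "\<exists>M. \<forall>m\<ge>M. \<forall>n\<ge>M. dist (\<phi> (real m)) (\<phi> (real n)) < e"
      using le by (metis dist_commute nat_le_linear)
  qed
  then obtain l where l: "(\<lambda>j. \<phi> (real j)) \<longlonglongrightarrow> l"
    using Cauchy_convergent convergent_def by blast
  have fin: "norm (\<phi> t - l) \<le> K * t powr (- a)" if "t > 0" for t
  proof (rule tendsto_upperbound)
    show "((\<lambda>j. norm (\<phi> t - \<phi> (real j))) \<longlongrightarrow> norm (\<phi> t - l)) sequentially"
      by (intro tendsto_intros l)
    obtain J :: nat where "real J \<ge> t" using real_arch_simple by blast
    then show "\<forall>\<^sub>F j in sequentially. norm (\<phi> t - \<phi> (real j)) \<le> K * t powr (- a)"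
      using bd that by (intro eventually_sequentiallyI[of J]) force
  qed simp
  have "((\<lambda>t. \<phi> t - l) \<longlongrightarrow> 0) at_top"
    by (rule Lim_null_comparison[OF _ lim0])
      (use fin in \<open>auto intro: eventually_at_top_linorderI[of 1]\<close>)
  then have "(\<phi> \<longlongrightarrow> l) at_top" by (rule LIM_zero_cancel)
  then show ?thesis using fin unfolding K_def q_def by blast
qed

text \<open>Bounds a seminorm by a finite S without supremum, p-th root or division by
  \<open>r powr lam\<close>, so that estimates run ball by ball. The argument \<open>a\<close>
  covers ball averages, heat extensions, constants and fixed functions alike.\<close>

definition morrey_bound ::
  "real \<Rightarrow> real \<Rightarrow> ('a::euclidean_space \<Rightarrow> real \<Rightarrow> 'a \<Rightarrow> complex) \<Rightarrow> ('a \<Rightarrow> complex) \<Rightarrow> real \<Rightarrow> bool" where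
  "morrey_bound p lam a f S \<longleftrightarrow> (\<forall>x r. r > 0 \<longrightarrow>
     (\<integral>\<^sup>+y\<in>ball x r. ennreal (norm (f y - a x r y) powr p) \<partial>lebesgue) \<le> ennreal (S powr p * r powr lam))"

lemma ennreal_root_le_iff:
  assumes "p > 0" "S \<ge> 0"
  shows "ennreal_root p a \<le> ennreal S \<longleftrightarrow> a \<le> ennreal (S powr p)"
proof (cases "a = \<infinity>")
  case True
  then show ?thesis by (auto simp: ennreal_root_def top_unique)
next
  case False
  then obtain b where b: "a = ennreal b" "b \<ge> 0" by (cases a) auto
  have "b powr (1 / p) \<le> S \<longleftrightarrow> b \<le> S powr p"
  proof
    assume "b powr (1 / p) \<le> S"
    then have "(b powr (1 / p)) powr p \<le> S powr p" using assms by (intro powr_mono2) auto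
    then show "b \<le> S powr p" using assms b by (simp add: powr_powr)
  next
    assume "b \<le> S powr p"
    then have "b powr (1 / p) \<le> (S powr p) powr (1 / p)" using assms b by (intro powr_mono2) auto
    then show "b powr (1 / p) \<le> S" using assms by (simp add: powr_powr)
  qed
  then show ?thesis using b assms by (simp add: ennreal_root_def)
qed

lemma morrey_sup_le_iff:
  assumes "p > 0" "S \<ge> 0"
  shows "morrey_sup p lam a f \<le> ennreal S \<longleftrightarrow> morrey_bound p lam a f S"
proof -
  have *: "ennreal (r powr (- lam)) * I \<le> ennreal (S powr p) \<longleftrightarrow> I \<le> ennreal (S powr p * r powr lam)"
    if "r > 0" for r and I :: ennreal
  proof -
    have "ennreal (r powr (- lam)) * I \<le> ennreal (S powr p) \<longleftrightarrow>
        ennreal (r powr (- lam)) * I \<le> ennreal (r powr (- lam)) * ennreal (S powr p * r powr lam)"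
    proof -
      have "r powr (- lam) * (S powr p * r powr lam) = S powr p"
        using that by (simp add: powr_minus field_simps)
      then show ?thesis by (simp only: ennreal_mult[symmetric, OF powr_ge_zero mult_nonneg_nonneg[OF powr_ge_zero powr_ge_zero]])
    qed
    also have "\<dots> \<longleftrightarrow> I \<le> ennreal (S powr p * r powr lam)"
      using that by (intro ennreal_mult_le_mult_iff) auto
    finally show ?thesis .
  qed
  show ?thesis
    using assms by (auto simp: morrey_sup_def morrey_bound_def SUP_le_iff ennreal_root_le_iff *)
qed

text \<open>The \<open>mu\<close> of the overview. The type argument supplies the dimension, which
  the real arguments do not determine.\<close>

definition morrey_exp :: "'a::euclidean_space itself \<Rightarrow> real \<Rightarrow> real \<Rightarrow> real" where
  "morrey_exp _ p lam = (real DIM('a) - lam) / p"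

text \<open>Dividing \<open>S powr p * r powr lam\<close> by the volume of the ball and taking the
  p-th root yields the rate \<open>- mu\<close>. The factor 2 is the price of
  \<open>set_nn_integral_le_of_powr\<close>.\<close>

lemma morrey_bound_avg:
  fixes f :: "'a::euclidean_space \<Rightarrow> complex"
  assumes bd: "morrey_bound p lam a f S" and p: "p \<ge> 1" and "S \<ge> 0" "r > 0"
    and [measurable]: "f \<in> borel_measurable lebesgue" "a x r \<in> borel_measurable lebesgue"
  shows "(\<integral>\<^sup>+y\<in>ball x r. ennreal (norm (f y - a x r y)) \<partial>lebesgue) \<le>
    ennreal (2 * (ball_vol TYPE('a) powr (- 1 / p) * S * r powr (- morrey_exp TYPE('a) p lam)))
      * emeasure lebesgue (ball x r)"
proof (rule set_nn_integral_le_of_powr[OF _ _ _ p])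
  let ?s = "ball_vol TYPE('a) powr (- 1 / p) * S * r powr (- morrey_exp TYPE('a) p lam)"
  have "?s powr p = (ball_vol TYPE('a) powr (- 1 / p)) powr p * S powr p * (r powr (- morrey_exp TYPE('a) p lam)) powr p"
    using assms by (simp add: powr_mult)
  also have "\<dots> = S powr p * r powr (lam - DIM('a)) / ball_vol TYPE('a)"
  proof -
    have "(ball_vol TYPE('a) powr (- 1 / p)) powr p = 1 / ball_vol TYPE('a)"
      using p by (subst powr_powr) (simp add: powr_minus_divide)
    moreover have "(r powr (- morrey_exp TYPE('a) p lam)) powr p = r powr (lam - DIM('a))"
      using p by (simp add: powr_powr morrey_exp_def)
    ultimately show ?thesis by simp
  qed
  finally have "?s powr p * (ball_vol TYPE('a) * r powr DIM('a)) = S powr p * (r powr (lam - DIM('a)) * r powr DIM('a))"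
    using unit_ball_vol_pos[of "real DIM('a)"] by (simp del: unit_ball_vol_pos)
  also have "\<dots> = S powr p * r powr lam"
    by (simp add: powr_add[symmetric])
  finally have "ennreal (?s powr p) * emeasure lebesgue (ball x r) = ennreal (S powr p * r powr lam)"
    using assms by (simp add: emeasure_lborel_ball ennreal_mult[symmetric])
  then show "(\<integral>\<^sup>+y\<in>ball x r. ennreal (norm (f y - a x r y) powr p) \<partial>lebesgue) \<le> ennreal (?s powr p) * emeasure lebesgue (ball x r)"
    using bd \<open>r > 0\<close> by (simp add: morrey_bound_def)
  show "0 \<le> ?s" using assms by simp
qed auto

text \<open>An error of order \<open>r powr (- mu)\<close> is exactly what a Morrey bound tolerates:
  its p-th power times the volume is a multiple of \<open>r powr lam\<close>. Every later exchange
  of one subtracted function for another (average and limit constant, heat extension and 0, heat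
  extension and fixed point) goes through this lemma.\<close>

lemma morrey_bound_perturb:
  fixes f :: "'a::euclidean_space \<Rightarrow> complex"
  assumes bd: "morrey_bound p lam a f S" and p: "p \<ge> 1" and S: "S \<ge> 0" and M: "M \<ge> 0"
    and [measurable]: "f \<in> borel_measurable lebesgue" "\<And>x r. r > 0 \<Longrightarrow> a x r \<in> borel_measurable lebesgue"
    and ab: "\<And>x r y. r > 0 \<Longrightarrow> norm (a x r y - b x r y) \<le> M * S * r powr (- morrey_exp TYPE('a) p lam)"
  shows "morrey_bound p lam b f (2 * (1 + M powr p * ball_vol TYPE('a)) powr (1 / p) * S)"
  unfolding morrey_bound_def
proof (intro allI impI)
  fix x :: 'a and r :: real assume r: "r > 0"
  let ?v = "ball_vol TYPE('a)"
  let ?d = "M * S * r powr (- morrey_exp TYPE('a) p lam)"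
  note [measurable] = assms(6)[OF r]
  have v: "?v > 0" by simp
  have d: "?d \<ge> 0" using M S by simp
  have pt: "norm (f y - b x r y) powr p \<le> 2 powr p * (norm (f y - a x r y) powr p + ?d powr p)" for y
  proof -
    have "norm (f y - b x r y) \<le> norm (f y - a x r y) + norm (a x r y - b x r y)"
      by (rule norm_diff_triangle_ineq[of "f y" "a x r y" "a x r y" "b x r y", simplified])
    also have "\<dots> \<le> norm (f y - a x r y) + ?d" using ab[OF r] by simp
    finally have "norm (f y - b x r y) powr p \<le> (norm (f y - a x r y) + ?d) powr p"
      using p by (intro powr_mono2) auto
    also have "\<dots> \<le> 2 powr p * (norm (f y - a x r y) powr p + ?d powr p)"
      using p d by (intro powr_add_le) auto
    finally show ?thesis .
  qed
  have "(\<integral>\<^sup>+y\<in>ball x r. ennreal (norm (f y - b x r y) powr p) \<partial>lebesgue) \<le>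
      (\<integral>\<^sup>+y. ennreal (2 powr p) * (ennreal (norm (f y - a x r y) powr p) * indicator (ball x r) y
         + ennreal (?d powr p) * indicator (ball x r) y) \<partial>lebesgue)"
    using pt by (intro nn_integral_mono)
      (auto simp: indicator_def ennreal_mult[symmetric] ennreal_plus[symmetric] intro!: ennreal_leI simp del: ennreal_plus)
  also have "\<dots> = ennreal (2 powr p) * ((\<integral>\<^sup>+y\<in>ball x r. ennreal (norm (f y - a x r y) powr p) \<partial>lebesgue)
      + ennreal (?d powr p) * emeasure lebesgue (ball x r))"
    by (subst nn_integral_cmult, simp, subst nn_integral_add) (auto simp: nn_integral_cmult_indicator)
  also have "\<dots> \<le> ennreal (2 powr p) * (ennreal (S powr p * r powr lam) + ennreal (?d powr p) * emeasure lebesgue (ball x r))"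
    using bd r by (intro mult_left_mono add_right_mono) (auto simp: morrey_bound_def)
  also have "\<dots> = ennreal (2 powr p * (S powr p * r powr lam + ?d powr p * (?v * r powr DIM('a))))"
    using r by (simp add: emeasure_lborel_ball ennreal_mult)
  also have "2 powr p * (S powr p * r powr lam + ?d powr p * (?v * r powr DIM('a))) =
      (2 * (1 + M powr p * ?v) powr (1 / p) * S) powr p * r powr lam"
  proof -
    have "?d powr p = M powr p * S powr p * r powr (lam - DIM('a))"
      using M S p by (simp add: powr_mult powr_powr morrey_exp_def)
    then have "?d powr p * (?v * r powr DIM('a)) = M powr p * S powr p * ?v * r powr lam"
      by (simp add: powr_add[symmetric] mult_ac)
    moreover have "(2 * (1 + M powr p * ?v) powr (1 / p) * S) powr p = 2 powr p * (1 + M powr p * ?v) * S powr p"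
      using S p v by (simp add: powr_mult powr_powr)
    ultimately show ?thesis by (simp add: algebra_simps)
  qed
  finally show "(\<integral>\<^sup>+y\<in>ball x r. ennreal (norm (f y - b x r y) powr p) \<partial>lebesgue) \<le>
    ennreal ((2 * (1 + M powr p * ?v) powr (1 / p) * S) powr p * r powr lam)" .
qed

section \<open>Campanato functions modulo constants\<close>

lemma Lp_loc_measurable: "f \<in> Lp_loc p \<Longrightarrow> f \<in> borel_measurable lebesgue"
  by (simp add: Lp_loc_def)

lemma norm_le_1_add_powr: "p \<ge> 1 \<Longrightarrow> norm z \<le> 1 + norm z powr p"
  using le_add_powr[of p 1 "norm z"] by simp

lemma Lp_loc_set_integrable_ball:
  fixes f :: "'a::euclidean_space \<Rightarrow> complex"
  assumes f: "f \<in> Lp_loc p" and p: "p \<ge> 1"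
  shows "set_integrable lebesgue (ball x r) f"
proof (rule set_integrable_subset)
  have 1: "set_integrable lebesgue (cball x r) (\<lambda>y. norm (f y) powr p)"
    using f by (simp add: Lp_loc_def)
  have "set_integrable lborel (cball x r) (\<lambda>y. 1 :: real)"
    unfolding set_integrable_def by (intro borel_integrable_compact) auto
  then have 2: "set_integrable lebesgue (cball x r) (\<lambda>y. 1 :: real)"
    by (simp add: set_integrable_def integrable_completion)
  have [measurable]: "f \<in> borel_measurable lebesgue" "cball x r \<in> sets lebesgue"
    by (auto intro: Lp_loc_measurable[OF f])
  show "set_integrable lebesgue (cball x r) f"
    unfolding set_integrable_def
  proof (rule Bochner_Integration.integrable_bound)
    show "integrable lebesgue (\<lambda>y. indicator (cball x r) y *\<^sub>R 1 + indicator (cball x r) y *\<^sub>R norm (f y) powr p)"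
      using 1 2 unfolding set_integrable_def by (intro Bochner_Integration.integrable_add)
    show "AE y in lebesgue. norm (indicator (cball x r) y *\<^sub>R f y)
        \<le> norm (indicator (cball x r) y *\<^sub>R (1::real) + indicator (cball x r) y *\<^sub>R norm (f y) powr p)"
      using norm_le_1_add_powr[OF p] by (intro AE_I2) (auto simp: indicator_def)
  qed simp
qed auto

lemma norm_ball_avg_diff_le:
  fixes f :: "'a::euclidean_space \<Rightarrow> complex"
  assumes f: "set_integrable lebesgue (ball x r) f" and r: "r > 0"
  shows "ennreal (norm (ball_avg f x r - c)) * emeasure lebesgue (ball x r) \<le>
    (\<integral>\<^sup>+y\<in>ball x r. ennreal (norm (f y - c)) \<partial>lebesgue)"
proof -
  let ?V = "measure lebesgue (ball x r)"
  have V: "?V > 0" using r by (simp add: measure_lborel_ball)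
  have c: "set_integrable lebesgue (ball x r) (\<lambda>y. c)"
    unfolding set_integrable_def by (intro integrable_scaleR_left integrable_real_indicator) (use r in \<open>auto simp: emeasure_lborel_ball\<close>)
  have lc: "(LINT y:ball x r|lebesgue. c) = ?V *\<^sub>R c"
    unfolding set_lebesgue_integral_def using r
    by (subst integral_scaleR_left) (auto intro!: integrable_real_indicator simp: emeasure_lborel_ball)
  have i: "integrable lebesgue (\<lambda>y. indicator (ball x r) y *\<^sub>R (f y - c))"
    using set_integral_diff(1)[OF f c] by (simp add: set_integrable_def)
  have "ball_avg f x r - c = (LINT y:ball x r|lebesgue. f y - c) /\<^sub>R ?V"
    using V by (simp add: ball_avg_def set_integral_diff(2)[OF f c] scaleR_diff_right lc)
  then have "norm (ball_avg f x r - c) * ?V = norm (LINT y:ball x r|lebesgue. f y - c)"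
    using V by (simp add: field_simps)
  moreover have "ennreal (norm (LINT y:ball x r|lebesgue. f y - c)) \<le>
      (\<integral>\<^sup>+y. ennreal (norm (indicator (ball x r) y *\<^sub>R (f y - c))) \<partial>lebesgue)"
    unfolding set_lebesgue_integral_def by (rule integral_norm_bound_ennreal[OF i])
  moreover have "\<dots> = (\<integral>\<^sup>+y\<in>ball x r. ennreal (norm (f y - c)) \<partial>lebesgue)"
    by (intro nn_integral_cong) (auto simp: indicator_def)
  moreover have "emeasure lebesgue (ball x r) = ennreal ?V"
    using r by (simp add: measure_lborel_ball emeasure_lborel_ball)
  ultimately show ?thesis
    using V by (simp add: ennreal_mult[symmetric])
qed

lemma campanato_imp_morrey:
  assumes p: "p \<ge> 1" and lam: "lam < real DIM('a)"
  shows "\<exists>C>0. \<forall>(f::'a::euclidean_space \<Rightarrow> complex) \<in> Lp_loc p. \<forall>S\<ge>0.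
    morrey_bound p lam (\<lambda>x r y. ball_avg f x r) f S \<longrightarrow>
    (\<exists>l. morrey_bound p lam (\<lambda>_ _ _. l) f (C * S))"
proof -
  let ?mu = "morrey_exp TYPE('a) p lam"
  let ?v = "ball_vol TYPE('a)"
  have mu: "?mu > 0" using p lam by (simp add: morrey_exp_def)
  \<comment> \<open>The first factors come from \<open>morrey_bound_avg\<close>;
    \<open>4 powr n\<close> bounds the volume ratio of two nested balls whose radii differ by a
    factor of at most 4.\<close>
  define K where "K = 2 * ?v powr (- 1 / p) * 4 powr real DIM('a)"
  have K: "K > 0" by (simp add: K_def)
  define M where "M = K / (1 - 2 powr (- ?mu))"
  have M: "M > 0" using K mu powr_less_mono[of "- ?mu" 0 2] by (simp add: M_def)
  have "\<exists>l. morrey_bound p lam (\<lambda>_ _ _. l) f (2 * (1 + M powr p * ?v) powr (1 / p) * S)"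
    if f: "f \<in> Lp_loc p" and S: "S \<ge> 0" and bd: "morrey_bound p lam (\<lambda>x r y. ball_avg f x r) f S"
    for f :: "'a \<Rightarrow> complex" and S
  proof -
    have [measurable]: "f \<in> borel_measurable lebesgue" by (rule Lp_loc_measurable[OF f])
    note int = Lp_loc_set_integrable_ball[OF f p]
    have near: "norm (ball_avg f y r - ball_avg f x R) \<le> K * S * r powr (- ?mu)"
      if r: "r > 0" and sub: "ball y r \<subseteq> ball x R" and R: "r \<le> R" "R \<le> 4 * r" for x y r R
    proof -
      define s where "s = 2 * (?v powr (- 1 / p) * S * R powr (- ?mu))"
      have s: "s \<ge> 0" using S by (simp add: s_def)
      have "ennreal (norm (ball_avg f y r - ball_avg f x R)) * emeasure lebesgue (ball y r)
          \<le> (\<integral>\<^sup>+z\<in>ball y r. ennreal (norm (f z - ball_avg f x R)) \<partial>lebesgue)"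
        by (rule norm_ball_avg_diff_le[OF int r])
      also have "\<dots> \<le> (\<integral>\<^sup>+z\<in>ball x R. ennreal (norm (f z - ball_avg f x R)) \<partial>lebesgue)"
        using sub by (intro nn_integral_mono) (auto simp: indicator_def)
      also have "\<dots> \<le> ennreal s * emeasure lebesgue (ball x R)"
        using morrey_bound_avg[OF bd p S] r R by (simp add: s_def)
      finally have "norm (ball_avg f y r - ball_avg f x R) * (?v * r powr DIM('a)) \<le> s * (?v * R powr DIM('a))"
        using r R s by (simp add: emeasure_lborel_ball ennreal_mult[symmetric] ennreal_le_iff)
      then have "norm (ball_avg f y r - ball_avg f x R) * r powr DIM('a) \<le> s * R powr DIM('a)"
        using unit_ball_vol_pos[of "real DIM('a)"] by (simp add: mult.left_commute[of _ ?v] del: unit_ball_vol_pos)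
      also have "R powr DIM('a) \<le> (4 * r) powr DIM('a)"
        using r R by (intro powr_mono2) auto
      also have "(4 * r) powr DIM('a) = 4 powr DIM('a) * r powr DIM('a)"
        using r by (intro powr_mult)
      finally have "norm (ball_avg f y r - ball_avg f x R) * r powr DIM('a) \<le> (s * 4 powr DIM('a)) * r powr DIM('a)"
        using s by (simp add: mult_left_mono)
      then have "norm (ball_avg f y r - ball_avg f x R) \<le> s * 4 powr DIM('a)"
        using r by simp
      also have "s \<le> 2 * (?v powr (- 1 / p) * S * r powr (- ?mu))"
        unfolding s_def using r R mu S by (intro mult_left_mono powr_mono2') auto
      finally show ?thesis by (simp add: K_def mult_ac)
    qed
    have lim: "\<exists>l. ((\<lambda>r. ball_avg f x r) \<longlongrightarrow> l) at_top \<and>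
        (\<forall>r>0. norm (ball_avg f x r - l) \<le> K * S / (1 - 2 powr (- ?mu)) * r powr (- ?mu))" for x
      using mu K S by (intro dyadic_chain near) auto
    then obtain l where l: "\<And>x. ((\<lambda>r. ball_avg f x r) \<longlongrightarrow> l x) at_top"
      "\<And>x r. r > 0 \<Longrightarrow> norm (ball_avg f x r - l x) \<le> M * S * r powr (- ?mu)"
      unfolding M_def by (metis times_divide_eq_left)
    \<comment> \<open>Independence of the centre: once \<open>r \<ge> norm x + 1\<close>, the ball
      of radius r about x lies in the ball of radius 2 r about 0, so \<open>near\<close> compares
      the two averages.\<close>
    have leq: "l x = l 0" for x
    proof -
      have "((\<lambda>r. ball_avg f x r - ball_avg f 0 (2 * r)) \<longlongrightarrow> l x - l 0) at_top"
        by (intro tendsto_diff l filterlim_compose[OF l(1)] filterlim_tendsto_pos_mult_at_top[OF tendsto_const])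
          (auto intro: filterlim_ident)
      moreover have "((\<lambda>r. ball_avg f x r - ball_avg f 0 (2 * r)) \<longlongrightarrow> 0) at_top"
      proof (rule Lim_null_comparison)
        show "((\<lambda>r. K * S * r powr (- ?mu)) \<longlongrightarrow> 0) at_top"
          using mu by (intro tendsto_mult_right_zero tendsto_neg_powr filterlim_ident) auto
        have "norm (ball_avg f x r - ball_avg f 0 (2 * r)) \<le> K * S * r powr (- ?mu)"
          if "r \<ge> norm x + 1" for r
        proof (rule near)
          show "r > 0" using that norm_ge_zero[of x] by linarith
          then show "ball x r \<subseteq> ball 0 (2 * r)" "r \<le> 2 * r" "2 * r \<le> 4 * r"
            using that norm_triangle_ineq2[of _ x] by (auto simp: dist_norm norm_minus_commute)
              (smt (verit) norm_triangle_ineq2)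
        qed
        then show "\<forall>\<^sub>F r in at_top. norm (ball_avg f x r - ball_avg f 0 (2 * r)) \<le> K * S * r powr (- ?mu)"
          by (intro eventually_at_top_linorderI)
      qed
      ultimately have "l x - l 0 = 0" by (rule tendsto_unique[rotated]) simp
      then show ?thesis by simp
    qed
    show ?thesis
      using S M l(2) leq by (intro exI[of _ "l 0"] morrey_bound_perturb[OF bd p]) (auto, metis)
  qed
  moreover have "1 + M powr p * ?v > 0"
    by (rule add_pos_nonneg) auto
  then have "2 * (1 + M powr p * ?v) powr (1 / p) > 0"
    by simp
  ultimately show ?thesis by blast
qed

text \<open>The distance of a ball average from l is at most the mean of |f - l| over that ball,
  hence of order \<open>r powr (- mu)\<close>, and \<open>morrey_bound_perturb\<close> absorbs
  it.\<close>

lemma morrey_imp_campanato: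
  assumes p: "p \<ge> 1"
  shows "\<exists>C>0. \<forall>(f::'a::euclidean_space \<Rightarrow> complex) \<in> Lp_loc p. \<forall>S\<ge>0. \<forall>l.
    morrey_bound p lam (\<lambda>_ _ _. l) f S \<longrightarrow>
    morrey_bound p lam (\<lambda>x r y. ball_avg f x r) f (C * S)"
proof -
  let ?mu = "morrey_exp TYPE('a) p lam"
  let ?v = "ball_vol TYPE('a)"
  define M where "M = 2 * ?v powr (- 1 / p)"
  have M: "M > 0" by (simp add: M_def)
  have "morrey_bound p lam (\<lambda>x r y. ball_avg f x r) f (2 * (1 + M powr p * ?v) powr (1 / p) * S)"
    if f: "f \<in> Lp_loc p" and S: "S \<ge> 0" and bd: "morrey_bound p lam (\<lambda>_ _ _. l) f S"
    for f :: "'a \<Rightarrow> complex" and S l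
  proof (rule morrey_bound_perturb[OF bd p S])
    show [measurable]: "f \<in> borel_measurable lebesgue" by (rule Lp_loc_measurable[OF f])
    show "norm (l - ball_avg f x r) \<le> M * S * r powr (- ?mu)" if r: "r > 0" for x r
    proof -
      have "ennreal (norm (ball_avg f x r - l)) * emeasure lebesgue (ball x r)
          \<le> (\<integral>\<^sup>+y\<in>ball x r. ennreal (norm (f y - l)) \<partial>lebesgue)"
        by (rule norm_ball_avg_diff_le[OF Lp_loc_set_integrable_ball[OF f p] r])
      also have "\<dots> \<le> ennreal (M * S * r powr (- ?mu)) * emeasure lebesgue (ball x r)"
        using morrey_bound_avg[OF bd p S r] by (simp add: M_def mult_ac)
      finally have "norm (ball_avg f x r - l) * (?v * r powr DIM('a)) \<le> (M * S * r powr (- ?mu)) * (?v * r powr DIM('a))"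
        using r M S by (simp add: emeasure_lborel_ball ennreal_mult[symmetric] ennreal_le_iff)
      then have "norm (ball_avg f x r - l) \<le> M * S * r powr (- ?mu)"
        by (rule mult_right_le_imp_le) (use r in simp)
      then show ?thesis by (simp add: norm_minus_commute)
    qed
  qed (use M in auto)
  moreover have "1 + M powr p * ?v > 0"
    by (rule add_pos_nonneg) auto
  then have "2 * (1 + M powr p * ?v) powr (1 / p) > 0"
    by simp
  ultimately show ?thesis by blast
qed

section \<open>A weighted space of integrable functions\<close>

text \<open>A common domain for all P_t when the kernel decays at rate e: the defining integrals
  converge absolutely, and the space is invariant under \<open>heat_ext k t\<close>, so compositions
  make sense.\<close>

definition weighted_L1 :: "real \<Rightarrow> ('a::euclidean_space \<Rightarrow> complex) set" where
  "weighted_L1 e = {F \<in> borel_measurable lebesgue.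
     (\<integral>\<^sup>+y. ennreal (decay_wt e 1 y * norm (F y)) \<partial>lebesgue) < \<infinity>}"

lemma weighted_L1_integrable:
  "F \<in> weighted_L1 e \<Longrightarrow> integrable lebesgue (\<lambda>y. decay_wt e 1 y * norm (F y))"
  by (rule integrableI_bounded) (auto simp: weighted_L1_def)

lemma weighted_L1_measurable: "F \<in> weighted_L1 e \<Longrightarrow> F \<in> borel_measurable lebesgue"
  by (simp add: weighted_L1_def)

lemma weighted_L1_mono:
  assumes "F \<in> weighted_L1 e" "G \<in> borel_measurable lebesgue" "\<And>y. norm (G y) \<le> norm (F y)"
  shows "G \<in> weighted_L1 e"
proof -
  have "(\<integral>\<^sup>+y. ennreal (decay_wt e 1 y * norm (G y)) \<partial>lebesgue) \<le> (\<integral>\<^sup>+y. ennreal (decay_wt e 1 y * norm (F y)) \<partial>lebesgue)"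
    using assms(3) by (intro nn_integral_mono ennreal_leI mult_left_mono) auto
  then show ?thesis using assms by (auto simp: weighted_L1_def intro: le_less_trans)
qed

lemma weighted_L1_diff:
  assumes "F \<in> weighted_L1 e" "G \<in> weighted_L1 e"
  shows "(\<lambda>y. F y - G y) \<in> weighted_L1 e"
proof -
  have [measurable]: "F \<in> borel_measurable lebesgue" "G \<in> borel_measurable lebesgue"
    using assms by (auto intro: weighted_L1_measurable)
  have "(\<integral>\<^sup>+y. ennreal (decay_wt e 1 y * norm (F y - G y)) \<partial>lebesgue) \<le>
      (\<integral>\<^sup>+y. ennreal (decay_wt e 1 y * norm (F y)) + ennreal (decay_wt e 1 y * norm (G y)) \<partial>lebesgue)"
    by (intro nn_integral_mono)
      (auto simp: ennreal_plus[symmetric] distrib_left[symmetric] intro!: ennreal_leI mult_left_mono norm_triangle_ineq4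
        simp del: ennreal_plus)
  also have "\<dots> = (\<integral>\<^sup>+y. ennreal (decay_wt e 1 y * norm (F y)) \<partial>lebesgue) + (\<integral>\<^sup>+y. ennreal (decay_wt e 1 y * norm (G y)) \<partial>lebesgue)"
    by (rule nn_integral_add) auto
  also have "\<dots> < \<infinity>" using assms by (simp add: weighted_L1_def)
  finally show ?thesis by (simp add: weighted_L1_def)
qed

lemma bounded_in_weighted_L1:
  fixes F :: "'a::euclidean_space \<Rightarrow> complex"
  assumes e: "e > 0" and [measurable]: "F \<in> borel_measurable lebesgue" and b: "\<And>y. norm (F y) \<le> b"
  shows "F \<in> weighted_L1 e"
proof -
  obtain C where C: "(\<integral>\<^sup>+y. ennreal (decay_wt e 1 (y :: 'a)) \<partial>lebesgue) \<le> ennreal C"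
  proof -
    obtain C where "\<forall>\<tau>>0. \<forall>x::'a. (\<integral>\<^sup>+y. ennreal (decay_wt e \<tau> (x - y)) \<partial>lebesgue) \<le> ennreal C"
      using nn_integral_decay_wt[OF e, where 'a='a] by blast
    from this[rule_format, of 1 0] that show ?thesis by simp
  qed
  have "b \<ge> 0" using b[of 0] norm_ge_zero[of "F 0"] by linarith
  have "(\<integral>\<^sup>+y. ennreal (decay_wt e 1 y * norm (F y)) \<partial>lebesgue) \<le>
      (\<integral>\<^sup>+y. ennreal (decay_wt e 1 (y :: 'a)) * ennreal b \<partial>lebesgue)"
    using b \<open>b \<ge> 0\<close> by (intro nn_integral_mono) (auto simp: ennreal_mult[symmetric] intro!: ennreal_leI mult_left_mono)
  also have "\<dots> = (\<integral>\<^sup>+y. ennreal (decay_wt e 1 (y :: 'a)) \<partial>lebesgue) * ennreal b"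
    by (rule nn_integral_multc) simp
  also have "\<dots> \<le> ennreal C * ennreal b" by (intro mult_right_mono C) simp
  also have "\<dots> < \<infinity>" by (simp add: ennreal_mult_less_top)
  finally show ?thesis by (simp add: weighted_L1_def)
qed

text \<open>Since \<open>min \<tau> 1 * (1 + norm x) \<le> \<tau> + norm x\<close>, a change of
  scale costs a constant depending on \<open>\<tau>\<close>. For each fixed time, integrability may
  therefore be tested against the weight of scale 1.\<close>

lemma decay_wt_le_unit:
  assumes "\<tau> > 0" "e > 0"
  shows "\<exists>K>0. \<forall>x::'a::euclidean_space. decay_wt e \<tau> x \<le> K * decay_wt e 1 x"
proof (intro exI conjI allI)
  let ?N = "real DIM('a) + e"
  let ?s = "min \<tau> 1"
  fix x :: 'a
  have s: "?s > 0" using assms by simp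
  then show "\<tau> powr e * ?s powr (- ?N) > 0" using assms by simp
  have "?s * (1 + norm x) \<le> \<tau> + norm x"
    using assms mult_right_mono[of ?s 1 "norm x"] by (simp add: distrib_left)
  moreover have "0 < ?s * (1 + norm x)" using s by (simp add: add_pos_nonneg)
  ultimately have "(\<tau> + norm x) powr (- ?N) \<le> (?s * (1 + norm x)) powr (- ?N)"
    using assms by (intro powr_mono2') auto
  also have "\<dots> = ?s powr (- ?N) * (1 + norm x) powr (- ?N)"
    using s by (intro powr_mult)
  finally have "\<tau> powr e * (\<tau> + norm x) powr (- ?N) \<le> \<tau> powr e * (?s powr (- ?N) * (1 + norm x) powr (- ?N))"
    by (rule mult_left_mono) simp
  then show "decay_wt e \<tau> x \<le> \<tau> powr e * ?s powr (- ?N) * decay_wt e 1 x"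
    by (simp add: decay_wt_def powr_minus divide_inverse mult.assoc del: minus_add_distrib)
qed

text \<open>At least one of x and x - y has about half the norm of y or more, so one of the two
  factors on the left is bounded by a multiple of the weight at y; the other factor
  survives.\<close>

lemma decay_wt_mult_le:
  fixes x y :: "'a::euclidean_space"
  assumes "e > 0"
  shows "decay_wt e 1 x * decay_wt e 1 (x - y) \<le>
    2 powr (real DIM('a) + e) * decay_wt e 1 y * (decay_wt e 1 x + decay_wt e 1 (x - y))"
proof -
  let ?N = "real DIM('a) + e"
  have half: "decay_wt e 1 z \<le> 2 powr ?N * decay_wt e 1 y" if "norm y \<le> 2 * norm z + 1" for z :: 'a
  proof -
    have "(1 + norm y) powr ?N \<le> (2 * (1 + norm z)) powr ?N"
      using that assms by (intro powr_mono2) auto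
    also have "\<dots> = 2 powr ?N * (1 + norm z) powr ?N"
      by (intro powr_mult)
    finally have *: "(1 + norm y) powr ?N \<le> 2 powr ?N * (1 + norm z) powr ?N" .
    have pos: "(1 + norm z) powr ?N > 0" "(1 + norm y) powr ?N > 0"
      by (smt (verit) norm_ge_zero powr_gt_zero)+
    show ?thesis using * pos by (simp add: decay_wt_def field_simps)
  qed
  have "norm y \<le> norm x + norm (x - y)"
    using norm_triangle_ineq4[of x "x - y"] by simp
  then consider "norm y \<le> 2 * norm x + 1" | "norm y \<le> 2 * norm (x - y) + 1" by linarith
  then show ?thesis
  proof cases
    case 1
    from mult_right_mono[OF half[OF 1], of "decay_wt e 1 (x - y)"]
    have "decay_wt e 1 x * decay_wt e 1 (x - y) \<le> 2 powr ?N * decay_wt e 1 y * decay_wt e 1 (x - y)" by simp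
    also have "\<dots> \<le> 2 powr ?N * decay_wt e 1 y * (decay_wt e 1 x + decay_wt e 1 (x - y))"
      by (intro mult_left_mono) auto
    finally show ?thesis .
  next
    case 2
    from mult_left_mono[OF half[OF 2], of "decay_wt e 1 x"]
    have "decay_wt e 1 x * decay_wt e 1 (x - y) \<le> 2 powr ?N * decay_wt e 1 y * decay_wt e 1 x" by (simp add: mult_ac)
    also have "\<dots> \<le> 2 powr ?N * decay_wt e 1 y * (decay_wt e 1 x + decay_wt e 1 (x - y))"
      by (intro mult_left_mono) auto
    finally show ?thesis .
  qed
qed

text \<open>With w the unit-scale weight, integrating \<open>decay_wt_mult_le\<close> in x shows
  that w convolved with itself is at most a multiple of w; Tonelli then moves the outer weight onto
  F. This yields both the invariance of \<open>weighted_L1\<close> and a majorant for the proof of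
  the semigroup law.\<close>

lemma weighted_L1_convolution:
  fixes F :: "'a::euclidean_space \<Rightarrow> complex"
  assumes e: "e > 0" and F: "F \<in> weighted_L1 e"
  shows "(\<lambda>x. \<integral>\<^sup>+y. ennreal (decay_wt e 1 (x - y) * norm (F y)) \<partial>lebesgue) \<in> borel_measurable lebesgue" (is ?M)
    and "(\<integral>\<^sup>+x. ennreal (decay_wt e 1 x) * (\<integral>\<^sup>+y. ennreal (decay_wt e 1 (x - y) * norm (F y)) \<partial>lebesgue) \<partial>lebesgue) < \<infinity>" (is ?I)
proof -
  let ?w = "decay_wt e 1 :: 'a \<Rightarrow> real"
  have [measurable]: "F \<in> borel_measurable lebesgue" by (rule weighted_L1_measurable[OF F])
  show ?M by measurable
  obtain C where C: "C > 0" "\<And>x::'a. (\<integral>\<^sup>+y. ennreal (?w (x - y)) \<partial>lebesgue) \<le> ennreal C"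
    using nn_integral_decay_wt[OF e, where 'a='a] by (metis zero_less_one)
  have C0: "(\<integral>\<^sup>+x. ennreal (?w x) \<partial>lebesgue) \<le> ennreal C"
    using C(2)[of 0] by (simp add: decay_wt_minus)
  have Cy: "(\<integral>\<^sup>+x. ennreal (?w (x - y)) \<partial>lebesgue) \<le> ennreal C" for y
    using C(2)[of y] by (subst decay_wt_commute)
  let ?K = "2 powr (real DIM('a) + e)"
  have inner: "(\<integral>\<^sup>+x. ennreal (?w x * ?w (x - y)) \<partial>lebesgue) \<le> ennreal (?K * ?w y * (2 * C))" for y
  proof -
    have "(\<integral>\<^sup>+x. ennreal (?w x * ?w (x - y)) \<partial>lebesgue) \<le>
        (\<integral>\<^sup>+x. ennreal (?K * ?w y) * (ennreal (?w x) + ennreal (?w (x - y))) \<partial>lebesgue)"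
      using decay_wt_mult_le[OF e, of _ y]
      by (intro nn_integral_mono) (auto simp: ennreal_plus[symmetric] ennreal_mult[symmetric] intro!: ennreal_leI simp del: ennreal_plus)
    also have "\<dots> = ennreal (?K * ?w y) * ((\<integral>\<^sup>+x. ennreal (?w x) \<partial>lebesgue) + (\<integral>\<^sup>+x. ennreal (?w (x - y)) \<partial>lebesgue))"
      by (subst nn_integral_cmult, simp, subst nn_integral_add) auto
    also have "\<dots> \<le> ennreal (?K * ?w y) * (ennreal C + ennreal C)"
      by (intro mult_left_mono add_mono C0 Cy) auto
    also have "\<dots> = ennreal (?K * ?w y * (2 * C))"
      using C(1) by (simp add: ennreal_plus[symmetric] ennreal_mult[symmetric] del: ennreal_plus)
    finally show ?thesis .
  qed
  have "(\<integral>\<^sup>+x. ennreal (?w x) * (\<integral>\<^sup>+y. ennreal (?w (x - y) * norm (F y)) \<partial>lebesgue) \<partial>lebesgue)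
      = (\<integral>\<^sup>+x. (\<integral>\<^sup>+y. ennreal (?w x * ?w (x - y)) * ennreal (norm (F y)) \<partial>lebesgue) \<partial>lebesgue)"
    by (subst nn_integral_cmult[symmetric]) (auto simp: ennreal_mult mult_ac)
  also have "\<dots> = (\<integral>\<^sup>+y. (\<integral>\<^sup>+x. ennreal (?w x * ?w (x - y)) * ennreal (norm (F y)) \<partial>lebesgue) \<partial>lebesgue)"
    by (rule lebesgue_pair.Fubini') simp
  also have "\<dots> = (\<integral>\<^sup>+y. (\<integral>\<^sup>+x. ennreal (?w x * ?w (x - y)) \<partial>lebesgue) * ennreal (norm (F y)) \<partial>lebesgue)"
    by (subst nn_integral_multc) auto
  also have "\<dots> \<le> (\<integral>\<^sup>+y. ennreal (?K * ?w y * (2 * C)) * ennreal (norm (F y)) \<partial>lebesgue)"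
    by (intro nn_integral_mono mult_right_mono inner) auto
  also have "\<dots> = (\<integral>\<^sup>+y. ennreal (?K * (2 * C)) * ennreal (?w y * norm (F y)) \<partial>lebesgue)"
    using C(1) by (intro nn_integral_cong) (auto simp: ennreal_mult[symmetric] mult_ac)
  also have "\<dots> = ennreal (?K * (2 * C)) * (\<integral>\<^sup>+y. ennreal (?w y * norm (F y)) \<partial>lebesgue)"
    by (rule nn_integral_cmult) simp
  also have "\<dots> < \<infinity>"
    using F by (simp add: weighted_L1_def ennreal_mult_less_top)
  finally show ?I .
qed

lemma continuous_AE_lebesgue_eq:
  fixes f h :: "'a::euclidean_space \<Rightarrow> 'b::t2_space"
  assumes "continuous_on UNIV f" "continuous_on UNIV h" "AE x in lebesgue. f x = h x"
  shows "f x = h x"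
proof -
  have "closed {x. f x = h x}" by (rule closed_Collect_eq[OF assms(1,2)])
  then have "x \<in> {x. f x = h x}" by (rule mem_closed_if_AE_lebesgue) (use assms(3) in simp)
  then show ?thesis by simp
qed

section \<open>The classes of functions of polynomial growth\<close>

lemma decay_wt_unit: "decay_wt b 1 x = (1 + norm x) powr (- (real DIM('a) + b))" for x :: "'a::euclidean_space"
  by (simp add: decay_wt_def powr_minus_divide del: minus_add_distrib)

lemma powr_norm_diff_le:
  fixes a b :: complex
  assumes "p \<ge> 0"
  shows "norm (a - b) powr p \<le> 2 powr p * (norm a powr p + norm b powr p)"
proof -
  have "norm (a - b) powr p \<le> (norm a + norm b) powr p"
    using assms by (intro powr_mono2 norm_triangle_ineq4) auto
  also have "\<dots> \<le> 2 powr p * (norm a powr p + norm b powr p)"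
    using assms by (intro powr_add_le) auto
  finally show ?thesis .
qed

lemma Lp_loc_diff:
  fixes f h :: "'a::euclidean_space \<Rightarrow> complex"
  assumes f: "f \<in> Lp_loc p" and h: "h \<in> Lp_loc p" and p: "p \<ge> 0"
  shows "(\<lambda>x. f x - h x) \<in> Lp_loc p"
proof -
  have [measurable]: "f \<in> borel_measurable lebesgue" "h \<in> borel_measurable lebesgue"
    using f h by (auto intro: Lp_loc_measurable)
  have "set_integrable lebesgue K (\<lambda>x. norm (f x - h x) powr p)" if K: "compact K" for K
    unfolding set_integrable_def
  proof (rule Bochner_Integration.integrable_bound)
    have [measurable]: "K \<in> sets lebesgue"
      by (rule fmeasurableD[OF lmeasurable_compact[OF K]])
    show "(\<lambda>x. indicat_real K x *\<^sub>R norm (f x - h x) powr p) \<in> borel_measurable lebesgue"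
      by measurable
    show "integrable lebesgue (\<lambda>x. 2 powr p * (indicator K x *\<^sub>R norm (f x) powr p + indicator K x *\<^sub>R norm (h x) powr p))"
      using f h K by (intro integrable_mult_right Bochner_Integration.integrable_add) (auto simp: Lp_loc_def set_integrable_def)
    show "AE x in lebesgue. norm (indicator K x *\<^sub>R norm (f x - h x) powr p) \<le>
        norm (2 powr p * (indicator K x *\<^sub>R norm (f x) powr p + indicator K x *\<^sub>R norm (h x) powr p))"
      using powr_norm_diff_le[OF p] by (intro AE_I2) (auto simp: indicator_def)
  qed
  then show ?thesis by (simp add: Lp_loc_def)
qed

lemma Lp_loc_const: "(\<lambda>_::'a::euclidean_space. c) \<in> Lp_loc p"
proof -
  have "set_integrable lebesgue K (\<lambda>_::'a. norm c powr p)" if "compact K" for K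
  proof -
    have "integrable lebesgue (indicat_real K)"
    proof (rule integrable_real_indicator)
      show "K \<in> sets lebesgue" by (rule fmeasurableD[OF lmeasurable_compact[OF that]])
      show "emeasure lebesgue K < \<infinity>"
        using fmeasurableD2[OF lmeasurable_compact[OF that]] by (simp only: less_top infinity_ennreal_def)
    qed
    then show ?thesis
      unfolding set_integrable_def by (rule integrable_scaleR_left)
  qed
  then show ?thesis by (simp add: Lp_loc_def)
qed

lemma morrey_bound_imp_Lp_loc:
  fixes F :: "'a::euclidean_space \<Rightarrow> complex"
  assumes [measurable]: "F \<in> borel_measurable lebesgue" and bd: "morrey_bound p lam (\<lambda>_ _ _. 0) F S"
  shows "F \<in> Lp_loc p"
proof -
  have "set_integrable lebesgue K (\<lambda>x. norm (F x) powr p)" if K: "compact K" for K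
    unfolding set_integrable_def
  proof (rule integrableI_bounded)
    have [measurable]: "K \<in> sets lebesgue"
      by (rule fmeasurableD[OF lmeasurable_compact[OF K]])
    show "(\<lambda>x. indicat_real K x *\<^sub>R norm (F x) powr p) \<in> borel_measurable lebesgue"
      by measurable
    obtain r where r: "r > 0" "K \<subseteq> ball 0 r"
      using compact_imp_bounded[OF K] bounded_subset_ballD by blast
    have "(\<integral>\<^sup>+x. ennreal (norm (indicat_real K x *\<^sub>R norm (F x) powr p)) \<partial>lebesgue) \<le>
        (\<integral>\<^sup>+x\<in>ball 0 r. ennreal (norm (F x) powr p) \<partial>lebesgue)"
      using r by (intro nn_integral_mono) (auto simp: indicator_def)
    also have "\<dots> \<le> ennreal (S powr p * r powr lam)"
      using bd r by (simp add: morrey_bound_def)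
    also have "\<dots> < \<infinity>" by simp
    finally show "(\<integral>\<^sup>+x. ennreal (norm (indicat_real K x *\<^sub>R norm (F x) powr p)) \<partial>lebesgue) < \<infinity>" .
  qed
  then show ?thesis by (simp add: Lp_loc_def)
qed

lemma M_weighted_mono:
  assumes "b \<le> b'"
  shows "M_weighted p b \<subseteq> M_weighted p b'"
proof
  fix f :: "'a \<Rightarrow> complex" assume f: "f \<in> M_weighted p b"
  have [measurable]: "f \<in> borel_measurable lebesgue"
    using f by (auto simp: M_weighted_def intro: Lp_loc_measurable)
  have "integrable lebesgue (\<lambda>x. norm (f x) powr p * (1 + norm x) powr (- (real DIM('a) + b')))"
  proof (rule Bochner_Integration.integrable_bound)
    show "integrable lebesgue (\<lambda>x. norm (f x) powr p * (1 + norm x) powr (- (real DIM('a) + b)))"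
      using f by (simp add: M_weighted_def)
    show "AE x in lebesgue. norm (norm (f x) powr p * (1 + norm x) powr (- (real DIM('a) + b')))
        \<le> norm (norm (f x) powr p * (1 + norm x) powr (- (real DIM('a) + b)))"
      using assms by (intro AE_I2) (auto simp: abs_mult intro!: mult_left_mono powr_mono)
  qed measurable
  then show "f \<in> M_weighted p b'" using f by (simp add: M_weighted_def)
qed

lemma M_weighted_diff:
  fixes f h :: "'a::euclidean_space \<Rightarrow> complex"
  assumes f: "f \<in> M_weighted p b" and h: "h \<in> M_weighted p b" and p: "p \<ge> 0"
  shows "(\<lambda>x. f x - h x) \<in> M_weighted p b"
proof -
  have fl: "f \<in> Lp_loc p" "h \<in> Lp_loc p" using f h by (auto simp: M_weighted_def)
  then have [measurable]: "f \<in> borel_measurable lebesgue" "h \<in> borel_measurable lebesgue"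
    by (auto intro: Lp_loc_measurable)
  let ?w = "\<lambda>x::'a. (1 + norm x) powr (- (real DIM('a) + b))"
  have "integrable lebesgue (\<lambda>x. norm (f x - h x) powr p * ?w x)"
  proof (rule Bochner_Integration.integrable_bound)
    show "integrable lebesgue (\<lambda>x. 2 powr p * (norm (f x) powr p * ?w x + norm (h x) powr p * ?w x))"
      using f h by (intro integrable_mult_right Bochner_Integration.integrable_add) (auto simp: M_weighted_def)
    show "AE x in lebesgue. norm (norm (f x - h x) powr p * ?w x) \<le>
        norm (2 powr p * (norm (f x) powr p * ?w x + norm (h x) powr p * ?w x))"
    proof (intro AE_I2)
      fix x
      have "norm (f x - h x) powr p * ?w x \<le> 2 powr p * (norm (f x) powr p + norm (h x) powr p) * ?w x"
        by (intro mult_right_mono powr_norm_diff_le p) auto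
      also have "\<dots> = 2 powr p * (norm (f x) powr p * ?w x + norm (h x) powr p * ?w x)"
        by (simp add: distrib_right)
      finally show "norm (norm (f x - h x) powr p * ?w x) \<le>
          norm (2 powr p * (norm (f x) powr p * ?w x + norm (h x) powr p * ?w x))"
        by simp
    qed
  qed measurable
  then show ?thesis using Lp_loc_diff[OF fl p] by (simp add: M_weighted_def)
qed

lemma M_weighted_const:
  assumes "b > 0"
  shows "(\<lambda>_::'a::euclidean_space. c) \<in> M_weighted p b"
proof -
  have "(\<lambda>_::'a. 1) \<in> weighted_L1 b"
    using assms by (rule bounded_in_weighted_L1[where b = 1]) auto
  from weighted_L1_integrable[OF this]
  have "integrable lebesgue (\<lambda>x::'a. norm c powr p * (decay_wt b 1 x * norm (1 :: complex)))"
    by (rule integrable_mult_right)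
  then show ?thesis by (simp add: M_weighted_def Lp_loc_const decay_wt_unit)
qed

text \<open>Balls of radius 1 suffice: uniformly bounded integrals over them make
  \<open>norm (F y) powr p\<close> integrable against every weight \<open>decay_wt b 1\<close>. As b
  is arbitrary, this will place Morrey functions in \<open>M_class\<close> whatever
  \<open>Theta\<close> is.\<close>

lemma morrey_bound_imp_M_weighted:
  fixes F :: "'a::euclidean_space \<Rightarrow> complex"
  assumes Fm [measurable]: "F \<in> borel_measurable lebesgue" and bd: "morrey_bound p lam (\<lambda>_ _ _. 0) F S" and b: "b > 0"
  shows "F \<in> M_weighted p b"
proof -
  define A where "A = S powr p / ball_vol TYPE('a)"
  obtain C where C: "\<And>\<tau> x::'a. \<tau> > 0 \<Longrightarrow> (\<integral>\<^sup>+y. ennreal (decay_wt b \<tau> (x - y)) \<partial>lebesgue) \<le> ennreal C"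
    using nn_integral_decay_wt[OF b, where 'a='a] by blast
  have "(\<integral>\<^sup>+y\<in>ball z 1. ennreal (norm (F y) powr p) \<partial>lebesgue) \<le> ennreal A * emeasure lebesgue (ball z 1)" for z
    using bd[unfolded morrey_bound_def, rule_format, of 1 z] by (simp add: A_def emeasure_lborel_ball ennreal_mult[symmetric])
  from nn_integral_decay_wt_mult_le[OF _ b zero_less_one zero_less_one this, of 0]
  have "(\<integral>\<^sup>+y. ennreal (decay_wt b 1 (0 - y)) * ennreal (norm (F y) powr p) \<partial>lebesgue) \<le>
      ennreal ((1 + 1 / 1) powr (real DIM('a) + b)) * ennreal A * (\<integral>\<^sup>+y. ennreal (decay_wt b 1 (0 - y :: 'a)) \<partial>lebesgue)"
    by simp
  also have "\<dots> \<le> ennreal ((1 + 1 / 1) powr (real DIM('a) + b)) * ennreal A * ennreal C"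
    by (intro mult_left_mono C) auto
  also have "\<dots> < \<infinity>" by (simp add: ennreal_mult_less_top)
  finally have "(\<integral>\<^sup>+y. ennreal (norm (norm (F y) powr p * decay_wt b 1 y)) \<partial>lebesgue) < \<infinity>"
    by (simp add: ennreal_mult abs_mult mult.commute)
  then have "integrable lebesgue (\<lambda>y. norm (F y) powr p * decay_wt b 1 y)"
    by (intro integrableI_bounded) auto
  then show ?thesis
    using morrey_bound_imp_Lp_loc[OF Fm bd] by (simp add: M_weighted_def decay_wt_unit)
qed

text \<open>Apply \<open>x \<le> s + s\<^bsup>1-p\<^esup> x\<^sup>p\<close> with \<open>s = (1 + \<bar>y\<bar>)\<^bsup>b/p\<^esup>\<close>.\<close>

lemma M_weighted_subset_weighted_L1:
  assumes p: "p > 1" and b: "b > 0" "b / p < e"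
  shows "(M_weighted p b :: ('a::euclidean_space \<Rightarrow> complex) set) \<subseteq> weighted_L1 e"
proof
  fix f :: "'a \<Rightarrow> complex" assume f: "f \<in> M_weighted p b"
  have fm [measurable]: "f \<in> borel_measurable lebesgue"
    using f by (auto simp: M_weighted_def intro: Lp_loc_measurable)
  let ?w = "\<lambda>b x::'a. (1 + norm x) powr (- (real DIM('a) + b))"
  \<comment> \<open>The threshold term \<open>(1 + norm y) powr (b / p)\<close> lowers the decay
    from e to \<open>e - b / p\<close>, which is still positive. The same inequality makes the
    factor of \<open>norm (f x) powr p\<close> at most the weight of order b.\<close>
  have "(\<lambda>_::'a. 1) \<in> weighted_L1 (e - b / p)"
    using assms by (intro bounded_in_weighted_L1[where b = 1]) auto
  from weighted_L1_integrable[OF this]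
  have 1: "integrable lebesgue (\<lambda>x::'a. ?w (e - b / p) x)"
    by (simp add: decay_wt_unit)
  have 2: "integrable lebesgue (\<lambda>x. norm (f x) powr p * ?w b x)"
    using f by (simp add: M_weighted_def)
  have "integrable lebesgue (\<lambda>x. decay_wt e 1 x * norm (f x))"
  proof (rule Bochner_Integration.integrable_bound[OF Bochner_Integration.integrable_add[OF 1 2]])
    show "AE x in lebesgue. norm (decay_wt e 1 x * norm (f x)) \<le> norm (?w (e - b / p) x + norm (f x) powr p * ?w b x)"
    proof (intro AE_I2)
      fix x :: 'a
      define q where "q = 1 + norm x"
      have q: "q \<ge> 1" by (simp add: q_def)
      have "norm (f x) \<le> q powr (b / p) + (q powr (b / p)) powr (1 - p) * norm (f x) powr p"
        using p q by (intro le_add_powr) auto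
      from mult_left_mono[OF this, of "?w e x"]
      have "?w e x * norm (f x) \<le> ?w e x * q powr (b / p) + (?w e x * (q powr (b / p)) powr (1 - p)) * norm (f x) powr p"
        by (simp add: distrib_left mult.assoc)
      also have "?w e x * q powr (b / p) = ?w (e - b / p) x"
      proof -
        have "- (real DIM('a) + e) + b / p = - (real DIM('a) + (e - b / p))" by simp
        then show ?thesis by (simp only: q_def[symmetric] powr_add[symmetric])
      qed
      also have "?w e x * (q powr (b / p)) powr (1 - p) = q powr (b / p * (1 - p) - (real DIM('a) + e))"
      proof -
        have "- (real DIM('a) + e) + b / p * (1 - p) = b / p * (1 - p) - (real DIM('a) + e)" by simp
        then show ?thesis by (simp only: q_def[symmetric] powr_powr powr_add[symmetric])
      qed
      also have "\<dots> \<le> ?w b x"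
      proof -
        have "b / p * (1 - p) = b / p - b" using p by (simp add: field_simps)
        then show ?thesis unfolding q_def[symmetric] using q b by (intro powr_mono) auto
      qed
      finally have "?w e x * norm (f x) \<le> ?w (e - b / p) x + ?w b x * norm (f x) powr p"
        by (simp add: mult_right_mono)
      then show "norm (decay_wt e 1 x * norm (f x)) \<le> norm (?w (e - b / p) x + norm (f x) powr p * ?w b x)"
        by (simp add: decay_wt_unit abs_mult mult.commute)
    qed
  qed measurable
  then show "f \<in> weighted_L1 e"
    by (simp add: weighted_L1_def integrable_iff_bounded abs_mult)
qed

section \<open>Quotients\<close>

text \<open>Injectivity holds because r is the restriction of s to A, surjectivity because every
  s-class meets A. For the Morrey spaces these two conditions carry the analytic content.\<close>

lemma bij_betw_quotients:
  assumes A: "equiv A r" and B: "equiv B s" and sub: "A \<subseteq> B"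
    and rs: "\<And>x y. x \<in> A \<Longrightarrow> y \<in> A \<Longrightarrow> (x, y) \<in> r \<longleftrightarrow> (x, y) \<in> s"
    and surj: "\<And>y. y \<in> B \<Longrightarrow> \<exists>x\<in>A. (x, y) \<in> s"
  shows "bij_betw (\<lambda>X. s `` X) (A // r) (B // s)"
proof -
  have img: "s `` (r `` {x}) = s `` {x}" if x: "x \<in> A" for x
  proof
    show "s `` {x} \<subseteq> s `` (r `` {x})"
      using equiv_class_self[OF A x] by blast
    show "s `` (r `` {x}) \<subseteq> s `` {x}"
    proof
      fix z assume "z \<in> s `` (r `` {x})"
      then obtain y where y: "(x, y) \<in> r" "(y, z) \<in> s" by blast
      then have "y \<in> A" using A by (auto simp: equiv_def refl_on_def)
      then have "(x, y) \<in> s" using rs x y(1) by blast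
      then show "z \<in> s `` {x}" using y(2) B by (auto simp: equiv_def elim: transE)
    qed
  qed
  show ?thesis
    unfolding bij_betw_def
  proof
    show "inj_on ((``) s) (A // r)"
    proof (rule inj_onI)
      fix X Y assume "X \<in> A // r" "Y \<in> A // r" and eq: "s `` X = s `` Y"
      then obtain x y where xy: "x \<in> A" "X = r `` {x}" "y \<in> A" "Y = r `` {y}"
        by (auto elim!: quotientE)
      then have "s `` {x} = s `` {y}" using eq img by simp
      then have "(x, y) \<in> s" using eq_equiv_class[OF _ B] xy sub by blast
      then have "(x, y) \<in> r" using rs xy by blast
      then show "X = Y" using equiv_class_eq[OF A] xy by blast
    qed
    show "(``) s ` (A // r) = B // s"
    proof
      show "(``) s ` (A // r) \<subseteq> B // s"
      proof clarify
        fix X assume "X \<in> A // r"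
        then obtain x where x: "x \<in> A" "X = r `` {x}" by (auto elim!: quotientE)
        then show "s `` X \<in> B // s" using img sub by (auto intro: quotientI)
      qed
      show "B // s \<subseteq> (``) s ` (A // r)"
      proof
        fix Y assume "Y \<in> B // s"
        then obtain y where y: "y \<in> B" "Y = s `` {y}" by (auto elim!: quotientE)
        obtain x where x: "x \<in> A" "(x, y) \<in> s" using surj[OF y(1)] by blast
        have "Y = s `` (r `` {x})"
          using equiv_class_eq[OF B x(2)] y(2) img[OF x(1)] by simp
        then show "Y \<in> (``) s ` (A // r)" using x(1) by (auto intro: quotientI)
      qed
    qed
  qed
qed

lemma equiv_mod_rel:
  assumes zero: "(\<lambda>_. 0) \<in> N"
    and diff: "\<And>f h. f \<in> N \<Longrightarrow> h \<in> N \<Longrightarrow> (\<lambda>x. f x - h x) \<in> N"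
  shows "equiv A (mod_rel A N)"
proof (rule equivI)
  have neg: "(\<lambda>x. - f x) \<in> N" if "f \<in> N" for f
    using diff[OF zero that] by simp
  show "mod_rel A N \<subseteq> A \<times> A" by (auto simp: mod_rel_def)
  show "refl_on A (mod_rel A N)" using zero by (auto simp: refl_on_def mod_rel_def)
  show "sym (mod_rel A N)"
    using neg by (force simp: sym_def mod_rel_def)
  show "trans (mod_rel A N)"
  proof (rule transI)
    fix f h u assume fh: "(f, h) \<in> mod_rel A N" and hu: "(h, u) \<in> mod_rel A N"
    have "(\<lambda>x. f x - h x) \<in> N" "(\<lambda>x. h x - u x) \<in> N"
      using fh hu by (auto simp: mod_rel_def)
    then have "(\<lambda>x. (f x - h x) - - (h x - u x)) \<in> N"
      using diff[OF _ neg] by blast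
    then show "(f, u) \<in> mod_rel A N" using fh hu by (auto simp: mod_rel_def)
  qed
qed

lemma const_fns_diff:
  assumes "f \<in> const_fns" "h \<in> const_fns"
  shows "(\<lambda>x::'a::euclidean_space. f x - h x) \<in> const_fns"
proof -
  obtain c d where "AE x in lebesgue. f x = c" "AE x in lebesgue. h x = d"
    using assms by (auto simp: const_fns_def ae_eq_def)
  then have "AE x in lebesgue. f x - h x = c - d" by eventually_elim simp
  then show ?thesis by (auto simp: const_fns_def ae_eq_def)
qed

lemma const_fns_0: "(\<lambda>_. 0) \<in> const_fns"
  by (auto simp: const_fns_def ae_eq_def)

lemma morrey_bound_cong_AE:
  assumes "\<And>x r. r > 0 \<Longrightarrow> AE y in lebesgue. f y - a x r y = f' y - a' x r y"
  shows "morrey_bound p lam a f S \<longleftrightarrow> morrey_bound p lam a' f' S"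
proof -
  have "(\<integral>\<^sup>+y\<in>ball x r. ennreal (norm (f y - a x r y) powr p) \<partial>lebesgue) =
      (\<integral>\<^sup>+y\<in>ball x r. ennreal (norm (f' y - a' x r y) powr p) \<partial>lebesgue)" if "r > 0" for x r
    using assms[OF that, of x] by (intro nn_integral_cong_AE) (auto elim: eventually_mono)
  then show ?thesis unfolding morrey_bound_def by simp
qed

section \<open>The heat semigroup\<close>

text \<open>Positive times lie in the sector by \<open>theta_pos\<close>; \<open>kernel_cont\<close>
  makes P_t F continuous, which turns the semigroup law from an almost-everywhere statement into a
  pointwise one; \<open>kernel_conserv\<close> makes constants fixed points.\<close>

locale heat_semigroup =
  fixes m \<theta> :: real and g :: "real \<Rightarrow> real"
    and D :: "('a::euclidean_space \<Rightarrow> complex) set"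
    and L :: "('a \<Rightarrow> complex) \<Rightarrow> 'a \<Rightarrow> complex"
    and T :: "complex \<Rightarrow> ('a \<Rightarrow> complex) \<Rightarrow> 'a \<Rightarrow> complex"
    and k :: "real \<Rightarrow> 'a \<Rightarrow> 'a \<Rightarrow> complex"
  assumes theta_pos: "\<theta> > 0"
    and analytic_semigroup: "generates_analytic_semigroup \<theta> D L T"
    and kernel_bounds: "heat_kernel_bounds T m g k"
    and kernel_cont: "\<And>t. t > 0 \<Longrightarrow> continuous_on UNIV (\<lambda>z. k t (fst z) (snd z))"
    and kernel_conserv: "\<And>t x. t > 0 \<Longrightarrow> integral\<^sup>L lebesgue (\<lambda>y. k t x y) = 1"
begin

section \<open>Domination of the heat kernel by decay weights\<close>

lemma m_pos: "m > 0"
  using kernel_bounds by (simp add: heat_kernel_bounds_def)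

text \<open>\<open>Theta\<close> is the supremum of these exponents and need not be one of them, so
  arguments pick an admissible exponent strictly above the value they require.\<close>

definition admissible :: "real \<Rightarrow> bool" where
  "admissible e \<longleftrightarrow> e > 0 \<and> ((\<lambda>r. r powr (real DIM('a) + e) * g r) \<longlongrightarrow> 0) at_top"

lemma kernel_cont_right: "t > 0 \<Longrightarrow> continuous_on UNIV (\<lambda>y. k t x y)"
  using continuous_on_compose2[OF kernel_cont, of t UNIV "\<lambda>y. (x, y)"]
  by (simp add: continuous_on_Pair continuous_on_const continuous_on_id)

lemma kernel_cont_left: "t > 0 \<Longrightarrow> continuous_on UNIV (\<lambda>x. k t x y)"
  using continuous_on_compose2[OF kernel_cont, of t UNIV "\<lambda>x. (x, y)"]
  by (simp add: continuous_on_Pair continuous_on_const continuous_on_id)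

lemma kernel_measurable: "t > 0 \<Longrightarrow> (\<lambda>y. k t x y) \<in> borel_measurable lebesgue"
  by (intro measurable_completion) (simp add: borel_measurable_continuous_onI kernel_cont_right)

text \<open>Admissibility controls g at infinity and boundedness controls it elsewhere; together
  they give g(r) at most a multiple of (1 + r)^(-(n + e)). Rescaling by
  \<open>t powr (1 / m)\<close> turns this into the weight at that scale.\<close>

lemma kernel_le_decay_wt:
  assumes "admissible e"
  shows "\<exists>C>0. \<forall>t>0. \<forall>x y. norm (k t x y) \<le> C * decay_wt e (t powr (1 / m)) (x - y)"
proof -
  let ?N = "real DIM('a) + e"
  have e: "e > 0" and lim: "((\<lambda>r. r powr ?N * g r) \<longlongrightarrow> 0) at_top"
    using assms by (auto simp: admissible_def)
  have prof: "heat_kernel_profile (real DIM('a)) g"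
    using kernel_bounds by (simp add: heat_kernel_bounds_def)
  then obtain M where M: "\<And>r. r \<ge> 0 \<Longrightarrow> g r \<le> M" by (auto simp: heat_kernel_profile_def)
  have gpos: "g r > 0" if "r \<ge> 0" for r using prof that by (auto simp: heat_kernel_profile_def)
  have Mpos: "M > 0" using M[of 0] gpos[of 0] by simp
  obtain c where c: "c > 0" "\<And>t x y. t > 0 \<Longrightarrow>
      norm (k t x y) \<le> c * t powr (- real DIM('a) / m) * g (norm (x - y) / t powr (1 / m))"
    using kernel_bounds by (auto simp: heat_kernel_bounds_def)
  have "\<forall>\<^sub>F r in at_top. r powr ?N * g r < 1"
    using lim by (rule order_tendstoD(2)) simp
  then obtain R0 where R0: "\<And>r. r \<ge> R0 \<Longrightarrow> r powr ?N * g r < 1"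
    by (auto simp: eventually_at_top_linorder)
  define R where "R = max R0 1"
  \<comment> \<open>The first summand serves \<open>r < R\<close>, where \<open>g r \<le> M\<close>;
    the second serves \<open>r \<ge> R\<close>, where \<open>1 + r \<le> 2 * r\<close> and
    \<open>r powr ?N * g r < 1\<close>.\<close>
  define C where "C = M * (1 + R) powr ?N + 2 powr ?N"
  have C: "C > 0" using Mpos by (simp add: C_def add_nonneg_pos)
  have gC: "g r \<le> C * (1 + r) powr (- ?N)" if r: "r \<ge> 0" for r
  proof -
    have "g r * (1 + r) powr ?N \<le> C"
    proof (cases "r \<ge> R")
      case True
      then have r1: "r \<ge> 1" "r \<ge> R0" by (auto simp: R_def)
      have "(1 + r) powr ?N \<le> (2 * r) powr ?N" using r1 e by (intro powr_mono2) auto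
      also have "\<dots> = 2 powr ?N * r powr ?N" using r by (intro powr_mult)
      finally have "g r * (1 + r) powr ?N \<le> g r * (2 powr ?N * r powr ?N)"
        using gpos[OF r] by (intro mult_left_mono) auto
      also have "\<dots> = 2 powr ?N * (r powr ?N * g r)" by simp
      also have "\<dots> \<le> 2 powr ?N * 1" using R0[OF r1(2)] by (intro mult_left_mono) auto
      also have "\<dots> \<le> C" using Mpos by (simp add: C_def)
      finally show ?thesis .
    next
      case False
      have "g r * (1 + r) powr ?N \<le> M * (1 + R) powr ?N"
        using False r e Mpos M[OF r] by (intro mult_mono powr_mono2) auto
      then show ?thesis by (simp add: C_def add_increasing2)
    qed
    then show ?thesis using r by (simp add: powr_minus field_simps del: minus_add_distrib)
  qed
  have "norm (k t x y) \<le> (c * C) * decay_wt e (t powr (1 / m)) (x - y)" if t: "t > 0" for t x y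
  proof -
    define \<tau> where "\<tau> = t powr (1 / m)"
    define d where "d = norm (x - y)"
    have \<tau>: "\<tau> > 0" and d: "d \<ge> 0" using t by (auto simp: \<tau>_def d_def)
    have "norm (k t x y) \<le> c * t powr (- real DIM('a) / m) * g (d / \<tau>)"
      using c(2)[OF t] by (simp add: \<tau>_def d_def)
    also have "t powr (- real DIM('a) / m) = \<tau> powr (- real DIM('a))"
      by (simp add: \<tau>_def powr_powr)
    also have "c * \<tau> powr (- real DIM('a)) * g (d / \<tau>) \<le> c * \<tau> powr (- real DIM('a)) * (C * (1 + d / \<tau>) powr (- ?N))"
      using gC[of "d / \<tau>"] d \<tau> c by (intro mult_left_mono) auto
    also have "1 + d / \<tau> = (\<tau> + d) / \<tau>" using \<tau> by (simp add: field_simps)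
    also have "((\<tau> + d) / \<tau>) powr (- ?N) = (\<tau> + d) powr (- ?N) * \<tau> powr ?N"
      using \<tau> d by (simp add: powr_divide powr_minus field_simps del: minus_add_distrib)
    also have "c * \<tau> powr (- real DIM('a)) * (C * ((\<tau> + d) powr (- ?N) * \<tau> powr ?N)) =
        c * C * (\<tau> + d) powr (- ?N) * (\<tau> powr (- real DIM('a)) * \<tau> powr ?N)" by simp
    also have "\<tau> powr (- real DIM('a)) * \<tau> powr ?N = \<tau> powr e"
      by (simp add: powr_add[symmetric])
    finally show ?thesis
      by (simp add: decay_wt_def \<tau>_def d_def powr_minus divide_inverse mult_ac del: minus_add_distrib)
  qed
  then show ?thesis using c(1) C by (intro exI[of _ "c * C"]) auto
qed

lemma kernel_le_unit:
  assumes "admissible e" "t > 0"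
  shows "\<exists>K>0. \<forall>x y. norm (k t x y) \<le> K * decay_wt e 1 (x - y)"
proof -
  obtain C where C: "C > 0" "\<And>x y. norm (k t x y) \<le> C * decay_wt e (t powr (1 / m)) (x - y)"
    using kernel_le_decay_wt[OF assms(1)] assms(2) by blast
  obtain K where K: "K > 0" "\<And>x::'a. decay_wt e (t powr (1 / m)) x \<le> K * decay_wt e 1 x"
    using decay_wt_le_unit[of "t powr (1 / m)" e] assms by (auto simp: admissible_def)
  have "norm (k t x y) \<le> C * K * decay_wt e 1 (x - y)" for x y
  proof -
    have "C * decay_wt e (t powr (1 / m)) (x - y) \<le> C * (K * decay_wt e 1 (x - y))"
      using C(1) by (intro mult_left_mono K) auto
    then show ?thesis using C(2)[of x y] by (simp add: mult.assoc)
  qed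
  then show ?thesis using C(1) K(1) by (intro exI[of _ "C * K"]) auto
qed

text \<open>For x in a bounded set the shift from x - y to - y costs one constant. The resulting
  majorant is independent of x and serves for dominated convergence.\<close>

lemma kernel_le_locally:
  assumes "admissible e" "t > 0"
  shows "\<exists>K>0. \<forall>x y. norm x \<le> R \<longrightarrow> norm (k t x y) \<le> K * decay_wt e 1 y"
proof -
  obtain C where C: "C > 0" "\<And>x y. norm (k t x y) \<le> C * decay_wt e 1 (x - y)"
    using kernel_le_unit[OF assms] by blast
  let ?K = "C * (1 + \<bar>R\<bar>) powr (real DIM('a) + e)"
  have "norm (k t x y) \<le> ?K * decay_wt e 1 y" if "norm x \<le> R" for x y
  proof -
    have "decay_wt e 1 (x - y) \<le> (1 + \<bar>R\<bar>) powr (real DIM('a) + e) * decay_wt e 1 (- y)"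
      using decay_wt_le_shift[of 1 e "\<bar>R\<bar>" "x - y" "- y"] that assms by (simp add: admissible_def)
    from mult_left_mono[OF this, of C] C(1)
    have "C * decay_wt e 1 (x - y) \<le> ?K * decay_wt e 1 y" by (simp add: mult.assoc)
    then show ?thesis using C(2)[of x y] by linarith
  qed
  moreover have "?K > 0" using C(1) by simp
  ultimately show ?thesis by blast
qed

section \<open>Convergence, continuity and invariance for P_t on the weighted space\<close>

lemma heat_ext_integrable:
  assumes "admissible e" "t > 0" "F \<in> weighted_L1 e"
  shows "integrable lebesgue (\<lambda>y. k t x y * F y)"
proof -
  obtain K where K: "K > 0" "\<And>y. norm (k t x y) \<le> K * decay_wt e 1 y"
    using kernel_le_locally[OF assms(1,2), of "norm x"] by auto
  have [measurable]: "F \<in> borel_measurable lebesgue" "(\<lambda>y. k t x y) \<in> borel_measurable lebesgue"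
    using assms by (auto intro: weighted_L1_measurable kernel_measurable)
  show ?thesis
  proof (rule Bochner_Integration.integrable_bound)
    show "integrable lebesgue (\<lambda>y. K * (decay_wt e 1 y * norm (F y)))"
      by (intro integrable_mult_right weighted_L1_integrable assms)
    show "AE y in lebesgue. norm (k t x y * F y) \<le> norm (K * (decay_wt e 1 y * norm (F y)))"
    proof (intro AE_I2)
      fix y
      have "norm (k t x y) * norm (F y) \<le> K * decay_wt e 1 y * norm (F y)"
        by (intro mult_right_mono K) simp
      then show "norm (k t x y * F y) \<le> norm (K * (decay_wt e 1 y * norm (F y)))"
        using K(1) by (simp add: norm_mult abs_mult mult.assoc)
    qed
  qed simp
qed

lemma heat_ext_cont:
  assumes "admissible e" "t > 0" "F \<in> weighted_L1 e"
  shows "continuous_on UNIV (heat_ext k t F)"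
  unfolding continuous_on_sequentially
proof (intro allI ballI impI)
  fix u and x :: 'a assume "(\<forall>j::nat. u j \<in> UNIV) \<and> u \<longlonglongrightarrow> x"
  then have u: "u \<longlonglongrightarrow> x" by simp
  then have "Bseq u" by (intro convergent_imp_Bseq) (auto simp: convergent_def)
  then obtain R where R: "\<And>j. norm (u j) \<le> R" by (auto simp: Bseq_def)
  obtain K where K: "K > 0" "\<And>z y. norm z \<le> R \<Longrightarrow> norm (k t z y) \<le> K * decay_wt e 1 y"
    using kernel_le_locally[OF assms(1,2), of R] by auto
  have [measurable]: "F \<in> borel_measurable lebesgue" "\<And>x. (\<lambda>y. k t x y) \<in> borel_measurable lebesgue"
    using assms by (auto intro: weighted_L1_measurable kernel_measurable)
  have "(\<lambda>j. LINT y|lebesgue. k t (u j) y * F y) \<longlonglongrightarrow> (LINT y|lebesgue. k t x y * F y)"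
  proof (rule integral_dominated_convergence)
    show "integrable lebesgue (\<lambda>y. K * (decay_wt e 1 y * norm (F y)))"
      by (intro integrable_mult_right weighted_L1_integrable assms)
    show "AE y in lebesgue. norm (k t (u j) y * F y) \<le> K * (decay_wt e 1 y * norm (F y))" for j
    proof (intro AE_I2)
      fix y
      have "norm (k t (u j) y) * norm (F y) \<le> K * decay_wt e 1 y * norm (F y)"
        by (intro mult_right_mono K R) simp
      then show "norm (k t (u j) y * F y) \<le> K * (decay_wt e 1 y * norm (F y))"
        by (simp add: norm_mult mult.assoc)
    qed
    show "AE y in lebesgue. (\<lambda>j. k t (u j) y * F y) \<longlonglongrightarrow> k t x y * F y"
    proof (intro AE_I2 tendsto_mult tendsto_const)
      fix y
      show "(\<lambda>j. k t (u j) y) \<longlonglongrightarrow> k t x y"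
        using continuous_on_tendsto_compose[OF kernel_cont_left[OF assms(2), of y] u] by simp
    qed
  qed simp_all
  then show "(heat_ext k t F \<circ> u) \<longlonglongrightarrow> heat_ext k t F x"
    by (simp add: heat_ext_def o_def)
qed

lemma heat_ext_measurable:
  assumes "admissible e" "t > 0" "F \<in> weighted_L1 e"
  shows "heat_ext k t F \<in> borel_measurable lebesgue"
  by (intro measurable_completion) (simp add: borel_measurable_continuous_onI heat_ext_cont[OF assms])

lemma heat_ext_diff:
  assumes "admissible e" "t > 0" "F \<in> weighted_L1 e" "G \<in> weighted_L1 e"
  shows "heat_ext k t (\<lambda>y. F y - G y) x = heat_ext k t F x - heat_ext k t G x"
  unfolding heat_ext_def right_diff_distrib
  by (intro Bochner_Integration.integral_diff heat_ext_integrable[OF assms(1,2)] assms)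

lemma heat_ext_const: "t > 0 \<Longrightarrow> heat_ext k t (\<lambda>_. c) x = c"
  by (simp add: heat_ext_def kernel_conserv)

text \<open>The exponent \<open>e'\<close> only makes the integral converge for this F, while C, e
  and \<open>\<tau>\<close> come from the supplied majorant; thus the constant does not depend on
  F.\<close>

lemma norm_heat_ext_le:
  assumes "\<And>y. norm (k t x y) \<le> C * decay_wt e \<tau> (x - y)" "admissible e'" "t > 0" "F \<in> weighted_L1 e'" "C \<ge> 0"
  shows "ennreal (norm (heat_ext k t F x)) \<le> ennreal C * (\<integral>\<^sup>+y. ennreal (decay_wt e \<tau> (x - y) * norm (F y)) \<partial>lebesgue)"
proof -
  have [measurable]: "F \<in> borel_measurable lebesgue" using assms by (auto intro: weighted_L1_measurable)
  have "ennreal (norm (heat_ext k t F x)) \<le> (\<integral>\<^sup>+y. ennreal (norm (k t x y * F y)) \<partial>lebesgue)"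
    unfolding heat_ext_def by (rule integral_norm_bound_ennreal[OF heat_ext_integrable[OF assms(2-4)]])
  also have "\<dots> \<le> (\<integral>\<^sup>+y. ennreal C * ennreal (decay_wt e \<tau> (x - y) * norm (F y)) \<partial>lebesgue)"
  proof (intro nn_integral_mono)
    fix y
    have "norm (k t x y * F y) \<le> C * (decay_wt e \<tau> (x - y) * norm (F y))"
      using mult_right_mono[OF assms(1), of "norm (F y)"] by (simp add: norm_mult mult.assoc)
    then show "ennreal (norm (k t x y * F y)) \<le> ennreal C * ennreal (decay_wt e \<tau> (x - y) * norm (F y))"
      using \<open>C \<ge> 0\<close> by (simp add: ennreal_mult[symmetric] ennreal_leI)
  qed
  also have "\<dots> = ennreal C * (\<integral>\<^sup>+y. ennreal (decay_wt e \<tau> (x - y) * norm (F y)) \<partial>lebesgue)"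
    by (rule nn_integral_cmult) simp
  finally show ?thesis .
qed

lemma heat_ext_weighted_L1:
  assumes e: "admissible e" and t: "t > 0" and F: "F \<in> weighted_L1 e"
  shows "heat_ext k t F \<in> weighted_L1 e"
proof -
  obtain C where C: "C > 0" "\<And>x y. norm (k t x y) \<le> C * decay_wt e 1 (x - y)"
    using kernel_le_unit[OF e t] by blast
  have e0: "e > 0" using e by (simp add: admissible_def)
  note conv = weighted_L1_convolution[OF e0 F]
  note [measurable] = conv(1)
  have "(\<integral>\<^sup>+x. ennreal (decay_wt e 1 x * norm (heat_ext k t F x)) \<partial>lebesgue) \<le>
      (\<integral>\<^sup>+x. ennreal C * (ennreal (decay_wt e 1 x) * (\<integral>\<^sup>+y. ennreal (decay_wt e 1 (x - y) * norm (F y)) \<partial>lebesgue)) \<partial>lebesgue)"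
  proof (intro nn_integral_mono)
    fix x :: 'a
    have "ennreal (decay_wt e 1 x) * ennreal (norm (heat_ext k t F x)) \<le>
      ennreal (decay_wt e 1 x) * (ennreal C * (\<integral>\<^sup>+y. ennreal (decay_wt e 1 (x - y) * norm (F y)) \<partial>lebesgue))"
      using C by (intro mult_left_mono norm_heat_ext_le[OF _ e t F]) auto
    then show "ennreal (decay_wt e 1 x * norm (heat_ext k t F x)) \<le>
      ennreal C * (ennreal (decay_wt e 1 x) * (\<integral>\<^sup>+y. ennreal (decay_wt e 1 (x - y) * norm (F y)) \<partial>lebesgue))"
      by (simp add: ennreal_mult mult_ac)
  qed
  also have "\<dots> = ennreal C * (\<integral>\<^sup>+x. ennreal (decay_wt e 1 x) * (\<integral>\<^sup>+y. ennreal (decay_wt e 1 (x - y) * norm (F y)) \<partial>lebesgue) \<partial>lebesgue)"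
    by (rule nn_integral_cmult) simp
  also have "\<dots> < \<infinity>" using conv(2) by (simp add: ennreal_mult_less_top)
  finally show ?thesis by (simp add: weighted_L1_def heat_ext_measurable[OF e t F])
qed

section \<open>The semigroup law, from L2 to the weighted space\<close>

lemma heat_ext_semigroup_L2:
  assumes e: "admissible e" and s: "s > 0" and t: "t > 0" and F: "F \<in> weighted_L1 e" and F2: "F \<in> L2"
  shows "AE x in lebesgue. heat_ext k (s + t) F x = heat_ext k s (heat_ext k t F) x"
proof -
  have sec: "complex_of_real r \<in> open_sector \<theta>" if "r > 0" for r
    using that theta_pos by (auto simp: open_sector_def Arg_of_real)
  have bdd: "\<forall>z\<in>open_sector \<theta> \<union> {0}. L2_bounded_op (T z)"
    using analytic_semigroup unfolding generates_analytic_semigroup_def by (elim conjE)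
  have grp: "\<forall>z\<in>open_sector \<theta> \<union> {0}. \<forall>w\<in>open_sector \<theta> \<union> {0}. \<forall>f\<in>L2. ae_eq (T (z + w) f) (T z (T w f))"
    using analytic_semigroup unfolding generates_analytic_semigroup_def by (elim conjE)
  have "T (of_real t) ` L2 \<subseteq> L2"
    using bdd sec[OF t] by (simp add: L2_bounded_op_def L2_linear_op_def)
  then have TL2: "T (of_real t) F \<in> L2"
    using F2 by blast
  have rep: "AE x in lebesgue. T (of_real r) G x = heat_ext k r G x" if "r > 0" "G \<in> L2" for r G
    using kernel_bounds that by (auto simp: heat_kernel_bounds_def heat_ext_def)
  have "AE x in lebesgue. T (of_real s + of_real t) F x = T (of_real s) (T (of_real t) F) x"
    using grp sec[OF s] sec[OF t] F2 by (simp add: ae_eq_def)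
  then have "AE x in lebesgue. T (of_real (s + t)) F x = T (of_real s) (T (of_real t) F) x"
    by simp
  moreover have "AE x in lebesgue. T (of_real (s + t)) F x = heat_ext k (s + t) F x"
    using s t by (intro rep F2) simp
  moreover have "AE x in lebesgue. T (of_real s) (T (of_real t) F) x = heat_ext k s (T (of_real t) F) x"
    by (rule rep[OF s TL2])
  \<comment> \<open>The function \<open>T t F\<close> agrees with P_t F only up to a null set, which
    the outer integral does not see; hence equality at every x.\<close>
  moreover have "heat_ext k s (T (of_real t) F) x = heat_ext k s (heat_ext k t F) x" for x
    unfolding heat_ext_def[of k s]
  proof (rule integral_cong_AE)
    have [measurable]: "T (of_real t) F \<in> borel_measurable lebesgue" using TL2 by (simp add: L2_def)
    note [measurable] = kernel_measurable[OF s, of x] heat_ext_measurable[OF e t F]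
    show "(\<lambda>y. k s x y * T (complex_of_real t) F y) \<in> borel_measurable lebesgue"
      and "(\<lambda>y. k s x y * heat_ext k t F y) \<in> borel_measurable lebesgue"
      by measurable
    show "AE y in lebesgue. k s x y * T (complex_of_real t) F y = k s x y * heat_ext k t F y"
      using rep[OF t F2] by eventually_elim simp
  qed
  ultimately show ?thesis by (elim AE_mp) (auto intro!: AE_I2)
qed

text \<open>Truncations of F lie in L2, where the law holds almost everywhere. Dominated convergence
  passes to F on both sides, and continuity of both sides removes the null set.\<close>

theorem heat_ext_semigroup:
  assumes e: "admissible e" and s: "s > 0" and t: "t > 0" and F: "F \<in> weighted_L1 e"
  shows "heat_ext k (s + t) F x = heat_ext k s (heat_ext k t F) x"
proof (rule continuous_AE_lebesgue_eq[where f = "heat_ext k (s + t) F" and h = "heat_ext k s (heat_ext k t F)"])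
  note PF = heat_ext_weighted_L1[OF e t F]
  show "continuous_on UNIV (heat_ext k (s + t) F)"
    using s t by (intro heat_ext_cont[OF e _ F]) simp
  show "continuous_on UNIV (heat_ext k s (heat_ext k t F))"
    by (rule heat_ext_cont[OF e s PF])
  have e0: "e > 0" using e by (simp add: admissible_def)
  have [measurable]: "F \<in> borel_measurable lebesgue" by (rule weighted_L1_measurable[OF F])
  \<comment> \<open>Cutting off both the argument and the value makes \<open>Fj j\<close> bounded
    with bounded support, hence square integrable, while |F| remains a majorant.\<close>
  define Fj where "Fj j y = (if norm y \<le> real j \<and> norm (F y) \<le> real j then F y else 0)" for j y
  have Fj_meas [measurable]: "Fj j \<in> borel_measurable lebesgue" for j
    unfolding Fj_def by measurable
  have Fj_le: "norm (Fj j y) \<le> norm (F y)" for j y by (simp add: Fj_def)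
  have Fj_wL1: "Fj j \<in> weighted_L1 e" for j
    by (rule weighted_L1_mono[OF F Fj_meas Fj_le])
  have Fj_L2: "Fj j \<in> L2" for j
  proof -
    have "integrable lebesgue (\<lambda>y. (norm (Fj j y))\<^sup>2)"
    proof (rule Bochner_Integration.integrable_bound)
      show "integrable lebesgue (\<lambda>y. (real j)\<^sup>2 * indicator (cball (0::'a) (real j)) y)"
        by (intro integrable_mult_right integrable_real_indicator) (auto simp: emeasure_cball)
      show "AE y in lebesgue. norm ((norm (Fj j y))\<^sup>2) \<le> norm ((real j)\<^sup>2 * indicator (cball (0::'a) (real j)) y)"
        by (intro AE_I2) (auto simp: Fj_def indicator_def intro!: power_mono)
    qed measurable
    then show ?thesis by (simp add: L2_def)
  qed
  have Fj_lim: "(\<lambda>j. Fj j y) \<longlonglongrightarrow> F y" for y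
  proof (rule tendsto_eventually)
    obtain J :: nat where "real J \<ge> max (norm y) (norm (F y))" using real_arch_simple by blast
    then show "\<forall>\<^sub>F j in sequentially. Fj j y = F y"
      by (intro eventually_sequentiallyI[of J]) (auto simp: Fj_def)
  qed
  have lim1: "(\<lambda>j. heat_ext k r (Fj j) z) \<longlonglongrightarrow> heat_ext k r F z" if r: "r > 0" for r z
    unfolding heat_ext_def
  proof (rule integral_dominated_convergence)
    note [measurable] = kernel_measurable[OF r, of z]
    show "(\<lambda>y. k r z y * F y) \<in> borel_measurable lebesgue" "\<And>j. (\<lambda>y. k r z y * Fj j y) \<in> borel_measurable lebesgue"
      by measurable
    show "integrable lebesgue (\<lambda>y. norm (k r z y * F y))"
      by (intro integrable_norm heat_ext_integrable[OF e r F])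
    show "AE y in lebesgue. norm (k r z y * Fj j y) \<le> norm (k r z y * F y)" for j
      using Fj_le by (auto simp: norm_mult intro!: mult_left_mono)
    show "AE y in lebesgue. (\<lambda>j. k r z y * Fj j y) \<longlonglongrightarrow> k r z y * F y"
      by (intro AE_I2 tendsto_intros Fj_lim)
  qed
  \<comment> \<open>Up to the constant C below, G dominates P_t applied to every truncation, and it
    is integrable against the weight by \<open>weighted_L1_convolution\<close>.\<close>
  define G where "G z = (\<integral>\<^sup>+y. ennreal (decay_wt e 1 (z - y) * norm (F y)) \<partial>lebesgue)" for z
  note conv = weighted_L1_convolution[OF e0 F, folded G_def]
  have [measurable]: "G \<in> borel_measurable lebesgue" unfolding G_def by (rule conv(1)[unfolded G_def])
  \<comment> \<open>Finiteness at every point matters because \<open>enn2real\<close> would send an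
    infinite value to 0 and destroy the majorant.\<close>
  have G_fin: "G z < \<infinity>" for z
  proof -
    have "G z \<le> (\<integral>\<^sup>+y. ennreal ((1 + norm z) powr (real DIM('a) + e)) * ennreal (decay_wt e 1 y * norm (F y)) \<partial>lebesgue)"
      unfolding G_def
    proof (intro nn_integral_mono)
      fix y
      have "decay_wt e 1 (z - y) \<le> (1 + norm z) powr (real DIM('a) + e) * decay_wt e 1 (- y)"
        using decay_wt_le_shift[of 1 e "norm z" "z - y" "- y"] e0 by simp
      from mult_right_mono[OF this, of "norm (F y)"]
      show "ennreal (decay_wt e 1 (z - y) * norm (F y)) \<le>
        ennreal ((1 + norm z) powr (real DIM('a) + e)) * ennreal (decay_wt e 1 y * norm (F y))"
        by (simp add: ennreal_mult[symmetric] ennreal_leI mult.assoc)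
    qed
    also have "\<dots> = ennreal ((1 + norm z) powr (real DIM('a) + e)) * (\<integral>\<^sup>+y. ennreal (decay_wt e 1 y * norm (F y)) \<partial>lebesgue)"
      by (rule nn_integral_cmult) simp
    also have "\<dots> < \<infinity>" using F by (simp add: weighted_L1_def ennreal_mult_less_top)
    finally show ?thesis .
  qed
  obtain C where C: "C > 0" "\<And>x y. norm (k t x y) \<le> C * decay_wt e 1 (x - y)"
    using kernel_le_unit[OF e t] by blast
  have dom: "norm (heat_ext k t (Fj j) z) \<le> C * enn2real (G z)" for j z
  proof -
    have "ennreal (norm (heat_ext k t (Fj j) z)) \<le> ennreal C * (\<integral>\<^sup>+y. ennreal (decay_wt e 1 (z - y) * norm (Fj j y)) \<partial>lebesgue)"
      using C by (intro norm_heat_ext_le[OF _ e t Fj_wL1]) auto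
    also have "\<dots> \<le> ennreal C * G z"
      unfolding G_def using Fj_le by (intro mult_left_mono nn_integral_mono ennreal_leI) auto
    also have "\<dots> = ennreal (C * enn2real (G z))"
      using C(1) G_fin[of z] by (simp add: ennreal_mult)
    finally show ?thesis using C(1) by (simp add: ennreal_le_iff)
  qed
  have lim2: "(\<lambda>j. heat_ext k s (heat_ext k t (Fj j)) x) \<longlonglongrightarrow> heat_ext k s (heat_ext k t F) x" for x
  proof -
    obtain K where K: "K > 0" "\<And>y. norm (k s x y) \<le> K * decay_wt e 1 y"
      using kernel_le_locally[OF e s, of "norm x"] by auto
    show ?thesis
      unfolding heat_ext_def[of k s]
    proof (rule integral_dominated_convergence)
      note [measurable] = kernel_measurable[OF s, of x] heat_ext_measurable[OF e t F] heat_ext_measurable[OF e t Fj_wL1]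
      show "(\<lambda>y. k s x y * heat_ext k t F y) \<in> borel_measurable lebesgue"
        "\<And>j. (\<lambda>y. k s x y * heat_ext k t (Fj j) y) \<in> borel_measurable lebesgue" by measurable
      show "integrable lebesgue (\<lambda>y. K * C * (decay_wt e 1 y * enn2real (G y)))"
      proof (intro integrable_mult_right integrableI_bounded)
        have "(\<integral>\<^sup>+y. ennreal (norm (decay_wt e 1 y * enn2real (G y))) \<partial>lebesgue) = (\<integral>\<^sup>+y. ennreal (decay_wt e 1 y) * G y \<partial>lebesgue)"
          using G_fin by (intro nn_integral_cong) (simp add: abs_mult ennreal_mult)
        then show "(\<integral>\<^sup>+y. ennreal (norm (decay_wt e 1 y * enn2real (G y))) \<partial>lebesgue) < \<infinity>"
          using conv(2) by simp
      qed measurable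
      show "AE y in lebesgue. norm (k s x y * heat_ext k t (Fj j) y) \<le> K * C * (decay_wt e 1 y * enn2real (G y))" for j
      proof (intro AE_I2)
        fix y
        have "norm (k s x y) * norm (heat_ext k t (Fj j) y) \<le> (K * decay_wt e 1 y) * (C * enn2real (G y))"
          using K(1) by (intro mult_mono K dom) auto
        then show "norm (k s x y * heat_ext k t (Fj j) y) \<le> K * C * (decay_wt e 1 y * enn2real (G y))"
          by (simp add: norm_mult mult_ac)
      qed
      show "AE y in lebesgue. (\<lambda>j. k s x y * heat_ext k t (Fj j) y) \<longlonglongrightarrow> k s x y * heat_ext k t F y"
        by (intro AE_I2 tendsto_intros lim1 t)
    qed
  qed
  have "AE x in lebesgue. \<forall>j. heat_ext k (s + t) (Fj j) x = heat_ext k s (heat_ext k t (Fj j)) x"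
    unfolding AE_all_countable by (intro allI heat_ext_semigroup_L2[OF e s t Fj_wL1 Fj_L2])
  then show "AE x in lebesgue. heat_ext k (s + t) F x = heat_ext k s (heat_ext k t F) x"
  proof eventually_elim
    case (elim x)
    have "(\<lambda>j. heat_ext k (s + t) (Fj j) x) \<longlonglongrightarrow> heat_ext k s (heat_ext k t F) x"
      using lim2[of x] elim by simp
    moreover have "(\<lambda>j. heat_ext k (s + t) (Fj j) x) \<longlonglongrightarrow> heat_ext k (s + t) F x"
      using s t by (intro lim1) simp
    ultimately show ?case by (rule LIMSEQ_unique[rotated])
  qed
qed

text \<open>At radii up to \<open>2 powr (1 / m)\<close> times the heat scale the shift factor
  \<open>(1 + r / \<tau>) powr ?N\<close> stays bounded. The factor \<open>2 powr (1 / m)\<close>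
  admits \<open>r = s powr (1 / m)\<close> for all \<open>s \<le> 2 * t\<close>, as the comparison
  of different times requires.\<close>

lemma norm_heat_ext_le_ball_averages:
  assumes e: "admissible e"
  obtains C where "C > 0" "\<And>t r e' F S x. t > 0 \<Longrightarrow> r > 0 \<Longrightarrow> r \<le> 2 powr (1 / m) * t powr (1 / m) \<Longrightarrow>
      admissible e' \<Longrightarrow> F \<in> weighted_L1 e' \<Longrightarrow> S \<ge> 0 \<Longrightarrow>
      (\<And>z. (\<integral>\<^sup>+y\<in>ball z r. ennreal (norm (F y)) \<partial>lebesgue) \<le> ennreal S * emeasure lebesgue (ball z r)) \<Longrightarrow>
      norm (heat_ext k t F x) \<le> C * S"
proof -
  let ?N = "real DIM('a) + e"
  have e0: "e > 0" using e by (simp add: admissible_def)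
  obtain C1 where C1: "C1 > 0" "\<And>t x y. t > 0 \<Longrightarrow> norm (k t x y) \<le> C1 * decay_wt e (t powr (1 / m)) (x - y)"
    using kernel_le_decay_wt[OF e] by blast
  obtain C2 where C2: "C2 > 0" "\<And>\<tau> x::'a. \<tau> > 0 \<Longrightarrow> (\<integral>\<^sup>+y. ennreal (decay_wt e \<tau> (x - y)) \<partial>lebesgue) \<le> ennreal C2"
    using nn_integral_decay_wt[OF e0, where 'a='a] by blast
  define B where "B = (1 + 2 powr (1 / m)) powr ?N"
  have B: "B > 0"
    unfolding B_def by (smt (verit) powr_gt_zero)
  have "norm (heat_ext k t F x) \<le> C1 * B * C2 * S"
    if t: "t > 0" and r: "r > 0" "r \<le> 2 powr (1 / m) * t powr (1 / m)" and e': "admissible e'"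
      and F: "F \<in> weighted_L1 e'" and S: "S \<ge> 0"
      and avg: "\<And>z. (\<integral>\<^sup>+y\<in>ball z r. ennreal (norm (F y)) \<partial>lebesgue) \<le> ennreal S * emeasure lebesgue (ball z r)"
    for t r e' F S x
  proof -
    define \<tau> where "\<tau> = t powr (1 / m)"
    have \<tau>: "\<tau> > 0" using t by (simp add: \<tau>_def)
    have [measurable]: "F \<in> borel_measurable lebesgue" by (rule weighted_L1_measurable[OF F])
    have "(1 + r / \<tau>) powr ?N \<le> B"
      unfolding B_def using r \<tau> e0 by (intro powr_mono2) (auto simp: \<tau>_def field_simps)
    then have rB: "ennreal ((1 + r / \<tau>) powr ?N) \<le> ennreal B" by (rule ennreal_leI)
    have "ennreal (norm (heat_ext k t F x)) \<le> ennreal C1 * (\<integral>\<^sup>+y. ennreal (decay_wt e \<tau> (x - y) * norm (F y)) \<partial>lebesgue)"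
      unfolding \<tau>_def using C1 t by (intro norm_heat_ext_le[OF _ e' t F]) auto
    also have "(\<integral>\<^sup>+y. ennreal (decay_wt e \<tau> (x - y) * norm (F y)) \<partial>lebesgue) =
        (\<integral>\<^sup>+y. ennreal (decay_wt e \<tau> (x - y)) * ennreal (norm (F y)) \<partial>lebesgue)"
      by (simp add: ennreal_mult)
    also have "\<dots> \<le> ennreal ((1 + r / \<tau>) powr ?N) * ennreal S * (\<integral>\<^sup>+y. ennreal (decay_wt e \<tau> (x - y)) \<partial>lebesgue)"
      using e0 \<tau> r avg by (intro nn_integral_decay_wt_mult_le) auto
    also have "\<dots> \<le> ennreal B * ennreal S * ennreal C2"
      by (intro mult_mono rB C2 \<tau>) auto
    finally have "ennreal (norm (heat_ext k t F x)) \<le> ennreal C1 * (ennreal B * ennreal S * ennreal C2)"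
      by (simp add: mult_left_mono)
    also have "\<dots> = ennreal (C1 * B * C2 * S)"
      using C1(1) C2(1) B S by (simp add: ennreal_mult[symmetric] mult_ac)
    finally show ?thesis using C1(1) C2(1) B S by (simp add: ennreal_le_iff)
  qed
  moreover have "C1 * B * C2 > 0" using C1(1) C2(1) B by simp
  ultimately show thesis by (rule that[rotated])
qed

subsection \<open>Large-time behaviour\<close>

lemma powr_neg_morrey_exp:
  assumes "t > 0"
  shows "(t powr (1 / m)) powr (- morrey_exp TYPE('a) p lam) = t powr (- (morrey_exp TYPE('a) p lam / m))"
  by (simp add: powr_powr)

text \<open>At the heat scale \<open>r = t powr (1 / m)\<close> the averages of |F| are of order
  \<open>S * r powr (- mu)\<close>, and P_t F inherits this size.\<close>

lemma heat_ext_morrey_decay: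
  assumes e: "admissible e" and p: "p \<ge> 1"
  obtains C where "C > 0" "\<And>e' F S t x. admissible e' \<Longrightarrow> F \<in> weighted_L1 e' \<Longrightarrow> S \<ge> 0 \<Longrightarrow> t > 0 \<Longrightarrow>
    morrey_bound p lam (\<lambda>_ _ _. 0) F S \<Longrightarrow>
    norm (heat_ext k t F x) \<le> C * S * t powr (- (morrey_exp TYPE('a) p lam / m))"
proof -
  let ?mu = "morrey_exp TYPE('a) p lam"
  let ?\<kappa> = "ball_vol TYPE('a) powr (- 1 / p)"
  obtain C where C: "C > 0" "\<And>t r e' F S x. t > 0 \<Longrightarrow> r > 0 \<Longrightarrow> r \<le> 2 powr (1 / m) * t powr (1 / m) \<Longrightarrow>
      admissible e' \<Longrightarrow> F \<in> weighted_L1 e' \<Longrightarrow> S \<ge> 0 \<Longrightarrow>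
      (\<And>z. (\<integral>\<^sup>+y\<in>ball z r. ennreal (norm (F y)) \<partial>lebesgue) \<le> ennreal S * emeasure lebesgue (ball z r)) \<Longrightarrow>
      norm (heat_ext k t F x) \<le> C * S"
    by (fact norm_heat_ext_le_ball_averages[OF e])
  have "norm (heat_ext k t F x) \<le> (C * (2 * ?\<kappa>)) * S * t powr (- (?mu / m))"
    if e': "admissible e'" and F: "F \<in> weighted_L1 e'" and S: "S \<ge> 0" and t: "t > 0"
      and bd: "morrey_bound p lam (\<lambda>_ _ _. 0) F S" for e' F S t x
  proof -
    let ?r = "t powr (1 / m)"
    have [measurable]: "F \<in> borel_measurable lebesgue" by (rule weighted_L1_measurable[OF F])
    have r: "?r > 0" "?r \<le> 2 powr (1 / m) * t powr (1 / m)"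
      using t m_pos ge_one_powr_ge_zero[of 2 "1 / m"] by auto
    have "norm (heat_ext k t F x) \<le> C * (2 * (?\<kappa> * S * ?r powr (- ?mu)))"
      using morrey_bound_avg[OF bd p S r(1)] S by (intro C(2)[OF t r e' F]) auto
    then show ?thesis by (simp only: powr_neg_morrey_exp[OF t] mult_ac)
  qed
  moreover have "C * (2 * ?\<kappa>) > 0" using C(1) by simp
  ultimately show thesis by (rule that[rotated])
qed

text \<open>As \<open>t\<close> tends to infinity, \<open>P\<^sub>t h\<close> converges uniformly to a fixed point of the semigroup,
  because \<open>P\<^sub>t h - P\<^bsub>t+s\<^esub> h = P\<^sub>t (h - P\<^sub>s h)\<close> decays like a negative power of \<open>t\<close> (here \<open>lam < n\<close> is used).\<close>

lemma heat_ext_limit: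
  assumes e: "admissible e" and p: "p \<ge> 1" and lam: "lam < real DIM('a)"
  obtains C where "C > 0" "\<And>e' h S. admissible e' \<Longrightarrow> h \<in> weighted_L1 e' \<Longrightarrow> S \<ge> 0 \<Longrightarrow>
    morrey_bound p lam (\<lambda>x r. heat_ext k (r powr m) h) h S \<Longrightarrow>
    \<exists>u\<in>weighted_L1 e'. (\<forall>t>0. \<forall>x. heat_ext k t u x = u x) \<and> morrey_bound p lam (\<lambda>_ _. u) h (C * S)"
proof -
  let ?mu = "morrey_exp TYPE('a) p lam"
  let ?v = "ball_vol TYPE('a)"
  let ?\<kappa> = "?v powr (- 1 / p)"
  have mu: "?mu / m > 0" using p lam m_pos by (simp add: morrey_exp_def)
  obtain C where C: "C > 0" "\<And>t r e' F S x. t > 0 \<Longrightarrow> r > 0 \<Longrightarrow> r \<le> 2 powr (1 / m) * t powr (1 / m) \<Longrightarrow>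
      admissible e' \<Longrightarrow> F \<in> weighted_L1 e' \<Longrightarrow> S \<ge> 0 \<Longrightarrow>
      (\<And>z. (\<integral>\<^sup>+y\<in>ball z r. ennreal (norm (F y)) \<partial>lebesgue) \<le> ennreal S * emeasure lebesgue (ball z r)) \<Longrightarrow>
      norm (heat_ext k t F x) \<le> C * S"
    by (fact norm_heat_ext_le_ball_averages[OF e])
  \<comment> \<open>Comparing two times takes two applications of \<open>step\<close> below, each
    with constant \<open>2 * C * ?\<kappa>\<close>.\<close>
  define A where "A = 4 * C * ?\<kappa>"
  define M where "M = A / (1 - 2 powr (- (?mu / m)))"
  have A: "A > 0" using C(1) by (simp add: A_def)
  have M: "M > 0" using A mu powr_less_mono[of "- (?mu / m)" 0 2] by (simp add: M_def)
  have "\<exists>u\<in>weighted_L1 e'. (\<forall>t>0. \<forall>x. heat_ext k t u x = u x) \<and>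
      morrey_bound p lam (\<lambda>_ _. u) h (2 * (1 + M powr p * ?v) powr (1 / p) * S)"
    if e': "admissible e'" and h: "h \<in> weighted_L1 e'" and S: "S \<ge> 0"
      and bd: "morrey_bound p lam (\<lambda>x r. heat_ext k (r powr m) h) h S" for e' h S
  proof -
    have e0': "e' > 0" using e' by (simp add: admissible_def)
    note hm [measurable] = weighted_L1_measurable[OF h]
    note P_meas = heat_ext_measurable[OF e' _ h]
    \<comment> \<open>On balls of radius \<open>s powr (1 / m)\<close> the hypothesis on h subtracts
      exactly P_s h, which controls the averages of h - P_s h there.\<close>
    have step: "norm (heat_ext k t h x - heat_ext k (t + s) h x) \<le> 2 * C * ?\<kappa> * S * s powr (- (?mu / m))"
      if t: "t > 0" and s: "s > 0" "s \<le> 2 * t" for t s x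
    proof -
      let ?r = "s powr (1 / m)"
      note Ps = heat_ext_weighted_L1[OF e' s(1) h]
      have rm: "?r powr m = s" using s m_pos by (simp add: powr_powr)
      have r: "?r > 0" using s by simp
      have "?r \<le> (2 * t) powr (1 / m)" using s m_pos by (intro powr_mono2) auto
      also have "\<dots> = 2 powr (1 / m) * t powr (1 / m)" using t by (intro powr_mult)
      finally have r2: "?r \<le> 2 powr (1 / m) * t powr (1 / m)" .
      have "heat_ext k t h x - heat_ext k (t + s) h x = heat_ext k t (\<lambda>y. h y - heat_ext k s h y) x"
        by (simp add: heat_ext_diff[OF e' t h Ps] heat_ext_semigroup[OF e' t s(1) h])
      also have "norm \<dots> \<le> C * (2 * (?\<kappa> * S * ?r powr (- ?mu)))"
        using morrey_bound_avg[OF bd p S r] P_meas[OF s(1)] S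
        by (intro C(2)[OF t r r2 e' weighted_L1_diff[OF h Ps]]) (auto simp: rm)
      finally show ?thesis by (simp only: powr_neg_morrey_exp[OF s(1)] mult_ac)
    qed
    \<comment> \<open>The comparison passes through time t + t'. Going directly from t to t' would
      involve P_s with s = t' - t, which may be tiny, and the factor
      \<open>s powr (- (mu / m))\<close> would blow up.\<close>
    have near: "norm (heat_ext k t h x - heat_ext k t' h x) \<le> A * S * t powr (- (?mu / m))"
      if t: "0 < t" "t \<le> t'" "t' \<le> 2 * t" for t t' x
    proof -
      have "norm (heat_ext k t h x - heat_ext k t' h x) \<le>
          norm (heat_ext k t h x - heat_ext k (t + t') h x) + norm (heat_ext k t' h x - heat_ext k (t' + t) h x)"
        using norm_triangle_ineq4[of "heat_ext k t h x - heat_ext k (t + t') h x" "heat_ext k t' h x - heat_ext k (t' + t) h x"]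
        by (simp add: add.commute)
      also have "\<dots> \<le> 2 * C * ?\<kappa> * S * t' powr (- (?mu / m)) + 2 * C * ?\<kappa> * S * t powr (- (?mu / m))"
        using t by (intro add_mono step) auto
      also have "\<dots> \<le> A * S * t powr (- (?mu / m))"
      proof -
        have "t' powr (- (?mu / m)) \<le> t powr (- (?mu / m))"
          using t mu by (intro powr_mono2') auto
        then have "2 * C * ?\<kappa> * S * t' powr (- (?mu / m)) \<le> 2 * C * ?\<kappa> * S * t powr (- (?mu / m))"
          using C(1) S by (intro mult_left_mono) auto
        moreover have "A * S * t powr (- (?mu / m)) = 2 * (2 * C * ?\<kappa> * S * t powr (- (?mu / m)))"
          by (simp add: A_def)
        ultimately show ?thesis by linarith
      qed
      finally show ?thesis .
    qed
    have "\<exists>l. ((\<lambda>t. heat_ext k t h x) \<longlongrightarrow> l) at_top \<and>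
        (\<forall>t>0. norm (heat_ext k t h x - l) \<le> A * S / (1 - 2 powr (- (?mu / m))) * t powr (- (?mu / m)))" for x
      using mu A S by (intro dyadic_chain near) auto
    then obtain u where u: "\<And>x. ((\<lambda>t. heat_ext k t h x) \<longlongrightarrow> u x) at_top"
      "\<And>x t. t > 0 \<Longrightarrow> norm (heat_ext k t h x - u x) \<le> M * S * t powr (- (?mu / m))"
      unfolding M_def by (metis times_divide_eq_left)
    \<comment> \<open>The index \<open>Suc j\<close> avoids time 0, at which nothing is known about
      the kernel.\<close>
    have seq: "(\<lambda>j. heat_ext k (real (Suc j)) h x) \<longlonglongrightarrow> u x" for x
      using filterlim_compose[OF u(1)[of x] filterlim_compose[OF filterlim_real_sequentially filterlim_Suc]] .
    have um [measurable]: "u \<in> borel_measurable lebesgue"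
    proof (rule borel_measurable_LIMSEQ_metric)
      show "(\<lambda>j. heat_ext k (real (Suc j)) h x) \<longlonglongrightarrow> u x" for x by (rule seq)
      show "heat_ext k (real (Suc j)) h \<in> borel_measurable lebesgue" for j by (rule P_meas) simp
    qed
    note P1 = heat_ext_weighted_L1[OF e' zero_less_one h]
    \<comment> \<open>The uniform estimate makes this difference bounded, hence weighted integrable;
      at t = 1 it gives membership of u.\<close>
    have diff_wL1: "(\<lambda>x. heat_ext k t h x - u x) \<in> weighted_L1 e'" if t: "t > 0" for t
      by (rule bounded_in_weighted_L1[OF e0' _ u(2)[OF t]]) (use P_meas[OF t] in measurable)
    have u1: "u \<in> weighted_L1 e'"
      using weighted_L1_diff[OF P1 diff_wL1[OF zero_less_one]] by simp
    have fixp: "heat_ext k t u x = u x" if t: "t > 0" for t x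
    proof -
      \<comment> \<open>A uniform bound on P_s h - u bounds all its ball averages and so survives
        P_t. As s grows, P_(t+s) h thus tends to P_t u, but it also tends to u.\<close>
      have close: "norm (heat_ext k (t + s) h x - heat_ext k t u x) \<le> C * (M * S * s powr (- (?mu / m)))" if s: "s > 0" for s
      proof -
        note Ps = heat_ext_weighted_L1[OF e' s h]
        have r: "t powr (1 / m) > 0" "t powr (1 / m) \<le> 2 powr (1 / m) * t powr (1 / m)"
          using t m_pos ge_one_powr_ge_zero[of 2 "1 / m"] by auto
        have "heat_ext k (t + s) h x - heat_ext k t u x = heat_ext k t (\<lambda>y. heat_ext k s h y - u y) x"
          by (simp add: heat_ext_diff[OF e' t Ps u1] heat_ext_semigroup[OF e' t s h])
        also have "norm \<dots> \<le> C * (M * S * s powr (- (?mu / m)))"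
        proof (rule C(2)[OF t r e' diff_wL1[OF s]])
          fix z
          have "(\<integral>\<^sup>+y\<in>ball z (t powr (1 / m)). ennreal (norm (heat_ext k s h y - u y)) \<partial>lebesgue) \<le>
              (\<integral>\<^sup>+y. ennreal (M * S * s powr (- (?mu / m))) * indicator (ball z (t powr (1 / m))) y \<partial>lebesgue)"
            using u(2)[OF s] by (intro nn_integral_mono mult_right_mono ennreal_leI) auto
          then show "(\<integral>\<^sup>+y\<in>ball z (t powr (1 / m)). ennreal (norm (heat_ext k s h y - u y)) \<partial>lebesgue) \<le>
              ennreal (M * S * s powr (- (?mu / m))) * emeasure lebesgue (ball z (t powr (1 / m)))"
            by (simp add: nn_integral_cmult_indicator)
        qed (use M S in auto)
        finally show ?thesis .
      qed
      have "((\<lambda>s. heat_ext k (t + s) h x - heat_ext k t u x) \<longlongrightarrow> 0) at_top"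
      proof (rule Lim_null_comparison)
        show "((\<lambda>s. C * (M * S * s powr (- (?mu / m)))) \<longlongrightarrow> 0) at_top"
          using mu by (intro tendsto_mult_right_zero tendsto_neg_powr filterlim_ident) auto
        show "\<forall>\<^sub>F s in at_top. norm (heat_ext k (t + s) h x - heat_ext k t u x) \<le> C * (M * S * s powr (- (?mu / m)))"
          using close by (auto intro: eventually_at_top_linorderI[of 1])
      qed
      then have "((\<lambda>s. heat_ext k (t + s) h x) \<longlongrightarrow> heat_ext k t u x) at_top"
        by (rule LIM_zero_cancel)
      moreover have "((\<lambda>s. heat_ext k (t + s) h x) \<longlongrightarrow> u x) at_top"
        by (rule filterlim_compose[OF u(1) filterlim_tendsto_add_at_top[OF tendsto_const filterlim_ident]])
      ultimately show ?thesis by (rule tendsto_unique[rotated]) simp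
    qed
    have "morrey_bound p lam (\<lambda>_ _. u) h (2 * (1 + M powr p * ?v) powr (1 / p) * S)"
    proof (rule morrey_bound_perturb[OF bd p S])
      show "heat_ext k (r powr m) h \<in> borel_measurable lebesgue" if "r > 0" for r
        using that by (intro P_meas) simp
      \<comment> \<open>At time \<open>r powr m\<close> the rate \<open>- mu / m\<close> in time
        becomes the rate \<open>- mu\<close> in r that \<open>morrey_bound_perturb\<close>
        expects.\<close>
      show "norm (heat_ext k (r powr m) h y - u y) \<le> M * S * r powr (- ?mu)" if "r > 0" for r y
        using u(2)[of "r powr m" y] that m_pos by (simp add: powr_powr)
    qed (use M in auto)
    with u1 fixp show ?thesis by blast
  qed
  moreover have "1 + M powr p * ?v > 0"
    by (rule add_pos_nonneg) auto
  then have "2 * (1 + M powr p * ?v) powr (1 / p) > 0"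
    by simp
  ultimately show thesis by (rule that[rotated])
qed

subsection \<open>Functions of polynomial growth under the semigroup\<close>

lemma Theta_eq: "Theta (real DIM('a)) g = (SUP e\<in>{e. admissible e}. ereal e)"
  by (simp add: Theta_def admissible_def)

lemma admissible_exists: "\<exists>e. admissible e"
  using kernel_bounds by (auto simp: heat_kernel_bounds_def heat_kernel_profile_def admissible_def)

lemma Theta_pos: "0 < Theta (real DIM('a)) g"
  using admissible_exists unfolding Theta_eq less_SUP_iff by (auto simp: admissible_def)

text \<open>If \<open>Theta\<close> is finite, b is \<open>Theta\<close>, and \<open>p > 1\<close>
  leaves room for an admissible e between \<open>Theta / p\<close> and \<open>Theta\<close>. If it
  is infinite, b is the larger of the two given exponents and admissible e are unbounded. The
  relation \<open>b / p < e\<close> is what places both functions in one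
  \<open>weighted_L1 e\<close>.\<close>

lemma M_class_pair:
  fixes f h :: "'a \<Rightarrow> complex"
  assumes p: "p > 1" and f: "f \<in> M_class p g" and h: "h \<in> M_class p g"
  obtains b e where "b > 0" "b / p < e" "admissible e" "f \<in> M_weighted p b" "h \<in> M_weighted p b"
    "M_weighted p b \<subseteq> (M_class p g :: ('a \<Rightarrow> complex) set)"
proof (cases "Theta (real DIM('a)) g < \<infinity>")
  case True
  let ?b = "real_of_ereal (Theta (real DIM('a)) g)"
  have Th: "Theta (real DIM('a)) g = ereal ?b"
    using True Theta_pos by (cases "Theta (real DIM('a)) g") auto
  have b: "?b > 0" using Theta_pos Th by (metis ereal_less(2))
  have "ereal (?b / p) < Theta (real DIM('a)) g"
  proof -
    have "?b / p < ?b" using p b by (simp add: field_simps)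
    then have "ereal (?b / p) < ereal ?b" by simp
    then show ?thesis using Th by argo
  qed
  then obtain e where e: "admissible e" "?b / p < e"
    unfolding Theta_eq less_SUP_iff by auto
  have M: "(M_class p g :: ('a \<Rightarrow> complex) set) = M_weighted p ?b"
    using True by (simp add: M_class_def Let_def)
  show thesis
    by (rule that[OF b e(2,1) f[unfolded M] h[unfolded M]]) (simp only: M order_refl)
next
  case False
  then have M: "(M_class p g :: ('a \<Rightarrow> complex) set) = (\<Union>b\<in>{0<..}. M_weighted p b)"
    by (simp add: M_class_def Let_def)
  obtain b1 b2 where b: "b1 > 0" "b2 > 0" "f \<in> M_weighted p b1" "h \<in> M_weighted p b2"
    using f h unfolding M by blast
  let ?b = "max b1 b2"
  have "ereal (?b / p) < Theta (real DIM('a)) g"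
  proof -
    have "Theta (real DIM('a)) g = \<infinity>" using False by simp
    then show ?thesis by simp
  qed
  then obtain e where e: "admissible e" "?b / p < e"
    unfolding Theta_eq less_SUP_iff by auto
  have fh: "f \<in> M_weighted p ?b" "h \<in> M_weighted p ?b"
    using b M_weighted_mono[of b1 ?b p] M_weighted_mono[of b2 ?b p] by auto
  have b0: "?b > 0" using b by simp
  have "M_weighted p ?b \<subseteq> (M_class p g :: ('a \<Rightarrow> complex) set)"
    unfolding M by (rule UN_upper) (use b0 in simp)
  then show thesis by (rule that[OF b0 e(2,1) fh])
qed

lemma M_class_pair_weighted_L1:
  fixes f h :: "'a \<Rightarrow> complex"
  assumes "p > 1" "f \<in> M_class p g" "h \<in> M_class p g"
  obtains e where "admissible e" "f \<in> weighted_L1 e" "h \<in> weighted_L1 e"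
proof (rule M_class_pair[OF assms])
  fix b e assume *: "b > 0" "b / p < e" "admissible e" "f \<in> M_weighted p b" "h \<in> M_weighted p b"
  then show thesis
    using that[of e] M_weighted_subset_weighted_L1[OF assms(1) *(1,2)] by blast
qed

lemma M_class_diff:
  fixes f h :: "'a \<Rightarrow> complex"
  assumes "p > 1" "f \<in> M_class p g" "h \<in> M_class p g"
  shows "(\<lambda>x. f x - h x) \<in> M_class p g"
proof -
  obtain b where "f \<in> M_weighted p b" "h \<in> M_weighted p b" "M_weighted p b \<subseteq> (M_class p g :: ('a \<Rightarrow> complex) set)"
    by (rule M_class_pair[OF assms])
  then show ?thesis using M_weighted_diff[of f p b h] assms(1) by auto
qed

lemma M_weighted_subset_M_class:
  obtains b where "b > 0" "M_weighted p b \<subseteq> (M_class p g :: ('a \<Rightarrow> complex) set)"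
proof (cases "Theta (real DIM('a)) g < \<infinity>")
  case True
  have "real_of_ereal (Theta (real DIM('a)) g) > 0"
    using True Theta_pos by (cases "Theta (real DIM('a)) g") auto
  then show thesis using True that[of "real_of_ereal (Theta (real DIM('a)) g)"] by (simp add: M_class_def Let_def)
next
  case False
  then have "(M_class p g :: ('a \<Rightarrow> complex) set) = (\<Union>b\<in>{0<..}. M_weighted p b)"
    by (simp add: M_class_def Let_def)
  moreover have "M_weighted p 1 \<subseteq> (\<Union>b\<in>{0<..}. M_weighted p b)"
    by (rule UN_upper) simp
  ultimately show thesis using that[of 1] by simp
qed

lemma M_class_const: "(\<lambda>_::'a. c) \<in> M_class p g"
  using M_weighted_subset_M_class[of p] M_weighted_const by blast

lemma morrey_bound_imp_M_class:
  assumes "F \<in> borel_measurable lebesgue" "morrey_bound p lam (\<lambda>(_::'a) _ _. 0) F S"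
  shows "F \<in> M_class p g"
  using M_weighted_subset_M_class[of p] morrey_bound_imp_M_weighted[OF assms] by blast

lemma M_class_measurable: "f \<in> (M_class p g :: ('a \<Rightarrow> complex) set) \<Longrightarrow> f \<in> borel_measurable lebesgue"
  by (auto simp: M_class_def M_weighted_def Let_def intro: Lp_loc_measurable split: if_splits)

lemma M_class_Lp_loc: "f \<in> (M_class p g :: ('a \<Rightarrow> complex) set) \<Longrightarrow> f \<in> Lp_loc p"
  by (auto simp: M_class_def M_weighted_def Let_def split: if_splits)

section \<open>Fixed points of the semigroup and Morrey bounds\<close>

lemma kernelL_M_class: "f \<in> kernelL g k p \<Longrightarrow> f \<in> M_class p g"
  by (simp add: kernelL_def)

lemma kernelL_diff:
  assumes p: "p > 1" and f: "f \<in> kernelL g k p" and h: "h \<in> kernelL g k p"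
  shows "(\<lambda>x::'a. f x - h x) \<in> kernelL g k p"
proof -
  obtain e where e: "admissible e" "f \<in> weighted_L1 e" "h \<in> weighted_L1 e"
    by (rule M_class_pair_weighted_L1[OF p kernelL_M_class[OF f] kernelL_M_class[OF h]])
  have "AE x in lebesgue. heat_ext k t (\<lambda>x. f x - h x) x = f x - h x" if t: "t > 0" for t
  proof -
    have "AE x in lebesgue. heat_ext k t f x = f x" "AE x in lebesgue. heat_ext k t h x = h x"
      using f h t by (auto simp: kernelL_def ae_eq_def)
    then show ?thesis by eventually_elim (simp add: heat_ext_diff[OF e(1) t e(2,3)])
  qed
  then show ?thesis
    using M_class_diff[OF p kernelL_M_class[OF f] kernelL_M_class[OF h]] by (simp add: kernelL_def ae_eq_def)
qed

lemma kernelL_const: "(\<lambda>_::'a. c) \<in> kernelL g k p"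
  by (auto simp: kernelL_def ae_eq_def M_class_const heat_ext_const)

lemma const_fns_imp_kernelL:
  assumes f: "f \<in> (M_class p g :: ('a \<Rightarrow> complex) set)" and "f \<in> const_fns"
  shows "f \<in> kernelL g k p"
proof -
  have [measurable]: "f \<in> borel_measurable lebesgue" by (rule M_class_measurable[OF f])
  obtain c where c: "AE x in lebesgue. f x = c" using assms by (auto simp: const_fns_def ae_eq_def)
  have "heat_ext k t f x = c" if t: "t > 0" for t x
  proof -
    note [measurable] = kernel_measurable[OF t, of x]
    have "heat_ext k t f x = heat_ext k t (\<lambda>_. c) x"
      unfolding heat_ext_def
    proof (rule integral_cong_AE)
      show "(\<lambda>y. k t x y * f y) \<in> borel_measurable lebesgue" "(\<lambda>y. k t x y * c) \<in> borel_measurable lebesgue"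
        by measurable
      show "AE y in lebesgue. k t x y * f y = k t x y * c"
        using c by eventually_elim simp
    qed
    then show ?thesis using heat_ext_const[OF t] by simp
  qed
  then show ?thesis using f c by (auto simp: kernelL_def ae_eq_def elim: eventually_mono)
qed

text \<open>Both sides involve only the operators I - P_t, which annihilate f - h almost
  everywhere.\<close>

lemma morreyL_bound_mod_kernelL:
  assumes p: "p > 1" and f: "f \<in> M_class p g" and h: "h \<in> M_class p g"
    and K: "(\<lambda>x::'a. f x - h x) \<in> kernelL g k p"
  shows "morrey_bound p lam (\<lambda>x r. heat_ext k (r powr m) f) f S \<longleftrightarrow>
    morrey_bound p lam (\<lambda>x r. heat_ext k (r powr m) h) h S"
proof (rule morrey_bound_cong_AE)
  fix x :: 'a and r :: real assume "r > 0"
  then have t: "r powr m > 0" by simp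
  obtain e where e: "admissible e" "f \<in> weighted_L1 e" "h \<in> weighted_L1 e"
    by (rule M_class_pair_weighted_L1[OF p f h])
  have "AE y in lebesgue. heat_ext k (r powr m) (\<lambda>x. f x - h x) y = f y - h y"
    using K t by (auto simp: kernelL_def ae_eq_def)
  then show "AE y in lebesgue. f y - heat_ext k (r powr m) f y = h y - heat_ext k (r powr m) h y"
    by eventually_elim (simp add: heat_ext_diff[OF e(1) t e(2,3)] algebra_simps)
qed

lemma morrey_bound_shift:
  "morrey_bound p lam (\<lambda>_ _ _. l) f S \<longleftrightarrow> morrey_bound p lam (\<lambda>_ _ _. 0) (\<lambda>x. f x - l) S"
  by (simp add: morrey_bound_def)

lemma morrey_bound_const_M_class:
  assumes p: "p > 1" and f: "f \<in> borel_measurable lebesgue" and bd: "morrey_bound p lam (\<lambda>(_::'a) _ _. l) f S"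
  shows "f \<in> M_class p g" and "(\<lambda>x. f x - l) \<in> M_class p g"
proof -
  show 1: "(\<lambda>x. f x - l) \<in> M_class p g"
    using f bd by (intro morrey_bound_imp_M_class[of _ p lam S]) (auto simp: morrey_bound_shift[symmetric])
  show "f \<in> M_class p g"
    using M_class_diff[OF p 1 M_class_const[of "- l"]] by simp
qed

text \<open>P_t preserves l while P_t (f - l) decays, so the heat flow recovers the constant from
  f.\<close>

lemma heat_ext_tendsto_const:
  assumes p: "p > 1" and lam: "lam < real DIM('a)" and f: "f \<in> borel_measurable lebesgue"
    and bd: "morrey_bound p lam (\<lambda>(_::'a) _ _. l) f S" and S: "S \<ge> 0"
  shows "((\<lambda>t. heat_ext k t f x) \<longlongrightarrow> l) at_top"
proof -
  have mu: "morrey_exp TYPE('a) p lam / m > 0" using p lam m_pos by (simp add: morrey_exp_def)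
  note M = morrey_bound_const_M_class[OF p f bd]
  obtain e where e: "admissible e" "f \<in> weighted_L1 e" "(\<lambda>x. f x - l) \<in> weighted_L1 e"
    by (rule M_class_pair_weighted_L1[OF p M])
  have c: "(\<lambda>_. l) \<in> weighted_L1 e"
    using e(1) by (intro bounded_in_weighted_L1[where b = "norm l"]) (auto simp: admissible_def)
  have p1: "p \<ge> 1" using p by simp
  obtain C where C: "\<And>e' F S t x. admissible e' \<Longrightarrow> F \<in> weighted_L1 e' \<Longrightarrow> S \<ge> 0 \<Longrightarrow> t > 0 \<Longrightarrow>
    morrey_bound p lam (\<lambda>_ _ _. 0) F S \<Longrightarrow>
    norm (heat_ext k t F x) \<le> C * S * t powr (- (morrey_exp TYPE('a) p lam / m))"
    by (rule heat_ext_morrey_decay[OF e(1) p1, of lam]) (rule that)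
  have "((\<lambda>t. heat_ext k t f x - l) \<longlongrightarrow> 0) at_top"
  proof (rule Lim_null_comparison)
    show "((\<lambda>t. C * S * t powr (- (morrey_exp TYPE('a) p lam / m))) \<longlongrightarrow> 0) at_top"
      using mu by (intro tendsto_mult_right_zero tendsto_neg_powr filterlim_ident) auto
    have "norm (heat_ext k t f x - l) \<le> C * S * t powr (- (morrey_exp TYPE('a) p lam / m))" if t: "t \<ge> 1" for t
    proof -
      have t0: "t > 0" using t by simp
      have "heat_ext k t f x - l = heat_ext k t (\<lambda>x. f x - l) x"
        by (simp add: heat_ext_diff[OF e(1) t0 e(2) c] heat_ext_const[OF t0])
      then show ?thesis using C[OF e(1,3) S t0] bd by (simp add: morrey_bound_shift[symmetric])
    qed
    then show "\<forall>\<^sub>F t in at_top. norm (heat_ext k t f x - l) \<le> C * S * t powr (- (morrey_exp TYPE('a) p lam / m))"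
      by (intro eventually_at_top_linorderI)
  qed
  then show ?thesis by (rule LIM_zero_cancel)
qed

text \<open>The difference f - h does not move under the flow, yet P_t f - P_t h tends to l -
  l'.\<close>

lemma kernelL_morrey_const:
  assumes p: "p > 1" and lam: "lam < real DIM('a)" and S: "S \<ge> 0" "S' \<ge> 0"
    and f: "f \<in> borel_measurable lebesgue" "morrey_bound p lam (\<lambda>_ _ _. l) f S"
    and h: "h \<in> borel_measurable lebesgue" "morrey_bound p lam (\<lambda>_ _ _. l') h S'"
    and K: "(\<lambda>x::'a. f x - h x) \<in> kernelL g k p"
  shows "AE x in lebesgue. f x - h x = l - l'"
proof -
  obtain e where e: "admissible e" "f \<in> weighted_L1 e" "h \<in> weighted_L1 e"
    by (rule M_class_pair_weighted_L1[OF p morrey_bound_const_M_class(1)[OF p f] morrey_bound_const_M_class(1)[OF p h]])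
  \<comment> \<open>The null set in the fixed-point property depends on the time, so only countably
    many times are used.\<close>
  have "AE x in lebesgue. \<forall>j. heat_ext k (real (Suc j)) (\<lambda>x. f x - h x) x = f x - h x"
    unfolding AE_all_countable using K by (auto simp: kernelL_def ae_eq_def)
  then show ?thesis
  proof eventually_elim
    case (elim x)
    have "((\<lambda>t. heat_ext k t f x - heat_ext k t h x) \<longlongrightarrow> l - l') at_top"
      by (intro tendsto_diff heat_ext_tendsto_const[OF p lam f S(1)] heat_ext_tendsto_const[OF p lam h S(2)])
    from filterlim_compose[OF this filterlim_compose[OF filterlim_real_sequentially filterlim_Suc]]
    have "(\<lambda>j. heat_ext k (real (Suc j)) f x - heat_ext k (real (Suc j)) h x) \<longlonglongrightarrow> l - l'" .
    moreover have "heat_ext k (real (Suc j)) f x - heat_ext k (real (Suc j)) h x = f x - h x" for j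
      using elim[rule_format, of j] heat_ext_diff[OF e(1) _ e(2,3), of "real (Suc j)" x] by simp
    ultimately have "(\<lambda>j::nat. f x - h x) \<longlonglongrightarrow> l - l'" by simp
    then show ?case by (simp add: tendsto_const_iff)
  qed
qed

subsection \<open>Comparison of the two spaces\<close>

text \<open>Subtracting l, which lies in the kernel, reduces to F = f - l; then P_t F itself is the
  tolerable perturbation of 0.\<close>

lemma morrey_imp_morreyL:
  assumes p: "p > 1"
  obtains C where "C > 0" "\<And>f l S. f \<in> borel_measurable lebesgue \<Longrightarrow> S \<ge> 0 \<Longrightarrow>
    morrey_bound p lam (\<lambda>_ _ _. l) f S \<Longrightarrow> morrey_bound p lam (\<lambda>x r. heat_ext k (r powr m) f) f (C * S)"
proof -
  let ?mu = "morrey_exp TYPE('a) p lam"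
  let ?v = "ball_vol TYPE('a)"
  have p1: "p \<ge> 1" using p by simp
  obtain e where e: "admissible e" using admissible_exists by blast
  obtain M where M: "M > 0" "\<And>e' F S t x. admissible e' \<Longrightarrow> F \<in> weighted_L1 e' \<Longrightarrow> S \<ge> 0 \<Longrightarrow> t > 0 \<Longrightarrow>
    morrey_bound p lam (\<lambda>_ _ _. 0) F S \<Longrightarrow>
    norm (heat_ext k t F x) \<le> M * S * t powr (- (?mu / m))"
    by (fact heat_ext_morrey_decay[OF e p1, of lam])
  have "morrey_bound p lam (\<lambda>x r. heat_ext k (r powr m) f) f (2 * (1 + M powr p * ?v) powr (1 / p) * S)"
    if f: "f \<in> borel_measurable lebesgue" and S: "S \<ge> 0" and bd: "morrey_bound p lam (\<lambda>_ _ _. l) f S"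
    for f l S
  proof -
    define F where "F = (\<lambda>x. f x - l)"
    note Mc = morrey_bound_const_M_class[OF p f bd, folded F_def]
    obtain e' where e': "admissible e'" "F \<in> weighted_L1 e'"
      by (rule M_class_pair_weighted_L1[OF p Mc(2) Mc(2)])
    have Fbd: "morrey_bound p lam (\<lambda>_ _ _. 0) F S"
      using bd by (simp add: F_def morrey_bound_shift[symmetric])
    have "morrey_bound p lam (\<lambda>x r. heat_ext k (r powr m) F) F (2 * (1 + M powr p * ?v) powr (1 / p) * S)"
    proof (rule morrey_bound_perturb[OF Fbd p1 S less_imp_le[OF M(1)]])
      show "F \<in> borel_measurable lebesgue" by (rule weighted_L1_measurable[OF e'(2)])
      show "norm (0 - heat_ext k (r powr m) F y) \<le> M * S * r powr (- ?mu)" if "r > 0" for r y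
        using M(2)[OF e' S _ Fbd, of "r powr m" y] that m_pos by (simp add: powr_powr)
    qed simp
    moreover have "(\<lambda>x. f x - F x) \<in> kernelL g k p"
      by (simp add: F_def kernelL_const)
    ultimately show ?thesis using morreyL_bound_mod_kernelL[OF p Mc] by simp
  qed
  moreover have "1 + M powr p * ?v > 0"
    by (rule add_pos_nonneg) auto
  then have "2 * (1 + M powr p * ?v) powr (1 / p) > 0"
    by simp
  ultimately show thesis by (rule that[rotated])
qed

lemma morreyL_imp_morrey:
  assumes p: "p > 1" and lam: "lam < real DIM('a)"
  obtains C where "C > 0" "\<And>h S. h \<in> M_class p g \<Longrightarrow> S \<ge> 0 \<Longrightarrow>
    morrey_bound p lam (\<lambda>x r. heat_ext k (r powr m) h) h S \<Longrightarrow>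
    \<exists>f\<in>M_class p g. (\<lambda>x. f x - h x) \<in> kernelL g k p \<and> morrey_bound p lam (\<lambda>_ _ _. 0) f (C * S)"
proof -
  have p1: "p \<ge> 1" using p by simp
  obtain e where e: "admissible e" using admissible_exists by blast
  obtain C where C: "C > 0" "\<And>e' h S. admissible e' \<Longrightarrow> h \<in> weighted_L1 e' \<Longrightarrow> S \<ge> 0 \<Longrightarrow>
    morrey_bound p lam (\<lambda>x r. heat_ext k (r powr m) h) h S \<Longrightarrow>
    \<exists>u\<in>weighted_L1 e'. (\<forall>t>0. \<forall>x. heat_ext k t u x = u x) \<and> morrey_bound p lam (\<lambda>_ _. u) h (C * S)"
    by (fact heat_ext_limit[OF e p1 lam])
  have "\<exists>f\<in>M_class p g. (\<lambda>x. f x - h x) \<in> kernelL g k p \<and> morrey_bound p lam (\<lambda>_ _ _. 0) f (C * S)"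
    if h: "h \<in> M_class p g" and S: "S \<ge> 0" and bd: "morrey_bound p lam (\<lambda>x r. heat_ext k (r powr m) h) h S"
    for h S
  proof -
    obtain e' where e': "admissible e'" "h \<in> weighted_L1 e'"
      by (rule M_class_pair_weighted_L1[OF p h h])
    obtain u where u: "u \<in> weighted_L1 e'" "\<And>t x. t > 0 \<Longrightarrow> heat_ext k t u x = u x"
      "morrey_bound p lam (\<lambda>_ _. u) h (C * S)"
      using C(2)[OF e' S bd] by blast
    have [measurable]: "h \<in> borel_measurable lebesgue" "u \<in> borel_measurable lebesgue"
      using e'(2) u(1) by (auto intro: weighted_L1_measurable)
    define f where "f = (\<lambda>x. h x - u x)"
    have fbd: "morrey_bound p lam (\<lambda>_ _ _. 0) f (C * S)"
      using u(3) by (simp add: f_def morrey_bound_def)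
    have fM: "f \<in> M_class p g"
      by (rule morrey_bound_imp_M_class[OF _ fbd]) (simp add: f_def)
    \<comment> \<open>So far u is only known to lie in \<open>weighted_L1 e'\<close>. It belongs to
      the class as the difference of h and the Morrey function f.\<close>
    have "u \<in> M_class p g"
      using M_class_diff[OF p h fM] by (simp add: f_def)
    then have "u \<in> kernelL g k p"
      by (simp add: kernelL_def ae_eq_def u(2))
    then have "(\<lambda>x. f x - h x) \<in> kernelL g k p"
      using kernelL_diff[OF p kernelL_const[of 0]] by (simp add: f_def)
    with fM fbd show ?thesis by blast
  qed
  with C(1) show thesis by (rule that)
qed

section \<open>Assembly in terms of seminorms and quotient spaces\<close>

lemma morrey_spaceE:
  assumes "p \<ge> 1" "f \<in> morrey_space p lam"
  obtains S where "S \<ge> 0" "morrey_seminorm p lam f = ennreal S" "f \<in> Lp_loc p"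
    "morrey_bound p lam (\<lambda>x r y. ball_avg f x r) f S"
proof -
  have "morrey_seminorm p lam f < \<infinity>" "f \<in> Lp_loc p"
    using assms by (auto simp: morrey_space_def)
  moreover from this obtain S where S: "S \<ge> 0" "morrey_seminorm p lam f = ennreal S"
    by (cases "morrey_seminorm p lam f") auto
  moreover have "morrey_bound p lam (\<lambda>x r y. ball_avg f x r) f S"
    using morrey_sup_le_iff[of p S lam "\<lambda>x r y. ball_avg f x r" f] assms(1) S by (simp add: morrey_seminorm_def)
  ultimately show thesis using that by blast
qed

lemma morreyL_spaceE:
  assumes "p \<ge> 1" "h \<in> morreyL_space m g k p lam"
  obtains S where "S \<ge> 0" "morreyL_seminorm m k p lam h = ennreal S" "h \<in> M_class p g"
    "morrey_bound p lam (\<lambda>x r. heat_ext k (r powr m) h) h S"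
proof -
  have "morreyL_seminorm m k p lam h < \<infinity>" "h \<in> M_class p g"
    using assms by (auto simp: morreyL_space_def)
  moreover from this obtain S where S: "S \<ge> 0" "morreyL_seminorm m k p lam h = ennreal S"
    by (cases "morreyL_seminorm m k p lam h") auto
  moreover have "morrey_bound p lam (\<lambda>x r. heat_ext k (r powr m) h) h S"
    using morrey_sup_le_iff[of p S lam "\<lambda>x r. heat_ext k (r powr m) h" h] assms(1) S by (simp add: morreyL_seminorm_def)
  ultimately show thesis using that by blast
qed

theorem morrey_spaces_equivalent:
  assumes p: "p > 1" and lam: "lam < real DIM('a)"
  shows "morrey_spaces_coincide m g k p lam \<and> morrey_norms_equivalent m g k p lam"
proof -
  let ?A = "morrey_space p lam :: ('a \<Rightarrow> complex) set"
  let ?B = "morreyL_space m g k p lam"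
  let ?K = "kernelL g k p"
  have p0: "p > 0" and p1: "p \<ge> 1" using p by auto
  obtain C1 where C1: "C1 > 0" "\<And>f S. f \<in> Lp_loc p \<Longrightarrow> S \<ge> 0 \<Longrightarrow>
      morrey_bound p lam (\<lambda>x r y. ball_avg f x r) f S \<Longrightarrow>
      \<exists>l. morrey_bound p lam (\<lambda>(_::'a) _ _. l) f (C1 * S)"
    using campanato_imp_morrey[OF p1 lam] by blast
  obtain C2 where C2: "C2 > 0" "\<And>f S l. f \<in> Lp_loc p \<Longrightarrow> S \<ge> 0 \<Longrightarrow>
      morrey_bound p lam (\<lambda>(_::'a) _ _. l) f S \<Longrightarrow> morrey_bound p lam (\<lambda>x r y. ball_avg f x r) f (C2 * S)"
    using morrey_imp_campanato[OF p1] by blast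
  obtain C3 where C3: "C3 > 0" "\<And>f l S. f \<in> borel_measurable lebesgue \<Longrightarrow> S \<ge> 0 \<Longrightarrow>
      morrey_bound p lam (\<lambda>_ _ _. l) f S \<Longrightarrow> morrey_bound p lam (\<lambda>x r. heat_ext k (r powr m) f) f (C3 * S)"
    by (fact morrey_imp_morreyL[OF p])
  obtain C4 where C4: "C4 > 0" "\<And>h S. h \<in> M_class p g \<Longrightarrow> S \<ge> 0 \<Longrightarrow>
      morrey_bound p lam (\<lambda>x r. heat_ext k (r powr m) h) h S \<Longrightarrow>
      \<exists>f\<in>M_class p g. (\<lambda>x. f x - h x) \<in> kernelL g k p \<and> morrey_bound p lam (\<lambda>_ _ _. 0) f (C4 * S)"
    by (fact morreyL_imp_morrey[OF p lam])
  have const: "\<exists>l. morrey_bound p lam (\<lambda>_ _ _. l) f (C1 * S) \<and> f \<in> M_class p g"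
    if "f \<in> Lp_loc p" "S \<ge> 0" "morrey_bound p lam (\<lambda>x r y. ball_avg f x r) f S" for f :: "'a \<Rightarrow> complex" and S
    using C1(2)[OF that] morrey_bound_const_M_class(1)[OF p Lp_loc_measurable[OF that(1)]] by blast
  have into: "morrey_bound p lam (\<lambda>x r. heat_ext k (r powr m) f) f (C3 * (C1 * S))"
    if "f \<in> Lp_loc p" "S \<ge> 0" "morrey_bound p lam (\<lambda>x r y. ball_avg f x r) f S" for f S
    using const[OF that] C3(2)[OF Lp_loc_measurable[OF that(1)], of "C1 * S"] C1(1) that(2) by auto
  have sup_le: "morrey_sup p lam a f \<le> ennreal S" if "morrey_bound p lam a f S" "S \<ge> 0"
    for a :: "'a \<Rightarrow> real \<Rightarrow> 'a \<Rightarrow> complex" and f S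
    using morrey_sup_le_iff[OF p0 that(2)] that(1) by blast
  have sub: "?A \<subseteq> ?B"
  proof
    fix f assume "f \<in> ?A"
    then obtain S where S: "S \<ge> 0" "f \<in> Lp_loc p" "morrey_bound p lam (\<lambda>x r y. ball_avg f x r) f S"
      by (rule morrey_spaceE[OF p1])
    have "morreyL_seminorm m k p lam f \<le> ennreal (C3 * (C1 * S))"
      unfolding morreyL_seminorm_def using C1(1) C3(1) S(1) by (intro sup_le into[OF S(2,1,3)]) simp
    then have "morreyL_seminorm m k p lam f < \<infinity>" by (simp add: le_less_trans)
    then show "f \<in> ?B" using const[OF S(2,1,3)] by (auto simp: morreyL_space_def)
  qed
  have rep: "\<exists>f\<in>?A. (\<lambda>x. f x - h x) \<in> ?K"
    if h: "h \<in> M_class p g" and S: "S \<ge> 0" and bd: "morrey_bound p lam (\<lambda>x r. heat_ext k (r powr m) h) h S" for h S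
  proof -
    obtain f where f: "f \<in> M_class p g" "(\<lambda>x. f x - h x) \<in> ?K" "morrey_bound p lam (\<lambda>_ _ _. 0) f (C4 * S)"
      using C4(2)[OF h S bd] by blast
    have fL: "f \<in> Lp_loc p" by (rule M_class_Lp_loc[OF f(1)])
    have "morrey_seminorm p lam f \<le> ennreal (C2 * (C4 * S))"
      unfolding morrey_seminorm_def using C2(1) C4(1) S by (intro sup_le C2(2)[OF fL _ f(3)]) simp_all
    then have "morrey_seminorm p lam f < \<infinity>" by (simp add: le_less_trans)
    then have "f \<in> ?A" using fL by (simp add: morrey_space_def)
    with f(2) show ?thesis by blast
  qed
  have const_diff: "(\<lambda>x. f x - h x) \<in> const_fns"
    if f: "f \<in> ?A" and h: "h \<in> ?A" and K: "(\<lambda>x. f x - h x) \<in> ?K" for f h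
  proof -
    obtain S where S: "S \<ge> 0" "f \<in> Lp_loc p" "morrey_bound p lam (\<lambda>x r y. ball_avg f x r) f S"
      using f by (rule morrey_spaceE[OF p1])
    obtain S' where S': "S' \<ge> 0" "h \<in> Lp_loc p" "morrey_bound p lam (\<lambda>x r y. ball_avg h x r) h S'"
      using h by (rule morrey_spaceE[OF p1])
    obtain l l' where l: "morrey_bound p lam (\<lambda>_ _ _. l) f (C1 * S)" "morrey_bound p lam (\<lambda>_ _ _. l') h (C1 * S')"
      using const[OF S(2,1,3)] const[OF S'(2,1,3)] by blast
    have "AE x in lebesgue. f x - h x = l - l'"
      by (rule kernelL_morrey_const[OF p lam _ _ Lp_loc_measurable[OF S(2)] l(1) Lp_loc_measurable[OF S'(2)] l(2) K])
        (use C1(1) S(1) S'(1) in auto)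
    then show ?thesis by (auto simp: const_fns_def ae_eq_def)
  qed
  have A_M: "f \<in> M_class p g" if "f \<in> ?A" for f
    using sub that by (auto simp: morreyL_space_def)
  have "bij_betw (\<lambda>X. mod_rel ?B ?K `` X) (?A // mod_rel ?A const_fns) (?B // mod_rel ?B ?K)"
  proof (rule bij_betw_quotients[OF _ _ sub])
    show "equiv ?A (mod_rel ?A const_fns)"
      by (rule equiv_mod_rel[OF const_fns_0 const_fns_diff])
    show "equiv ?B (mod_rel ?B ?K)"
      by (rule equiv_mod_rel[OF kernelL_const kernelL_diff[OF p]])
    show "(f, h) \<in> mod_rel ?A const_fns \<longleftrightarrow> (f, h) \<in> mod_rel ?B ?K" if "f \<in> ?A" "h \<in> ?A" for f h
    proof -
      have "(\<lambda>x. f x - h x) \<in> ?K" if "(\<lambda>x. f x - h x) \<in> const_fns"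
        using const_fns_imp_kernelL[OF M_class_diff[OF p A_M A_M]] \<open>f \<in> ?A\<close> \<open>h \<in> ?A\<close> that by blast
      then show ?thesis using that sub const_diff[OF that] by (auto simp: mod_rel_def)
    qed
    show "\<exists>f\<in>?A. (f, h) \<in> mod_rel ?B ?K" if h: "h \<in> ?B" for h
    proof -
      obtain S where S: "S \<ge> 0" "h \<in> M_class p g" "morrey_bound p lam (\<lambda>x r. heat_ext k (r powr m) h) h S"
        using h by (rule morreyL_spaceE[OF p1])
      show ?thesis using rep[OF S(2,1,3)] sub h by (auto simp: mod_rel_def)
    qed
  qed
  then have coincide: "morrey_spaces_coincide m g k p lam"
    using sub by (simp add: morrey_spaces_coincide_def)
  \<comment> \<open>The product \<open>C3 * C1\<close> leads from Campanato through Morrey to the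
    L-seminorm; \<open>C2 * C4\<close> leads from the L-seminorm through its Morrey representative
    back to Campanato.\<close>
  define C where "C = max (C3 * C1) (C2 * C4)"
  have C: "C > 0" "C3 * C1 \<le> C" "C2 * C4 \<le> C" using C1(1) C3(1) by (auto simp: C_def less_max_iff_disj)
  have "morreyL_seminorm m k p lam h \<le> ennreal C * morrey_seminorm p lam f \<and>
      morrey_seminorm p lam f \<le> ennreal C * morreyL_seminorm m k p lam h"
    if f: "f \<in> ?A" and h: "h \<in> ?B" and K: "(\<lambda>x. f x - h x) \<in> ?K" for f h
  proof
    obtain S where S: "S \<ge> 0" "morrey_seminorm p lam f = ennreal S" "f \<in> Lp_loc p"
      "morrey_bound p lam (\<lambda>x r y. ball_avg f x r) f S"
      using f by (rule morrey_spaceE[OF p1])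
    obtain S' where S': "S' \<ge> 0" "morreyL_seminorm m k p lam h = ennreal S'" "h \<in> M_class p g"
      "morrey_bound p lam (\<lambda>x r. heat_ext k (r powr m) h) h S'"
      using h by (rule morreyL_spaceE[OF p1])
    \<comment> \<open>The bound is proved for f and transferred to h, since f - h lies in the
      kernel.\<close>
    have "morrey_bound p lam (\<lambda>x r. heat_ext k (r powr m) h) h (C3 * (C1 * S))"
      using into[OF S(3,1,4)] morreyL_bound_mod_kernelL[OF p A_M[OF f] S'(3) K] by simp
    then have "morreyL_seminorm m k p lam h \<le> ennreal (C3 * (C1 * S))"
      unfolding morreyL_seminorm_def using C1(1) C3(1) S(1) by (intro sup_le) simp_all
    also have "\<dots> \<le> ennreal (C * S)"
      using mult_right_mono[OF C(2) S(1)] by (intro ennreal_leI) (simp add: mult.assoc)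
    also have "\<dots> = ennreal C * morrey_seminorm p lam f"
      using C(1) S by (simp add: ennreal_mult)
    finally show "morreyL_seminorm m k p lam h \<le> ennreal C * morrey_seminorm p lam f" .
    \<comment> \<open>The Morrey representative f' of h has its size controlled by h. Both f and f'
      are Morrey up to constants, and they agree modulo the kernel, so f - l = f' almost everywhere
      and the bound passes to f.\<close>
    obtain f' where f': "f' \<in> M_class p g" "(\<lambda>x. f' x - h x) \<in> ?K" "morrey_bound p lam (\<lambda>_ _ _. 0) f' (C4 * S')"
      using C4(2)[OF S'(3,1,4)] by blast
    obtain l where l: "morrey_bound p lam (\<lambda>_ _ _. l) f (C1 * S)"
      using const[OF S(3,1,4)] by blast
    have K': "(\<lambda>x. f x - f' x) \<in> ?K"
      using kernelL_diff[OF p K f'(2)] by simp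
    have "AE x in lebesgue. f x - f' x = l - 0"
      by (rule kernelL_morrey_const[OF p lam _ _ Lp_loc_measurable[OF S(3)] l M_class_measurable[OF f'(1)] f'(3) K'])
        (use C1(1) C4(1) S(1) S'(1) in auto)
    then have "AE x in lebesgue. f x - l = f' x - 0"
      by eventually_elim (simp add: algebra_simps)
    then have "morrey_bound p lam (\<lambda>_ _ _. l) f (C4 * S')"
      using f'(3) morrey_bound_cong_AE[of f "\<lambda>_ _ _. l" f' "\<lambda>_ _ _. 0" p lam "C4 * S'"] by simp
    then have "morrey_seminorm p lam f \<le> ennreal (C2 * (C4 * S'))"
      unfolding morrey_seminorm_def using C2(1) C4(1) S'(1) by (intro sup_le C2(2)[OF S(3)]) simp_all
    also have "\<dots> \<le> ennreal (C * S')"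
      using mult_right_mono[OF C(3) S'(1)] by (intro ennreal_leI) (simp add: mult.assoc)
    also have "\<dots> = ennreal C * morreyL_seminorm m k p lam h"
      using C(1) S' by (simp add: ennreal_mult)
    finally show "morrey_seminorm p lam f \<le> ennreal C * morreyL_seminorm m k p lam h" .
  qed
  then have "morrey_norms_equivalent m g k p lam"
    using C(1) unfolding morrey_norms_equivalent_def by blast
  with coincide show ?thesis ..
qed

end

theorem proposition5p6:
  fixes p lam \<omega> m \<beta> \<gamma> c :: real
    and D :: "((real ^ 'n) \<Rightarrow> complex) set"
    and L :: "((real ^ 'n) \<Rightarrow> complex) \<Rightarrow> (real ^ 'n) \<Rightarrow> complex"
    and T :: "complex \<Rightarrow> ((real ^ 'n) \<Rightarrow> complex) \<Rightarrow> (real ^ 'n) \<Rightarrow> complex"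
    and g :: "real \<Rightarrow> real"
    and k :: "real \<Rightarrow> (real ^ 'n) \<Rightarrow> (real ^ 'n) \<Rightarrow> complex"
  assumes "1 < p"
    and "0 < lam" and "lam < real CARD('n)"
    and "0 \<le> \<omega>" and "\<omega> < pi / 2"
    and "op_type \<omega> D L"
    and "generates_analytic_semigroup (pi / 2 - \<omega>) D L T"
    and "heat_kernel_bounds T m g k"
    and "\<And>t. t > 0 \<Longrightarrow> \<exists>\<alpha> A. 0 < \<alpha> \<and> \<alpha> \<le> 1 \<and>
           (\<forall>x y x' y'. norm (k t x y - k t x' y') \<le> A * dist (x, y) (x', y') powr \<alpha>)"
    and "\<beta> > 0" and "0 < \<gamma>" and "\<gamma> \<le> 1" and "c > 0"
    and "\<And>t x y. t > 0 \<Longrightarrow>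
           norm (k t x y) \<le>
             c * (t powr (\<beta> / m) / (t powr (1 / m) + norm (x - y)) powr (real CARD('n) + \<beta>))"
    and "\<And>t x y h. t > 0 \<Longrightarrow> 2 * norm h \<le> t powr (1 / m) + norm (x - y) \<Longrightarrow>
           norm (k t (x + h) y - k t x y) + norm (k t x (y + h) - k t x y) \<le>
             c * norm h powr \<gamma> *
             (t powr (\<beta> / m) / (t powr (1 / m) + norm (x - y)) powr (real CARD('n) + \<beta> + \<gamma>))"
    and "\<And>t y. t > 0 \<Longrightarrow> integral\<^sup>L lebesgue (\<lambda>x. k t x y) = 1"
    and "\<And>t x. t > 0 \<Longrightarrow> integral\<^sup>L lebesgue (\<lambda>y. k t x y) = 1"
  shows "morrey_spaces_coincide m g k p lam \<and> morrey_norms_equivalent m g k p lam"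
proof -
  \<comment> \<open>The Hoelder estimate at fixed time yields the joint continuity that the locale
    asks for.\<close>
  have cont: "continuous_on UNIV (\<lambda>z. k t (fst z) (snd z))" if t: "t > 0" for t
  proof -
    obtain \<alpha> A where \<alpha>: "0 < \<alpha>"
      and hoelder: "\<And>x y x' y'. norm (k t x y - k t x' y') \<le> A * dist (x, y) (x', y') powr \<alpha>"
      using assms(9)[OF t] by blast
    have "((\<lambda>z. k t (fst z) (snd z) - k t (fst w) (snd w)) \<longlongrightarrow> 0) (at w)" for w
    proof (rule Lim_null_comparison)
      have "((\<lambda>z. dist z w) \<longlongrightarrow> 0) (at w)"
        using tendsto_dist[OF tendsto_ident_at[of w UNIV] tendsto_const[of w]] by simp
      then show "((\<lambda>z. A * dist z w powr \<alpha>) \<longlongrightarrow> 0) (at w)"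
        using \<alpha> by (intro tendsto_mult_right_zero tendsto_zero_powrI[where b = \<alpha>]) auto
      show "\<forall>\<^sub>F z in at w. norm (k t (fst z) (snd z) - k t (fst w) (snd w)) \<le> A * dist z w powr \<alpha>"
        using hoelder by (intro always_eventually) (metis prod.collapse)
    qed
    then show ?thesis by (simp add: continuous_on_def LIM_zero_iff)
  qed
  interpret heat_semigroup m "pi / 2 - \<omega>" g D L T k
    using assms(5,7,8,17) cont by unfold_locales auto
  show ?thesis
    using assms(1,3) by (intro morrey_spaces_equivalent) auto
qed

end
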